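(* Let $\beta_1,\beta_2>0$, $\beta_1\ne\beta_2$. Let $u$ be a continuous function on $[0,\infty)^2$ and let $\chi,\psi:[0,\infty)\to\mathbb R$ be continuously differentiable with $\chi(0)=\psi(0)=0$; extend $\chi,\psi$ to negative arguments as identical zeros. Let $\phi$ be the solution of the telegraph equation $$\phi_{XY}(X,Y)+\beta_1\phi_Y(X,Y)+\beta_2\phi_X(X,Y)=u(X,Y),\qquad X,Y>0,$$ with boundary conditions $\phi(x,0)=\chi(x)$, $\phi(0,y)=\psi(y)$. For $X,Y>0$ consider two independent persistent Poisson paths $\mathcal T_-$ and $\mathcal T_|$ leaving $(X,Y)$ horizontally and vertically, respectively. Let $\mathbf y$ be the ordinate of the first intersection of $\mathcal T_-$ with the $y$-axis, and let $\mathbf x$ be the abscissa of the first intersection of $\mathcal T_|$ with the $x$-axis. Further, for any point $(x,y)\in\mathbb R_{>0}^2$ define $$\mathcal I_{\mathrm{between}}(x,y)=\begin{cases}1,&(x,y)\text{ is between }\mathcal T_-\text{ and }\mathcal T_|\text{ with }\mathcal T_-\text{ above},\\-1,&(x,y)\text{ is between }\mathcal T_-\text{ and }\mathcal T_|\text{ with }\mathcal T_-\text{ below},\\0,&\text{otherwise.}\end{cases}$$ Then $$\phi(X,Y)=\mathbb E\chi(\mathbf x)+\mathbb E\psi(\mathbf y)+\mathbb E\left[\int_0^X\int_0^Y\mathcal I_{\mathrm{between}}(x,y)\,u(x,y)\,dx\,dy\right].$$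
   Context: **Persistent Poisson random walk (path).** A random continuous path in $\mathbb R^2$ that starts from $(X,Y)$ and moves along vertical and horizontal directions, to the left or down. Whenever it moves horizontally (to the left), it turns down with intensity $\beta_1$ (i.e. after an independent exponentially distributed length with rate $\beta_1$). Whenever it moves vertically (down), it turns to the left with intensity $\beta_2$. $\mathcal T_-$ denotes the path whose initial direction is horizontal, $\mathcal T_|$ the path whose initial direction is vertical. The paths continue past the coordinate axes, so $\mathbf x$ and $\mathbf y$ may be negative. **Between.** Each of the two paths splits the region $\{(x,y):x<X,\ y<Y\}$ into an upper-left part and a lower-right part. A point $(x,y)$ is between the paths with $\mathcal T_-$ above if it lies in the lower-right part for $\mathcal T_-$ and in the upper-left part for $\mathcal T_|$; it is between the paths with $\mathcal T_-$ below if it lies in the upper-left part for $\mathcal T_-$ and in the lower-right part for $\mathcal T_|$. **Solution.** For continuous $u$ and continuously differentiable $\chi,\psi$ with $\chi(0)=\psi(0)$ the boundary value problem consisting of the equation $\phi_{XY}+\beta_1\phi_Y+\beta_2\phi_X=u$ for $X,Y>0$ and the boundary conditions $\phi(x,0)=\chi(x)$, $\phi(0,y)=\psi(y)$ has a unique continuous solution $\phi$ with continuous mixed derivative $\phi_{XY}$. *)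

theory Defs
  imports "HOL-Probability.Probability"
begin

datatype direction = Horizontal | Vertical

fun turn :: "direction \<Rightarrow> direction" where
  "turn Horizontal = Vertical"
| "turn Vertical = Horizontal"

text \<open>A path is encoded by its starting point, its initial direction and the lengths
  \<open>L 0, L 1, \<dots>\<close> of its successive straight segments, whose directions alternate.\<close>

definition segment_dir :: "direction \<Rightarrow> nat \<Rightarrow> direction" where
  "segment_dir d n = (if even n then d else turn d)"

definition step :: "direction \<Rightarrow> real \<times> real" where
  "step d = (case d of Horizontal \<Rightarrow> (-1, 0) | Vertical \<Rightarrow> (0, -1))"

definition turn_time :: "(nat \<Rightarrow> real) \<Rightarrow> nat \<Rightarrow> real" where
  "turn_time L n = (\<Sum>k<n. L k)"

definition turn_point :: "real \<times> real \<Rightarrow> direction \<Rightarrow> (nat \<Rightarrow> real) \<Rightarrow> nat \<Rightarrow> real \<times> real" where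
  "turn_point P d L n = P + (\<Sum>k<n. L k *\<^sub>R step (segment_dir d k))"

text \<open>The path parametrised by the travelled length \<open>t \<ge> 0\<close>. For exponential lengths, almost
  surely all \<open>L n\<close> are positive and \<open>turn_time L\<close> is unbounded, so the index \<open>n\<close> of the
  current segment exists for every \<open>t\<close> and the path is continuous.\<close>

definition walk :: "real \<times> real \<Rightarrow> direction \<Rightarrow> (nat \<Rightarrow> real) \<Rightarrow> real \<Rightarrow> real \<times> real" where
  "walk P d L t =
     (let n = (LEAST n. t < turn_time L (Suc n))
      in turn_point P d L n + (t - turn_time L n) *\<^sub>R step (segment_dir d n))"

text \<open>The segment lengths of a persistent Poisson walk with initial direction \<open>d\<close>.\<close>

definition poisson_lengths ::
    "'a measure \<Rightarrow> real \<Rightarrow> real \<Rightarrow> direction \<Rightarrow> (nat \<Rightarrow> 'a \<Rightarrow> real) \<Rightarrow> bool" where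
  "poisson_lengths M \<beta>1 \<beta>2 d L \<longleftrightarrow>
     prob_space.indep_vars M (\<lambda>_. borel) L UNIV \<and>
     (\<forall>n. distributed M lborel (L n)
        (exponential_density
          (case segment_dir d n of Horizontal \<Rightarrow> \<beta>1 | Vertical \<Rightarrow> \<beta>2)))"

definition first_y_axis_ordinate :: "(real \<Rightarrow> real \<times> real) \<Rightarrow> real" where
  "first_y_axis_ordinate T = snd (T (Inf {t. 0 \<le> t \<and> fst (T t) = 0}))"

definition first_x_axis_abscissa :: "(real \<Rightarrow> real \<times> real) \<Rightarrow> real" where
  "first_x_axis_abscissa T = fst (T (Inf {t. 0 \<le> t \<and> snd (T t) = 0}))"

text \<open>The two parts into which a left-down path \<open>T\<close> starting from \<open>P\<close> splits the open quadrant
  to the lower left of \<open>P\<close>: since \<open>T\<close> meets each vertical line in a segment, a point off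
  the path is in the upper-left part iff the path passes below it.\<close>

definition upper_left :: "real \<times> real \<Rightarrow> (real \<Rightarrow> real \<times> real) \<Rightarrow> (real \<times> real) set" where
  "upper_left P T = {(x, y). x < fst P \<and> y < snd P \<and> (x, y) \<notin> T ` {0..} \<and>
     (\<exists>y'<y. (x, y') \<in> T ` {0..})}"

definition lower_right :: "real \<times> real \<Rightarrow> (real \<Rightarrow> real \<times> real) \<Rightarrow> (real \<times> real) set" where
  "lower_right P T = {(x, y). x < fst P \<and> y < snd P \<and> (x, y) \<notin> T ` {0..} \<and>
     (\<exists>y'>y. (x, y') \<in> T ` {0..})}"

text \<open>\<open>Th\<close> is the path leaving \<open>P\<close> horizontally, \<open>Tv\<close> the one leaving it vertically.\<close>

definition I_between ::
    "real \<times> real \<Rightarrow> (real \<Rightarrow> real \<times> real) \<Rightarrow> (real \<Rightarrow> real \<times> real) \<Rightarrow> real \<Rightarrow> real \<Rightarrow> real" where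
  "I_between P Th Tv x y =
     (if (x, y) \<in> lower_right P Th \<inter> upper_left P Tv then 1
      else if (x, y) \<in> upper_left P Th \<inter> lower_right P Tv then -1
      else 0)"

definition C1_on_nonneg :: "(real \<Rightarrow> real) \<Rightarrow> bool" where
  "C1_on_nonneg f \<longleftrightarrow>
     (\<exists>f'. (\<forall>x\<ge>0. (f has_real_derivative f' x) (at x within {0..})) \<and> continuous_on {0..} f')"

definition zero_ext :: "(real \<Rightarrow> real) \<Rightarrow> real \<Rightarrow> real" where
  "zero_ext f x = (if x < 0 then 0 else f x)"

text \<open>Continuity of \<open>\<phi>\<close> is required on the closed quadrant, differentiability and continuity
  of the mixed derivative only on the open one, where the equation is posed.\<close>

definition telegraph_solution ::
    "real \<Rightarrow> real \<Rightarrow> (real \<Rightarrow> real \<Rightarrow> real) \<Rightarrow> (real \<Rightarrow> real) \<Rightarrow> (real \<Rightarrow> real)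
      \<Rightarrow> (real \<Rightarrow> real \<Rightarrow> real) \<Rightarrow> bool" where
  "telegraph_solution \<beta>1 \<beta>2 u chi psi \<phi> \<longleftrightarrow>
     continuous_on ({0..} \<times> {0..}) (\<lambda>(x, y). \<phi> x y) \<and>
     (\<exists>\<phi>X \<phi>Y \<phi>XY.
        (\<forall>X>0. \<forall>Y>0.
           ((\<lambda>x. \<phi> x Y) has_real_derivative \<phi>X X Y) (at X) \<and>
           ((\<lambda>y. \<phi> X y) has_real_derivative \<phi>Y X Y) (at Y) \<and>
           ((\<lambda>y. \<phi>X X y) has_real_derivative \<phi>XY X Y) (at Y) \<and>
           \<phi>XY X Y + \<beta>1 * \<phi>Y X Y + \<beta>2 * \<phi>X X Y = u X Y) \<and>
        continuous_on ({0<..} \<times> {0<..}) (\<lambda>(x, y). \<phi>XY x y)) \<and>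
     (\<forall>x\<ge>0. \<phi> x 0 = chi x) \<and>
     (\<forall>y\<ge>0. \<phi> 0 y = psi y)"

end

theory Submission
  imports Defs
begin

text \<open>
Write $a = \beta_2$ and $b = \beta_1$ for the turning rates of vertical and horizontal segments.
The proof compares the two sides of the formula through the integral equation
\[ F(X,Y) + b \int_0^X F(x,Y)\,dx + a \int_0^Y F(X,y)\,dy = G(X,Y), \]
whose bounded solutions are unique by a Gronwall argument (\<open>homogeneous_integral_equation_zero\<close>).

For the solution \<open>\<phi>\<close> this equation is the telegraph equation integrated over $[p,X]\times[q,Y]$,
followed by $p,q \to 0$ (\<open>telegraph_rectangle\<close>, \<open>telegraph_integral_equation\<close>); its right-hand side is
$\chi(X) + \psi(Y) + b\int_0^X\chi + a\int_0^Y\psi + \int_0^X\int_0^Y u$.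

For the expectations, the first segment of a path is split off (\<open>walk_case_nat\<close>,
\<open>length_law_first_step\<close>). A functional of the path that is determined by the first segment or else
passes to the remaining path has an expectation $V$ for a vertical start and $H$ for a horizontal
start, and these satisfy $V(X,Y) = h(X) + a\int_0^Y (H - V)(X,y)\,dy$ and
$H(X,Y) = b\int_0^X (V - H)(x,Y)\,dx$ (locale \<open>renewal_pair\<close>). Eliminating $H$ gives the integral
equation for $V$ with right-hand side $h(X) + b\int_0^X h$. With $h = \chi$ this is the term of \<open>chi\<close>;
the term of \<open>psi\<close> follows by reflection in the diagonal, which exchanges the two rates.

For the term of \<open>u\<close>, let $p$ and $q$ be 1 or 0 according to whether a point off the paths is in the
upper-left part for $\mathcal T_-$ and for $\mathcal T_|$. The other part is the complement, so
$\mathcal I_{\rm between} = (1-p)q - p(1-q) = q - p$ (\<open>I_between_off_paths\<close>). Its expectation is a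
difference of two one-path probabilities, a function $D(X-x,Y-y)$. The renewal system with
$h = 1$ yields $D + b\int_0^X D + a\int_0^Y D = 1$ (\<open>passes_below_difference_equation\<close>), and superposing
translates of $D$ with weight \<open>u\<close> gives the integral equation with right-hand side
$\int_0^X\int_0^Y u$ (\<open>superposition_integral_equation\<close>).

Integrability also asks for measurability on the null set where lengths are negative or the path
gets stuck. There the quantifiers over all times in the definitions are reduced to countably many
times (\<open>crossing_iff_candidate\<close>).
\<close>

section \<open>Paths with prescribed segment lengths\<close>

text \<open>Indexing the coordinates by directions lets one proof serve abscissae and ordinates alike.\<close>

definition coord :: "direction \<Rightarrow> real \<times> real \<Rightarrow> real" where
  "coord d p = (case d of Horizontal \<Rightarrow> fst p | Vertical \<Rightarrow> snd p)"

text \<open>The almost sure event on which a path looks as expected. Segments with even index have the initial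
  direction and those with odd index the other one, so both coordinates tend to minus infinity.\<close>

definition regular :: "(nat \<Rightarrow> real) \<Rightarrow> bool" where
  "regular L \<longleftrightarrow> (\<forall>n. 0 < L n) \<and> (\<forall>c. \<exists>n. c < (\<Sum>k<n. L (2 * k)))
     \<and> (\<forall>c. \<exists>n. c < (\<Sum>k<n. L (Suc (2 * k))))"

lemma turn_turn [simp]: "turn (turn d) = d"
  by (cases d) auto

lemma turn_neq [simp]: "turn d \<noteq> d" "d \<noteq> turn d"
  by (cases d; simp)+

lemma neq_iff_turn: "d' \<noteq> d \<longleftrightarrow> d' = turn d"
  by (cases d; cases d') auto

lemma segment_dir_0 [simp]: "segment_dir d 0 = d"
  by (simp add: segment_dir_def)

lemma segment_dir_Suc: "segment_dir d (Suc n) = segment_dir (turn d) n"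
  by (simp add: segment_dir_def)

lemma turn_segment_dir: "turn (segment_dir d n) = segment_dir (turn d) n"
  by (simp add: segment_dir_def)

lemma coord_add [simp]: "coord d (p + q) = coord d p + coord d q"
  and coord_diff [simp]: "coord d (p - q) = coord d p - coord d q"
  and coord_scaleR [simp]: "coord d (c *\<^sub>R p) = c * coord d p"
  and coord_zero [simp]: "coord d 0 = 0"
  by (auto simp: coord_def split: direction.splits)

lemma coord_step: "coord e (step d) = (if d = e then - 1 else 0)"
  by (cases d; cases e) (auto simp: coord_def step_def)

lemma step_swap: "prod.swap (step d) = step (turn d)"
  by (cases d) (auto simp: step_def)

lemma coord_simps: "coord Horizontal p = fst p" "coord Vertical p = snd p"
  by (auto simp: coord_def)

lemma turn_time_0 [simp]: "turn_time L 0 = 0"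
  and turn_time_Suc: "turn_time L (Suc n) = turn_time L n + L n"
  by (simp_all add: turn_time_def)

lemma turn_point_0 [simp]: "turn_point P d L 0 = P"
  and turn_point_Suc: "turn_point P d L (Suc n) = turn_point P d L n + L n *\<^sub>R step (segment_dir d n)"
  by (simp_all add: turn_point_def algebra_simps)

lemma regular_pos: "regular L \<Longrightarrow> 0 < L n"
  by (simp add: regular_def)

lemma regular_even_sum: "regular L \<Longrightarrow> \<exists>n. c < (\<Sum>k<n. L (2 * k))"
  and regular_odd_sum: "regular L \<Longrightarrow> \<exists>n. c < (\<Sum>k<n. L (Suc (2 * k)))"
  by (simp_all add: regular_def)

lemma turn_time_mono: "regular L \<Longrightarrow> m \<le> n \<Longrightarrow> turn_time L m \<le> turn_time L n"
  by (rule lift_Suc_mono_le) (auto simp: turn_time_Suc regular_pos less_imp_le)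

lemma turn_time_split_parity:
  "turn_time L (2 * n) = (\<Sum>k<n. L (2 * k)) + (\<Sum>k<n. L (Suc (2 * k)))"
  by (induction n) (auto simp: turn_time_Suc)

lemma turn_time_unbounded:
  assumes "regular L"
  shows "\<exists>n. c < turn_time L n"
proof -
  obtain n where "c < (\<Sum>k<n. L (2 * k))"
    using regular_even_sum[OF assms] by blast
  moreover have "0 \<le> (\<Sum>k<n. L (Suc (2 * k)))"
    using assms by (intro sum_nonneg) (auto simp: regular_pos less_imp_le)
  ultimately have "c < turn_time L (2 * n)"
    by (simp add: turn_time_split_parity)
  then show ?thesis ..
qed

lemma segment_at_time:
  assumes "regular L" "0 \<le> t"
  obtains n where "turn_time L n \<le> t" "t < turn_time L (Suc n)"
proof -
  define n where "n = (LEAST n. t < turn_time L (Suc n))"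
  obtain m where "t < turn_time L m"
    using turn_time_unbounded[OF assms(1)] by blast
  then have "t < turn_time L (Suc m)"
    using turn_time_mono[OF assms(1), of m "Suc m"] by auto
  then have 1: "t < turn_time L (Suc n)"
    unfolding n_def by (rule LeastI)
  have "turn_time L n \<le> t"
  proof (cases n)
    case (Suc k)
    then have "\<not> t < turn_time L (Suc k)"
      unfolding n_def by (metis lessI not_less_Least)
    then show ?thesis using Suc by simp
  qed (use assms in simp)
  with 1 that show ?thesis by blast
qed

lemma walk_on_segment:
  assumes "regular L" "turn_time L n \<le> t" "t < turn_time L (Suc n)"
  shows "walk P d L t = turn_point P d L n + (t - turn_time L n) *\<^sub>R step (segment_dir d n)"
proof -
  have "(LEAST n. t < turn_time L (Suc n)) = n"
  proof (rule Least_equality)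
    fix m assume m: "t < turn_time L (Suc m)"
    show "n \<le> m"
    proof (rule ccontr)
      assume "\<not> n \<le> m"
      then have "turn_time L (Suc m) \<le> turn_time L n"
        by (intro turn_time_mono assms) auto
      with m assms show False by simp
    qed
  qed fact
  then show ?thesis by (simp add: walk_def)
qed

lemma coord_turn_point_Suc:
  "coord e (turn_point P d L (Suc n)) =
     coord e (turn_point P d L n) - (if segment_dir d n = e then L n else 0)"
  by (simp add: turn_point_Suc coord_step)

lemma coord_turn_point_antimono:
  assumes "regular L" "m \<le> n"
  shows "coord e (turn_point P d L n) \<le> coord e (turn_point P d L m)"
  using assms(2)
  by (rule lift_Suc_antimono_le[rotated])
     (auto simp: coord_turn_point_Suc regular_pos[OF assms(1)] less_imp_le)

lemma coord_turn_point_even: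
  "coord e (turn_point P d L (2 * n)) = coord e P -
     (if d = e then \<Sum>k<n. L (2 * k) else \<Sum>k<n. L (Suc (2 * k)))"
  by (induction n) (auto simp: coord_turn_point_Suc segment_dir_def neq_iff_turn)

lemma coord_turn_point_unbounded:
  assumes "regular L"
  shows "\<exists>n. coord e (turn_point P d L n) < c"
proof -
  have "\<exists>n. coord e P - c < (if d = e then \<Sum>k<n. L (2 * k) else \<Sum>k<n. L (Suc (2 * k)))"
  proof (cases "d = e")
    case True
    then show ?thesis using regular_even_sum[OF assms] by (simp only: if_True simp_thms)
  next
    case False
    then show ?thesis using regular_odd_sum[OF assms] by (simp only: if_False simp_thms)
  qed
  then obtain n where "coord e P - c < (if d = e then \<Sum>k<n. L (2 * k) else \<Sum>k<n. L (Suc (2 * k)))" ..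
  then have "coord e (turn_point P d L (2 * n)) < c"
    by (subst coord_turn_point_even) linarith
  then show ?thesis ..
qed

lemma coord_walk_segment_bounds:
  assumes "regular L" "turn_time L n \<le> t" "t < turn_time L (Suc n)"
  shows "coord e (walk P d L t) \<le> coord e (turn_point P d L n)"
    and "coord e (turn_point P d L (Suc n)) \<le> coord e (walk P d L t)"
  using assms(2,3) by (auto simp: walk_on_segment[OF assms] coord_turn_point_Suc coord_step turn_time_Suc)

lemma coord_walk_antimono:
  assumes L: "regular L" and t: "0 \<le> t" "t \<le> t'"
  shows "coord e (walk P d L t') \<le> coord e (walk P d L t)"
proof -
  obtain n where n: "turn_time L n \<le> t" "t < turn_time L (Suc n)"
    using segment_at_time[OF L t(1)] .
  obtain m where m: "turn_time L m \<le> t'" "t' < turn_time L (Suc m)"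
    using segment_at_time[OF L, of t'] t by auto
  have "n \<le> m"
  proof (rule ccontr)
    assume "\<not> n \<le> m"
    then have "turn_time L (Suc m) \<le> turn_time L n"
      by (intro turn_time_mono L) auto
    with n m t show False by linarith
  qed
  show ?thesis
  proof (cases "n = m")
    case True
    with m have m': "turn_time L n \<le> t'" "t' < turn_time L (Suc n)" by auto
    show ?thesis
      using t by (auto simp: walk_on_segment[OF L n] walk_on_segment[OF L m'] coord_step)
  next
    case False
    with \<open>n \<le> m\<close> have "coord e (turn_point P d L m) \<le> coord e (turn_point P d L (Suc n))"
      by (intro coord_turn_point_antimono L) auto
    with coord_walk_segment_bounds(2)[OF L n] coord_walk_segment_bounds(1)[OF L m]
    show ?thesis by (meson order_trans)
  qed
qed

lemma walk_0: "regular L \<Longrightarrow> walk P d L 0 = P"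
  by (subst walk_on_segment[of L 0]) (auto simp: turn_time_Suc regular_pos)

lemma coord_walk_le: "regular L \<Longrightarrow> 0 \<le> t \<Longrightarrow> coord e (walk P d L t) \<le> coord e P"
  using coord_walk_antimono[of L 0 t] by (simp add: walk_0)

text \<open>The level is reached on the first segment whose end is not above it. That segment starts above the
  level, hence moves in direction \<open>e\<close>, and the hitting time is explicit.\<close>

lemma first_hit_exists:
  assumes L: "regular L" and y: "y \<le> coord e P"
  obtains t where "0 \<le> t" "coord e (walk P d L t) = y"
    "\<And>s. 0 \<le> s \<Longrightarrow> s < t \<Longrightarrow> y < coord e (walk P d L s)"
proof (cases "y = coord e P")
  case True
  with that[of 0] show ?thesis by (simp add: walk_0[OF L])
next
  case False
  let ?c = "\<lambda>n. coord e (turn_point P d L n)"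
  define n where "n = (LEAST n. ?c (Suc n) \<le> y)"
  obtain m where "?c m < y"
    using coord_turn_point_unbounded[OF L] by blast
  moreover have "?c (Suc m) \<le> ?c m"
    by (intro coord_turn_point_antimono L) simp
  ultimately have "?c (Suc m) \<le> y" by linarith
  then have n1: "?c (Suc n) \<le> y"
    unfolding n_def by (rule LeastI)
  have before: "y < ?c (Suc k)" if "k < n" for k
    using not_less_Least[of k "\<lambda>n. ?c (Suc n) \<le> y"] that by (simp add: n_def)
  have n2: "y < ?c n"
    using before[of "n - 1"] False y by (cases n) auto
  have dir: "segment_dir d n = e"
    using n1 n2 by (auto simp: coord_turn_point_Suc split: if_splits)
  define t where "t = turn_time L n + (?c n - y)"
  have t: "turn_time L n < t" "t \<le> turn_time L (Suc n)"
    using n1 n2 by (auto simp: t_def coord_turn_point_Suc dir turn_time_Suc)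
  have "0 \<le> turn_time L n"
    using turn_time_mono[OF L, of 0 n] by simp
  show ?thesis
  proof (rule that[of t])
    show "0 \<le> t" using t \<open>0 \<le> turn_time L n\<close> by simp
    show "coord e (walk P d L t) = y"
    proof (cases "t = turn_time L (Suc n)")
      case True
      then have "walk P d L t = turn_point P d L (Suc n)"
        by (subst walk_on_segment[OF L, of "Suc n"]) (auto simp: turn_time_Suc[of L "Suc n"] regular_pos[OF L])
      with True show ?thesis
        by (simp add: t_def coord_turn_point_Suc dir turn_time_Suc)
    next
      case False
      with t show ?thesis
        by (subst walk_on_segment[OF L, of n]) (auto simp: coord_step dir t_def)
    qed
    fix s assume s: "0 \<le> s" "s < t"
    obtain k where k: "turn_time L k \<le> s" "s < turn_time L (Suc k)"
      using segment_at_time[OF L s(1)] .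
    show "y < coord e (walk P d L s)"
    proof (cases "k < n")
      case True
      with before[OF True] coord_walk_segment_bounds(2)[OF L k] show ?thesis
        by (meson less_le_trans)
    next
      case False
      have "\<not> n < k"
      proof
        assume "n < k"
        then have "turn_time L (Suc n) \<le> turn_time L k"
          by (intro turn_time_mono L) auto
        with k t s show False by linarith
      qed
      with False have "k = n" by simp
      with k s show ?thesis
        by (subst walk_on_segment[OF L, of n]) (auto simp: coord_step dir t_def)
    qed
  qed
qed

lemma hits_abscissa: "regular L \<Longrightarrow> x \<le> fst P \<Longrightarrow> \<exists>t\<ge>0. fst (walk P d L t) = x"
  and hits_ordinate: "regular L \<Longrightarrow> y \<le> snd P \<Longrightarrow> \<exists>t\<ge>0. snd (walk P d L t) = y"
  by (metis first_hit_exists coord_simps)+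

lemma regular_case_nat:
  assumes "0 < s" "regular L"
  shows "regular (case_nat s L)"
  unfolding regular_def
proof (intro conjI allI)
  show "0 < case_nat s L n" for n
    using assms by (auto simp: regular_pos split: nat.split)
  fix c
  show "\<exists>n. c < (\<Sum>k<n. case_nat s L (Suc (2 * k)))"
    using assms by (simp add: regular_def)
  obtain n where "c < (\<Sum>k<n. L (Suc (2 * k)))"
    using regular_odd_sum[OF assms(2)] by blast
  then have "c < (\<Sum>k<Suc n. case_nat s L (2 * k))"
    using assms by (subst sum.lessThan_Suc_shift) simp
  then show "\<exists>n. c < (\<Sum>k<n. case_nat s L (2 * k))" ..
qed

lemma turn_time_case_nat: "turn_time (case_nat s L) (Suc n) = s + turn_time L n"
  by (simp add: turn_time_def sum.lessThan_Suc_shift del: sum.lessThan_Suc)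

lemma turn_point_case_nat:
  "turn_point P d (case_nat s L) (Suc n) = turn_point (P + s *\<^sub>R step d) (turn d) L n"
  by (simp add: turn_point_def sum.lessThan_Suc_shift segment_dir_Suc algebra_simps del: sum.lessThan_Suc)

text \<open>After its first segment a path is a path from the first turn, started in the other direction. All
  renewal arguments rest on this decomposition.\<close>

lemma walk_case_nat:
  assumes "0 < s" "regular L" "0 \<le> t"
  shows "walk P d (case_nat s L) t =
    (if t < s then P + t *\<^sub>R step d else walk (P + s *\<^sub>R step d) (turn d) L (t - s))"
proof (cases "t < s")
  case True
  then show ?thesis
    using assms by (subst walk_on_segment[OF regular_case_nat, of _ _ 0]) (auto simp: turn_time_Suc)
next
  case False
  then obtain n where n: "turn_time L n \<le> t - s" "t - s < turn_time L (Suc n)"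
    using segment_at_time[OF assms(2), of "t - s"] by auto
  have "walk P d (case_nat s L) t = turn_point P d (case_nat s L) (Suc n)
      + (t - turn_time (case_nat s L) (Suc n)) *\<^sub>R step (segment_dir d (Suc n))"
    by (rule walk_on_segment[OF regular_case_nat]) (use n assms in \<open>auto simp: turn_time_case_nat\<close>)
  then show ?thesis using False
    by (simp add: walk_on_segment[OF assms(2) n] turn_time_case_nat turn_point_case_nat segment_dir_Suc algebra_simps)
qed

lemma image_walk_case_nat:
  assumes "0 < s" "regular L"
  shows "walk P d (case_nat s L) ` {0..} =
    (\<lambda>t. P + t *\<^sub>R step d) ` {0..<s} \<union> walk (P + s *\<^sub>R step d) (turn d) L ` {0..}" (is "?l = ?a \<union> ?b")
proof -
  have "?l = walk P d (case_nat s L) ` {0..<s} \<union> walk P d (case_nat s L) ` {s..}"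
    using assms by (subst image_Un[symmetric]) (auto intro!: arg_cong2[where f=image])
  also have "walk P d (case_nat s L) ` {0..<s} = ?a"
    by (intro image_cong refl) (use assms in \<open>simp add: walk_case_nat\<close>)
  also have "walk P d (case_nat s L) ` {s..} = (\<lambda>t. walk (P + s *\<^sub>R step d) (turn d) L (t - s)) ` {s..}"
    by (intro image_cong refl) (use assms in \<open>simp add: walk_case_nat\<close>)
  also have "\<dots> = walk (P + s *\<^sub>R step d) (turn d) L ` ((\<lambda>t. t - s) ` {s..})"
    by (simp add: image_image)
  also have "(\<lambda>t. t - s) ` {s..} = {0..}"
  proof safe
    fix x :: real assume "0 \<le> x"
    then show "x \<in> (\<lambda>t. t - s) ` {s..}" by (intro image_eqI[of _ _ "x + s"]) auto
  qed simp
  finally show ?thesis .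
qed

lemma turn_point_translate: "turn_point (P + v) d L n = turn_point P d L n + v"
  by (simp add: turn_point_def)

lemma walk_translate: "walk (P + v) d L t = walk P d L t + v"
  by (simp add: walk_def Let_def turn_point_translate)

lemma swap_add: "prod.swap (p + q) = prod.swap p + prod.swap q"
  and swap_scaleR: "prod.swap (c *\<^sub>R p) = c *\<^sub>R prod.swap p"
  for p q :: "real \<times> real"
  by (auto simp: prod_eq_iff)

lemma turn_point_swap: "turn_point (prod.swap P) (turn d) L n = prod.swap (turn_point P d L n)"
  by (induction n) (auto simp: turn_point_Suc swap_add swap_scaleR step_swap turn_segment_dir)

lemma walk_swap: "walk (prod.swap P) (turn d) L t = prod.swap (walk P d L t)"
  by (simp add: walk_def Let_def turn_point_swap swap_add swap_scaleR step_swap turn_segment_dir)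

section \<open>First crossings and the two sides of a path\<close>

definition abscissa :: "direction \<Rightarrow> real \<Rightarrow> real \<Rightarrow> (nat \<Rightarrow> real) \<Rightarrow> real" where
  "abscissa d x y L = first_x_axis_abscissa (walk (x, y) d L)"

lemma first_x_axis_abscissa_eqI:
  assumes "0 \<le> t" "snd (T t) = 0" "\<And>s. 0 \<le> s \<Longrightarrow> s < t \<Longrightarrow> snd (T s) \<noteq> 0"
  shows "first_x_axis_abscissa T = fst (T t)"
proof -
  have "Inf {t. 0 \<le> t \<and> snd (T t) = 0} = t"
    by (rule cInf_eq_minimum) (use assms in \<open>auto simp: not_less[symmetric]\<close>)
  then show ?thesis by (simp add: first_x_axis_abscissa_def)
qed

lemma abscissa_hit:
  assumes "regular L" "0 \<le> y"
  obtains t where "0 \<le> t" "snd (walk (x, y) d L t) = 0"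
    "\<And>s. 0 \<le> s \<Longrightarrow> s < t \<Longrightarrow> 0 < snd (walk (x, y) d L s)"
    "abscissa d x y L = fst (walk (x, y) d L t)"
proof -
  obtain t where "0 \<le> t" "snd (walk (x, y) d L t) = 0"
    "\<And>s. 0 \<le> s \<Longrightarrow> s < t \<Longrightarrow> 0 < snd (walk (x, y) d L s)"
    using first_hit_exists[OF assms(1), of 0 Vertical "(x, y)" d] assms(2) by (auto simp: coord_simps)
  moreover from this have "abscissa d x y L = fst (walk (x, y) d L t)"
    unfolding abscissa_def by (intro first_x_axis_abscissa_eqI) force+
  ultimately show ?thesis using that by blast
qed

lemma abscissa_le:
  assumes "regular L" "0 \<le> y"
  shows "abscissa d x y L \<le> x"
  by (rule abscissa_hit[OF assms, of x d])
     (use coord_walk_le[OF assms(1), of _ Horizontal "(x, y)" d] in \<open>auto simp: coord_simps\<close>)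

lemma abscissa_Vertical_crossing:
  assumes "regular L" "0 < y" "y \<le> s"
  shows "abscissa Vertical x y (case_nat s L) = x"
proof -
  have L: "regular (case_nat s L)" using assms by (intro regular_case_nat) auto
  have w: "walk (x, y) Vertical (case_nat s L) t = (x, y - t)" if "0 \<le> t" "t \<le> y" for t
  proof (cases "t < s")
    case False
    with assms that have "t = s" "s = y" by auto
    with assms show ?thesis by (simp add: walk_case_nat step_def walk_0)
  qed (use assms that in \<open>simp add: walk_case_nat step_def\<close>)
  have "first_x_axis_abscissa (walk (x, y) Vertical (case_nat s L)) = fst (walk (x, y) Vertical (case_nat s L) y)"
    by (rule first_x_axis_abscissa_eqI) (use assms w in auto)
  with w[of y] assms show ?thesis by (simp add: abscissa_def)
qed

text \<open>A first segment that does not end below the axis leaves the crossing to the remaining path; if it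
  ends on the axis, the remaining path crosses at its time 0.\<close>

lemma abscissa_first_step:
  assumes L: "regular L" and s: "0 < s" and y: "0 < y"
    and y': "0 \<le> y + s * snd (step d)"
  shows "abscissa d x y (case_nat s L) =
    abscissa (turn d) (x + s * fst (step d)) (y + s * snd (step d)) L"
proof -
  let ?w = "walk (x + s * fst (step d), y + s * snd (step d)) (turn d) L"
  obtain t where t: "0 \<le> t" "snd (?w t) = 0"
    "\<And>s. 0 \<le> s \<Longrightarrow> s < t \<Longrightarrow> 0 < snd (?w s)" "abscissa (turn d) (x + s * fst (step d)) (y + s * snd (step d)) L = fst (?w t)"
    using abscissa_hit[OF L y'] by metis
  have P: "(x, y) + s *\<^sub>R step d = (x + s * fst (step d), y + s * snd (step d))"
    by (cases "step d") simp
  have w: "walk (x, y) d (case_nat s L) r = (if r < s then (x, y) + r *\<^sub>R step d else ?w (r - s))" if "0 \<le> r" for r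
    using walk_case_nat[OF s L that, of "(x, y)" d] by (simp only: P)
  have "abscissa d x y (case_nat s L) = fst (walk (x, y) d (case_nat s L) (s + t))"
    unfolding abscissa_def
  proof (rule first_x_axis_abscissa_eqI)
    show "0 \<le> s + t" using s t by simp
    show "snd (walk (x, y) d (case_nat s L) (s + t)) = 0"
      using s t by (simp add: w)
    fix r assume r: "0 \<le> r" "r < s + t"
    show "snd (walk (x, y) d (case_nat s L) r) \<noteq> 0"
    proof (cases "r < s")
      case True
      have "0 < y + r * snd (step d)"
        using True y y' r by (cases d) (auto simp: step_def)
      with True r show ?thesis by (simp add: w)
    next
      case False
      with t(3)[of "r - s"] r show ?thesis by (simp add: w)
    qed
  qed
  with s t show ?thesis by (simp add: w)
qed

text \<open>By translation invariance only the vector from the target to the start matters, so the target is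
  taken to be the origin.\<close>

definition passes_below :: "direction \<Rightarrow> real \<Rightarrow> real \<Rightarrow> (nat \<Rightarrow> real) \<Rightarrow> bool" where
  "passes_below d x y L \<longleftrightarrow> (0, 0) \<in> upper_left (x, y) (walk (x, y) d L)"

lemma passes_below_iff: "passes_below d x y L \<longleftrightarrow> 0 < x \<and> 0 < y \<and> (0, 0) \<notin> walk (x, y) d L ` {0..} \<and>
    (\<exists>y'<0. (0, y') \<in> walk (x, y) d L ` {0..})"
  by (simp add: passes_below_def upper_left_def)

lemma walk_coord_le_image:
  "regular L \<Longrightarrow> p \<in> walk P d L ` {0..} \<Longrightarrow> coord e p \<le> coord e P"
  by (auto simp: coord_walk_le)

text \<open>From its first turn on the path lies below the origin, and it still has to reach abscissa 0.\<close>

lemma passes_below_Vertical_crossing: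
  assumes "regular L" "0 < x" "0 < y" "y < s"
  shows "passes_below Vertical x y (case_nat s L)"
proof -
  have s: "0 < s" using assms by simp
  let ?w = "walk (x, y - s) Horizontal L"
  have im: "walk (x, y) Vertical (case_nat s L) ` {0..} = (\<lambda>t. (x, y - t)) ` {0..<s} \<union> ?w ` {0..}"
    using image_walk_case_nat[OF s assms(1), of "(x, y)" Vertical] by (simp add: step_def)
  have neg: "snd p < 0" if "p \<in> ?w ` {0..}" for p
    using walk_coord_le_image[OF assms(1) that, of Vertical] assms by (simp add: coord_simps)
  obtain t where "0 \<le> t" "fst (?w t) = 0"
    using hits_abscissa[OF assms(1), of 0 "(x, y - s)" Horizontal] assms by auto
  then have "(0, snd (?w t)) \<in> ?w ` {0..}"
    by (intro image_eqI[of _ _ t]) (auto simp: prod_eq_iff)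
  moreover from neg[OF this] have "snd (?w t) < 0" by simp
  ultimately show ?thesis
    unfolding passes_below_iff im using assms neg[of "(0, 0)"] by auto
qed

lemma passes_below_Vertical_turn:
  assumes "regular L" "0 < x" "0 < s" "s < y"
  shows "passes_below Vertical x y (case_nat s L) \<longleftrightarrow> passes_below Horizontal x (y - s) L"
proof -
  have "walk (x, y) Vertical (case_nat s L) ` {0..} = (\<lambda>t. (x, y - t)) ` {0..<s} \<union> walk (x, y - s) Horizontal L ` {0..}"
    using image_walk_case_nat[OF assms(3,1), of "(x, y)" Vertical] by (simp add: step_def)
  then show ?thesis unfolding passes_below_iff using assms by auto
qed

text \<open>The path passes over the origin at height \<open>y\<close> and never returns to abscissa 0.\<close>

lemma passes_below_Horizontal_crossing:
  assumes "regular L" "0 < y" "0 < x" "x < s"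
  shows "\<not> passes_below Horizontal x y (case_nat s L)"
proof -
  have s: "0 < s" using assms by simp
  have im: "walk (x, y) Horizontal (case_nat s L) ` {0..} = (\<lambda>t. (x - t, y)) ` {0..<s} \<union> walk (x - s, y) Vertical L ` {0..}"
    using image_walk_case_nat[OF s assms(1), of "(x, y)" Horizontal] by (simp add: step_def)
  have neg: "fst p < 0" if "p \<in> walk (x - s, y) Vertical L ` {0..}" for p
    using walk_coord_le_image[OF assms(1) that, of Horizontal] assms by (simp add: coord_simps)
  have "(0, y') \<notin> walk (x - s, y) Vertical L ` {0..}" for y'
    using neg[of "(0, y')"] by auto
  then show ?thesis unfolding passes_below_iff im using assms by auto
qed

lemma passes_below_Horizontal_turn:
  assumes "regular L" "0 < y" "0 < s" "s < x"
  shows "passes_below Horizontal x y (case_nat s L) \<longleftrightarrow> passes_below Vertical (x - s) y L"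
proof -
  have "walk (x, y) Horizontal (case_nat s L) ` {0..} = (\<lambda>t. (x - t, y)) ` {0..<s} \<union> walk (x - s, y) Vertical L ` {0..}"
    using image_walk_case_nat[OF assms(3,1), of "(x, y)" Horizontal] by (simp add: step_def)
  then show ?thesis unfolding passes_below_iff using assms by auto
qed

text \<open>The path meets the vertical line through the point. It cannot do so both above and below the point:
  at the time when it is at height \<open>y\<close>, monotonicity would force it through the point itself.\<close>

lemma lower_right_iff_not_upper_left:
  assumes L: "regular L" and xy: "x < fst P" "y < snd P" and off: "(x, y) \<notin> walk P d L ` {0..}"
  shows "(x, y) \<in> lower_right P (walk P d L) \<longleftrightarrow> (x, y) \<notin> upper_left P (walk P d L)"
proof -
  let ?w = "walk P d L"
  obtain t where t: "0 \<le> t" "fst (?w t) = x"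
    using hits_abscissa[OF L, of x P d] xy by auto
  obtain r where r: "0 \<le> r" "snd (?w r) = y"
    using hits_ordinate[OF L, of y P d] xy by auto
  have on: "(x, snd (?w t)) \<in> ?w ` {0..}"
    using t by (intro image_eqI[of _ _ t]) (auto simp: prod_eq_iff)
  with off have "snd (?w t) \<noteq> y" by auto
  then have one: "(\<exists>y'<y. (x, y') \<in> ?w ` {0..}) \<or> (\<exists>y'>y. (x, y') \<in> ?w ` {0..})"
    using on by (meson linorder_neqE_linordered_idom)
  have "False" if low: "y1 < y" "(x, y1) \<in> ?w ` {0..}" and high: "y < y2" "(x, y2) \<in> ?w ` {0..}" for y1 y2
  proof -
    obtain t1 where t1: "0 \<le> t1" "?w t1 = (x, y1)" using low by auto
    obtain t2 where t2: "0 \<le> t2" "?w t2 = (x, y2)" using high by auto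
    have "r \<le> t1"
      using coord_walk_antimono[OF L, of t1 r Vertical P d] t1 r low by (cases "r \<le> t1") (auto simp: coord_simps)
    moreover have "t2 \<le> r"
      using coord_walk_antimono[OF L, of r t2 Vertical P d] t2 r high by (cases "t2 \<le> r") (auto simp: coord_simps)
    ultimately have "fst (?w r) = x"
      using coord_walk_antimono[OF L, of r t1 Horizontal P d] coord_walk_antimono[OF L, of t2 r Horizontal P d]
        t1 t2 r by (auto simp: coord_simps)
    with r have "(x, y) \<in> ?w ` {0..}"
      by (intro image_eqI[of _ _ r]) (auto simp: prod_eq_iff)
    with off show False by simp
  qed
  with one xy off show ?thesis
    by (auto simp: lower_right_def upper_left_def)
qed

lemma image_walk_translate:
  "(x, y) \<in> walk (X + a, Y + b) d L ` {0..} \<longleftrightarrow> (x - a, y - b) \<in> walk (X, Y) d L ` {0..}"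
  using walk_translate[of "(X, Y)" "(a, b)" d L] by (auto simp: image_iff prod_eq_iff algebra_simps)

lemma upper_left_translate:
  "(x, y) \<in> upper_left (X, Y) (walk (X, Y) d L) \<longleftrightarrow> passes_below d (X - x) (Y - y) L"
proof -
  have im: "(v, w) \<in> walk (X, Y) d L ` {0..} \<longleftrightarrow> (v - x, w - y) \<in> walk (X - x, Y - y) d L ` {0..}" for v w
    using image_walk_translate[of v w "X - x" x "Y - y" y d L] by simp
  have "(\<exists>y'<y. Q (y' - y)) \<longleftrightarrow> (\<exists>y'<0. Q y')" for Q
    by (metis add_diff_cancel_right' add_less_same_cancel2 less_iff_diff_less_0)
  from this[of "\<lambda>z. (0, z) \<in> walk (X - x, Y - y) d L ` {0..}"] show ?thesis
    unfolding passes_below_iff by (auto simp: upper_left_def im)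
qed

lemma lower_right_translate:
  "(x, y) \<in> lower_right (X, Y) (walk (X, Y) d L) \<longleftrightarrow>
    (0, 0) \<in> lower_right (X - x, Y - y) (walk (X - x, Y - y) d L)"
proof -
  have im: "(v, w) \<in> walk (X, Y) d L ` {0..} \<longleftrightarrow> (v - x, w - y) \<in> walk (X - x, Y - y) d L ` {0..}" for v w
    using image_walk_translate[of v w "X - x" x "Y - y" y d L] by simp
  have "(\<exists>y'>y. Q (y' - y)) \<longleftrightarrow> (\<exists>y'>0. Q y')" for Q
    by (metis add_diff_cancel_right' diff_gt_0_iff_gt less_add_same_cancel2)
  from this[of "\<lambda>z. (0, z) \<in> walk (X - x, Y - y) d L ` {0..}"] show ?thesis
    by (auto simp: lower_right_def im)
qed

text \<open>With \<open>p\<close>, \<open>q\<close> the indicators of the upper-left parts of the horizontal and the vertical path,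
  the left-hand side is \<open>(1 - p) * q - p * (1 - q) = q - p\<close>. This separates the two paths.\<close>

lemma I_between_off_paths:
  assumes "regular Lh" "regular Lv" "x < X" "y < Y"
    and "(x, y) \<notin> walk (X, Y) Horizontal Lh ` {0..}" "(x, y) \<notin> walk (X, Y) Vertical Lv ` {0..}"
  shows "I_between (X, Y) (walk (X, Y) Horizontal Lh) (walk (X, Y) Vertical Lv) x y =
    of_bool (passes_below Vertical (X - x) (Y - y) Lv) - of_bool (passes_below Horizontal (X - x) (Y - y) Lh)"
  using assms
  by (auto simp: I_between_def lower_right_iff_not_upper_left upper_left_translate)

text \<open>Hence a point is off the path as soon as its coordinates avoid two countable sets.\<close>

lemma walk_in_lines:
  "(x, y) \<in> walk P d L ` {0..} \<Longrightarrow>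
     x \<in> range (\<lambda>n. fst (turn_point P d L n)) \<or> y \<in> range (\<lambda>n. snd (turn_point P d L n))"
proof -
  assume "(x, y) \<in> walk P d L ` {0..}"
  then obtain n t where "(x, y) = turn_point P d L n + t *\<^sub>R step (segment_dir d n)"
    by (auto simp: walk_def Let_def)
  then show ?thesis
    by (cases "segment_dir d n") (auto simp: step_def prod_eq_iff)
qed

text \<open>Reflection in the diagonal exchanges the axes and the directions.\<close>

lemma first_y_axis_ordinate_eq:
  "first_y_axis_ordinate (walk (X, Y) Horizontal L) = abscissa Vertical Y X L"
  using walk_swap[of "(X, Y)" Horizontal L]
  by (simp add: first_y_axis_ordinate_def abscissa_def first_x_axis_abscissa_def)

section \<open>Measurability of path functionals\<close>

abbreviation seq_space :: "(nat \<Rightarrow> real) measure" where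
  "seq_space \<equiv> \<Pi>\<^sub>M n\<in>UNIV. borel"

text \<open>If \<open>t\<close> is beyond all \<open>T n\<close>, then so is \<open>t + s\<close>, and both sides are the default value of \<open>LEAST\<close>.\<close>

lemma segment_index_right_constant:
  fixes T :: "nat \<Rightarrow> real"
  obtains \<epsilon> where "0 < \<epsilon>" "\<And>s. 0 \<le> s \<Longrightarrow> s < \<epsilon> \<Longrightarrow> (LEAST n. t + s < T n) = (LEAST n. t < T n)"
proof (cases "\<exists>n. t < T n")
  case True
  define n where "n = (LEAST n. t < T n)"
  have n: "t < T n" using True unfolding n_def by (rule LeastI_ex)
  show ?thesis
  proof (rule that[of "T n - t"])
    fix s assume s: "0 \<le> s" "s < T n - t"
    have "(LEAST n. t + s < T n) = n"
    proof (rule Least_equality)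
      fix m assume "t + s < T m"
      with s have "t < T m" by simp
      then show "n \<le> m" unfolding n_def by (rule Least_le)
    qed (use s in simp)
    then show "(LEAST n. t + s < T n) = (LEAST n. t < T n)" by (simp add: n_def)
  qed (use n in simp)
next
  case False
  show ?thesis
  proof (rule that[of 1])
    fix s :: real assume "0 \<le> s" "s < 1"
    with False have "t + s < T n \<longleftrightarrow> t < T n" for n
      by (smt (verit))
    then show "(LEAST n. t + s < T n) = (LEAST n. t < T n)" by simp
  qed simp
qed

text \<open>The only time at which segment \<open>n\<close>, if it moves in direction \<open>e\<close>, can make the coordinate \<open>e\<close> vanish.\<close>

definition candidate_time :: "direction \<Rightarrow> real \<times> real \<Rightarrow> direction \<Rightarrow> (nat \<Rightarrow> real) \<Rightarrow> nat \<Rightarrow> real" where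
  "candidate_time e P d L n = turn_time L n + coord e (turn_point P d L n)"

lemma coord_walk:
  "coord e (walk P d L t) = (let n = (LEAST n. t < turn_time L (Suc n)) in
     coord e (turn_point P d L n) - (if segment_dir d n = e then t - turn_time L n else 0))"
  by (simp add: walk_def Let_def coord_step)

text \<open>A witness on a segment that moves in direction \<open>e\<close> is the candidate time of this segment. On any
  other segment the coordinate \<open>e\<close> is constant for a while to the right of the witness and \<open>Q\<close> persists,
  so that a rational time is a witness too. The equivalence holds for all sequences of lengths.\<close>

lemma crossing_iff_candidate:
  fixes e d :: direction and P :: "real \<times> real" and L :: "nat \<Rightarrow> real" and Q :: "real \<Rightarrow> real \<Rightarrow> bool"
  assumes Q: "\<And>t c. Q t c \<Longrightarrow> \<exists>\<epsilon>>0. \<forall>s. 0 \<le> s \<longrightarrow> s < \<epsilon> \<longrightarrow> Q (t + s) (c - s)"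
  defines "R \<equiv> (\<lambda>t. 0 \<le> t \<and> coord e (walk P d L t) = 0 \<and> Q t (coord (turn e) (walk P d L t)))"
  shows "(\<exists>t. R t) \<longleftrightarrow> (\<exists>n. R (candidate_time e P d L n)) \<or> (\<exists>q::rat. R (of_rat q))"
proof
  assume "\<exists>t. R t"
  then obtain t where t: "R t" ..
  define n where "n = (LEAST n. t < turn_time L (Suc n))"
  show "(\<exists>n. R (candidate_time e P d L n)) \<or> (\<exists>q::rat. R (of_rat q))"
  proof (cases "segment_dir d n = e")
    case True
    with t have "t = candidate_time e P d L n"
      unfolding R_def coord_walk n_def[symmetric] by (simp add: candidate_time_def Let_def)
    with t show ?thesis by blast
  next
    case False
    then have dir: "segment_dir d n = turn e" by (simp add: neq_iff_turn)
    obtain \<epsilon>1 where e1: "0 < \<epsilon>1" "\<And>s. 0 \<le> s \<Longrightarrow> s < \<epsilon>1 \<Longrightarrow> (LEAST n. t + s < turn_time L (Suc n)) = n"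
      using segment_index_right_constant[where t=t and T="\<lambda>n. turn_time L (Suc n)"] unfolding n_def by blast
    obtain \<epsilon>2 where e2: "0 < \<epsilon>2" "\<And>s. 0 \<le> s \<Longrightarrow> s < \<epsilon>2 \<Longrightarrow> Q (t + s) (coord (turn e) (walk P d L t) - s)"
      using t Q unfolding R_def by blast
    obtain q :: rat where q: "t < of_rat q" "of_rat q < t + min \<epsilon>1 \<epsilon>2"
      using of_rat_dense[of t "t + min \<epsilon>1 \<epsilon>2"] e1 e2 by auto
    define s where "s = of_rat q - t"
    have s: "0 \<le> s" "s < \<epsilon>1" "s < \<epsilon>2" "of_rat q = t + s" using q by (auto simp: s_def)
    have c: "coord e (walk P d L (t + s)) = coord e (walk P d L t)"
      "coord (turn e) (walk P d L (t + s)) = coord (turn e) (walk P d L t) - s"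
      unfolding coord_walk e1(2)[OF s(1,2)] n_def[symmetric] by (simp_all add: Let_def dir)
    have "R (of_rat q)"
      using t e2(2)[OF s(1,3)] s(1) unfolding R_def s(4) c by auto
    then show ?thesis by blast
  qed
qed blast

text \<open>A segment can visit the origin only at the candidate time of its own direction.\<close>

lemma on_walk_iff_candidate:
  "0 \<in> walk P d L ` {0..} \<longleftrightarrow>
    (\<exists>n. 0 \<le> candidate_time (segment_dir d n) P d L n \<and>
      coord Horizontal (walk P d L (candidate_time (segment_dir d n) P d L n)) = 0 \<and>
      coord Vertical (walk P d L (candidate_time (segment_dir d n) P d L n)) = 0)"
proof
  assume "0 \<in> walk P d L ` {0..}"
  then obtain t where t: "0 \<le> t" "walk P d L t = 0" by auto
  define n where "n = (LEAST n. t < turn_time L (Suc n))"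
  have "coord (segment_dir d n) (walk P d L t) = 0" using t by simp
  then have "t = candidate_time (segment_dir d n) P d L n"
    unfolding coord_walk n_def[symmetric] by (simp add: candidate_time_def Let_def)
  with t show "\<exists>n. 0 \<le> candidate_time (segment_dir d n) P d L n \<and>
      coord Horizontal (walk P d L (candidate_time (segment_dir d n) P d L n)) = 0 \<and>
      coord Vertical (walk P d L (candidate_time (segment_dir d n) P d L n)) = 0"
    by (intro exI[of _ n]) auto
next
  assume "\<exists>n. 0 \<le> candidate_time (segment_dir d n) P d L n \<and>
      coord Horizontal (walk P d L (candidate_time (segment_dir d n) P d L n)) = 0 \<and>
      coord Vertical (walk P d L (candidate_time (segment_dir d n) P d L n)) = 0"
  then obtain t where "0 \<le> t" "walk P d L t = 0"
    by (auto simp: coord_simps prod_eq_iff)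
  then show "0 \<in> walk P d L ` {0..}" by (intro image_eqI[of _ _ t]) auto
qed

lemma coord_turn_point:
  "coord e (turn_point P d L n) = coord e P - (\<Sum>k<n. if segment_dir d k = e then L k else 0)"
  by (induction n) (auto simp: coord_turn_point_Suc)

context
  fixes N :: "'b measure" and x y :: "'b \<Rightarrow> real" and L :: "'b \<Rightarrow> nat \<Rightarrow> real"
  assumes x [measurable]: "x \<in> borel_measurable N"
    and y [measurable]: "y \<in> borel_measurable N"
    and L [measurable]: "L \<in> measurable N seq_space"
begin

lemma measurable_length: "(\<lambda>\<omega>. L \<omega> n) \<in> borel_measurable N"
  using measurable_compose[OF L measurable_component_singleton[of n UNIV "\<lambda>_. borel"]] by simp

lemma measurable_turn_time: "(\<lambda>\<omega>. turn_time (L \<omega>) n) \<in> borel_measurable N"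
  unfolding turn_time_def by (intro borel_measurable_sum measurable_length)

lemma measurable_coord_turn_point:
  "(\<lambda>\<omega>. coord e (turn_point (x \<omega>, y \<omega>) d (L \<omega>) n)) \<in> borel_measurable N"
proof -
  have "(\<lambda>\<omega>. coord e (x \<omega>, y \<omega>)) \<in> borel_measurable N"
    by (cases e) (simp_all add: coord_simps)
  moreover have "(\<lambda>\<omega>. if segment_dir d k = e then L \<omega> k else 0) \<in> borel_measurable N" for k
    using measurable_length by (cases "segment_dir d k = e") simp_all
  ultimately show ?thesis unfolding coord_turn_point
    by (intro borel_measurable_diff borel_measurable_sum)
qed

lemma measurable_candidate_time:
  "(\<lambda>\<omega>. candidate_time e (x \<omega>, y \<omega>) d (L \<omega>) n) \<in> borel_measurable N"
  unfolding candidate_time_def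
  by (intro borel_measurable_add measurable_turn_time measurable_coord_turn_point)

lemma measurable_coord_walk:
  assumes [measurable]: "t \<in> borel_measurable N"
  shows "(\<lambda>\<omega>. coord e (walk (x \<omega>, y \<omega>) d (L \<omega>) (t \<omega>))) \<in> borel_measurable N"
proof -
  note [measurable] = measurable_turn_time measurable_coord_turn_point
  have idx: "(\<lambda>\<omega>. LEAST n. t \<omega> < turn_time (L \<omega>) (Suc n)) \<in> measurable N (count_space UNIV)"
    by measurable
  have "(\<lambda>\<omega>. coord e (turn_point (x \<omega>, y \<omega>) d (L \<omega>) n) -
      (if segment_dir d n = e then t \<omega> - turn_time (L \<omega>) n else 0)) \<in> borel_measurable N" for n
    by (cases "segment_dir d n = e") simp_all
  from measurable_compose_countable[OF this idx] show ?thesis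
    unfolding coord_walk Let_def .
qed

lemma pred_crossing:
  assumes Q: "\<And>t c. Q t c \<Longrightarrow> \<exists>\<epsilon>>0. \<forall>s. 0 \<le> s \<longrightarrow> s < \<epsilon> \<longrightarrow> Q (t + s) (c - s)"
    and Qm: "\<And>f g. f \<in> borel_measurable N \<Longrightarrow> g \<in> borel_measurable N \<Longrightarrow> Measurable.pred N (\<lambda>\<omega>. Q (f \<omega>) (g \<omega>))"
  shows "Measurable.pred N (\<lambda>\<omega>. \<exists>t. 0 \<le> t \<and> coord e (walk (x \<omega>, y \<omega>) d (L \<omega>) t) = 0 \<and>
    Q t (coord (turn e) (walk (x \<omega>, y \<omega>) d (L \<omega>) t)))"
proof -
  define R where "R \<omega> t \<longleftrightarrow> 0 \<le> t \<and> coord e (walk (x \<omega>, y \<omega>) d (L \<omega>) t) = 0 \<and>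
    Q t (coord (turn e) (walk (x \<omega>, y \<omega>) d (L \<omega>) t))" for \<omega> t
  have *: "Measurable.pred N (\<lambda>\<omega>. R \<omega> (t \<omega>))" if t [measurable]: "t \<in> borel_measurable N" for t
  proof -
    note [measurable] = measurable_coord_walk[OF t] Qm[OF t measurable_coord_walk[OF t]]
    show ?thesis unfolding R_def by measurable
  qed
  have "(\<exists>t. R \<omega> t) \<longleftrightarrow> (\<exists>n. R \<omega> (candidate_time e (x \<omega>, y \<omega>) d (L \<omega>) n)) \<or> (\<exists>q::rat. R \<omega> (of_rat q))" for \<omega>
    unfolding R_def by (rule crossing_iff_candidate) (rule Q)
  moreover have "Measurable.pred N (\<lambda>\<omega>. (\<exists>n. R \<omega> (candidate_time e (x \<omega>, y \<omega>) d (L \<omega>) n)) \<or> (\<exists>q::rat. R \<omega> (of_rat q)))"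
    by (intro pred_intros_logic pred_intros_countable * measurable_candidate_time) measurable
  ultimately show ?thesis by (simp add: R_def)
qed

lemma pred_on_walk: "Measurable.pred N (\<lambda>\<omega>. (0, 0) \<in> walk (x \<omega>, y \<omega>) d (L \<omega>) ` {0..})"
proof -
  note [measurable] = measurable_coord_walk measurable_candidate_time
  show ?thesis
    unfolding on_walk_iff_candidate zero_prod_def[symmetric] by measurable
qed

lemma pred_passes_below: "Measurable.pred N (\<lambda>\<omega>. passes_below d (x \<omega>) (y \<omega>) (L \<omega>))"
  and pred_passes_above: "Measurable.pred N (\<lambda>\<omega>. (0, 0) \<in> lower_right (x \<omega>, y \<omega>) (walk (x \<omega>, y \<omega>) d (L \<omega>)))"
proof -
  have hit: "(\<exists>y'. S y' \<and> (0, y') \<in> walk P d M ` {0..}) \<longleftrightarrow>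
      (\<exists>t. 0 \<le> t \<and> coord Horizontal (walk P d M t) = 0 \<and> S (coord (turn Horizontal) (walk P d M t)))" for S P M
    by (auto simp: coord_simps image_iff prod_eq_iff)
  note [measurable] = pred_on_walk
  have [measurable]: "Measurable.pred N (\<lambda>\<omega>. \<exists>y'. y' < 0 \<and> (0, y') \<in> walk (x \<omega>, y \<omega>) d (L \<omega>) ` {0..})"
    unfolding hit
  proof (rule pred_crossing)
    fix t c :: real assume "c < 0"
    then show "\<exists>\<epsilon>>0. \<forall>s. 0 \<le> s \<longrightarrow> s < \<epsilon> \<longrightarrow> c - s < 0" by (intro exI[of _ 1]) auto
  qed measurable
  show "Measurable.pred N (\<lambda>\<omega>. passes_below d (x \<omega>) (y \<omega>) (L \<omega>))"
    unfolding passes_below_iff by measurable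
  have [measurable]: "Measurable.pred N (\<lambda>\<omega>. \<exists>y'. 0 < y' \<and> (0, y') \<in> walk (x \<omega>, y \<omega>) d (L \<omega>) ` {0..})"
    unfolding hit
  proof (rule pred_crossing)
    fix t c :: real assume "0 < c"
    then show "\<exists>\<epsilon>>0. \<forall>s. 0 \<le> s \<longrightarrow> s < \<epsilon> \<longrightarrow> 0 < c - s" by (intro exI[of _ c]) auto
  qed measurable
  show "Measurable.pred N (\<lambda>\<omega>. (0, 0) \<in> lower_right (x \<omega>, y \<omega>) (walk (x \<omega>, y \<omega>) d (L \<omega>)))"
    unfolding lower_right_def by (simp, measurable)
qed

text \<open>The infimum of the crossing times is below \<open>c\<close> iff some crossing happens before \<open>c\<close>, except that the
  infimum of the empty set is a default value; that there is no crossing is an event as well.\<close>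

lemma measurable_abscissa: "(\<lambda>\<omega>. abscissa d (x \<omega>) (y \<omega>) (L \<omega>)) \<in> borel_measurable N"
proof -
  define S where "S \<omega> = {t. 0 \<le> t \<and> snd (walk (x \<omega>, y \<omega>) d (L \<omega>) t) = 0}" for \<omega>
  have ex: "Measurable.pred N (\<lambda>\<omega>. \<exists>t\<in>S \<omega>. t < c)" for c
  proof -
    have "Measurable.pred N (\<lambda>\<omega>. \<exists>t. 0 \<le> t \<and> coord Vertical (walk (x \<omega>, y \<omega>) d (L \<omega>) t) = 0 \<and> t < c)"
    proof (rule pred_crossing)
      fix t assume "t < c"
      then show "\<exists>\<epsilon>>0. \<forall>s. 0 \<le> s \<longrightarrow> s < \<epsilon> \<longrightarrow> t + s < c" by (intro exI[of _ "c - t"]) auto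
    qed measurable
    then show ?thesis by (simp add: S_def coord_simps Bex_def conj_assoc)
  qed
  have ex': "Measurable.pred N (\<lambda>\<omega>. S \<omega> = {})"
  proof -
    have eq: "S \<omega> = {} \<longleftrightarrow> \<not> (\<exists>n::nat. \<exists>t\<in>S \<omega>. t < real n)" for \<omega>
      using reals_Archimedean2 by blast
    show ?thesis unfolding eq by (intro pred_intros_logic pred_intros_countable ex)
  qed
  have [measurable]: "(\<lambda>\<omega>. Inf (S \<omega>)) \<in> borel_measurable N"
  proof (rule borel_measurable_iff_less[THEN iffD2], rule allI)
    fix c :: real
    have "Inf (S \<omega>) < c \<longleftrightarrow> (S \<omega> = {} \<and> Inf {} < c) \<or> (S \<omega> \<noteq> {} \<and> (\<exists>t\<in>S \<omega>. t < c))" for \<omega>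
    proof (cases "S \<omega> = {}")
      case False
      moreover have "bdd_below (S \<omega>)" by (auto simp: S_def intro!: bdd_belowI[of _ 0])
      ultimately show ?thesis using cInf_less_iff[of "S \<omega>" c] by blast
    qed simp
    moreover have "Measurable.pred N (\<lambda>\<omega>. (S \<omega> = {} \<and> Inf {} < c) \<or> (S \<omega> \<noteq> {} \<and> (\<exists>t\<in>S \<omega>. t < c)))"
      by (intro pred_intros_logic ex ex') simp
    ultimately show "{\<omega> \<in> space N. Inf (S \<omega>) < c} \<in> sets N"
      by (simp add: pred_def)
  qed
  have "abscissa d (x \<omega>) (y \<omega>) (L \<omega>) = coord Horizontal (walk (x \<omega>, y \<omega>) d (L \<omega>) (Inf (S \<omega>)))" for \<omega>
    by (simp add: abscissa_def first_x_axis_abscissa_def S_def coord_simps)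
  then show ?thesis using measurable_coord_walk[of "\<lambda>\<omega>. Inf (S \<omega>)" Horizontal d] by simp
qed

end

section \<open>The law of the segment lengths\<close>

abbreviation exp_law :: "real \<Rightarrow> real measure" where
  "exp_law a \<equiv> density lborel (exponential_density a)"

text \<open>Here \<open>a\<close> is the turning rate of the initial direction and \<open>b\<close> that of the other direction.\<close>

definition length_law :: "real \<Rightarrow> real \<Rightarrow> (nat \<Rightarrow> real) measure" where
  "length_law a b = (\<Pi>\<^sub>M n\<in>UNIV. exp_law (if even n then a else b))"

lemma sets_length_law [measurable_cong, simp]: "sets (length_law a b) = sets seq_space"
  unfolding length_law_def by (intro sets_PiM_cong) auto

lemma space_length_law [simp]: "space (length_law a b) = UNIV"
  using sets_eq_imp_space_eq[OF sets_length_law[of a b]] by (simp add: space_PiM)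

lemma measurable_component: "(\<lambda>L. L n) \<in> borel_measurable seq_space"
  using measurable_component_singleton[of n UNIV "\<lambda>_. borel"] by simp

lemma measurable_case_nat_seq:
  assumes f: "f \<in> borel_measurable N" and g: "g \<in> measurable N seq_space"
  shows "(\<lambda>x. case_nat (f x) (g x)) \<in> measurable N seq_space"
proof (rule measurable_PiM_single'[where f="\<lambda>n x. case_nat (f x) (g x) n"])
  fix n :: nat
  show "(\<lambda>x. case_nat (f x) (g x) n) \<in> borel_measurable N"
  proof (cases n)
    case 0
    show ?thesis unfolding 0 using f by (simp only: nat.case)
  next
    case (Suc m)
    show ?thesis unfolding Suc using measurable_compose[OF g measurable_component[of m]] by (simp only: nat.case)
  qed
qed (rule funcsetI, rule PiE_I, simp only: space_borel UNIV_I, blast)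

context
  fixes a b :: real
  assumes a: "0 < a" and b: "0 < b"
begin

lemma prob_space_length_law: "prob_space (length_law a b)" "prob_space (length_law b a)"
  unfolding length_law_def using a b
  by (auto intro!: prob_space_PiM prob_space_exponential_density)

text \<open>Without its first length, a sequence has the law of a path with the other initial direction.\<close>

lemma length_law_first_step:
  "distr (exp_law a \<Otimes>\<^sub>M length_law b a) seq_space (\<lambda>(s, L). case_nat s L) = length_law a b" (is "?D = _")
proof -
  let ?M = "\<lambda>n::nat. exp_law (if even n then a else b)" and ?N = "\<lambda>n::nat. exp_law (if even n then b else a)"
  let ?S = "length_law b a"
  let ?f = "\<lambda>(s, L). case_nat s L :: nat \<Rightarrow> real"
  have measurable_f: "?f \<in> measurable (exp_law a \<Otimes>\<^sub>M ?S) seq_space"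
    unfolding split_beta' by (rule measurable_case_nat_seq) measurable
  interpret M: product_prob_space ?M UNIV
    using a b by (auto intro!: product_prob_spaceI prob_space_exponential_density)
  interpret S: prob_space ?S by (rule prob_space_length_law)
  interpret P: pair_prob_space "exp_law a" ?S
    using prob_space_exponential_density[OF a] S.prob_space_axioms
    by (simp add: pair_prob_space_def pair_sigma_finite_def prob_space_imp_sigma_finite)
  show ?thesis
    unfolding length_law_def[of a b]
  proof (rule M.PiM_eq)
    show "sets ?D = sets (PiM UNIV ?M)"
      using sets_length_law[of a b] by (simp add: length_law_def)
    fix J and E :: "nat \<Rightarrow> real set" assume J: "finite J" "J \<subseteq> UNIV" "\<And>j. j \<in> J \<Longrightarrow> E j \<in> sets (?M j)"
    let ?X = "prod_emb UNIV ?M J (\<Pi>\<^sub>E j\<in>J. E j)"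
    have X: "?X \<in> sets seq_space"
      using J sets_length_law[of a b] by (auto simp: length_law_def intro!: sets_PiM_I)
    have vi: "?f -` ?X \<inter> space (exp_law a \<Otimes>\<^sub>M ?S) = (if 0 \<in> J then E 0 else UNIV) \<times>
      (prod_emb UNIV ?N (Suc -` J) (\<Pi>\<^sub>E j\<in>Suc -` J. E (Suc j)))" (is "_ = ?E \<times> ?F")
      using J by (auto simp: space_pair_measure space_PiM PiE_iff prod_emb_def all_conj_distrib
        split: nat.split nat.split_asm)
    have E: "?E \<in> sets (exp_law a)" using J(3)[of 0] by auto
    have F: "?F \<in> sets ?S"
      unfolding length_law_def using J by (intro sets_PiM_I) (auto intro!: finite_vimageI)
    have "emeasure ?D ?X = emeasure (exp_law a \<Otimes>\<^sub>M ?S) (?E \<times> ?F)"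
      unfolding vi[symmetric] by (rule emeasure_distr[OF measurable_f X])
    also have "\<dots> = emeasure (exp_law a) ?E * emeasure ?S ?F"
      using E F by (rule S.emeasure_pair_measure_Times)
    also have "emeasure ?S ?F = (\<Prod>j\<in>Suc -` J. emeasure (?N j) (E (Suc j)))"
      unfolding length_law_def using J a b
      by (intro emeasure_PiM_emb) (auto intro!: prob_space_exponential_density finite_vimageI)
    also have "\<dots> = (\<Prod>j\<in>Suc ` (Suc -` J). emeasure (?M j) (E j))"
      by (subst prod.reindex) (auto intro!: prod.cong)
    also have "Suc ` (Suc -` J) = J - {0}"
      by (auto simp: image_iff gr0_conv_Suc)
    also have "emeasure (exp_law a) ?E * (\<Prod>j\<in>J - {0}. emeasure (?M j) (E j)) = (\<Prod>j\<in>J. emeasure (?M j) (E j))"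
      using prob_space.emeasure_space_1[OF prob_space_exponential_density[OF a]] J
      by (auto simp: prod.remove)
    finally show "emeasure ?D ?X = (\<Prod>j\<in>J. emeasure (?M j) (E j))" .
  qed
qed

lemma measurable_first_step:
  assumes F: "F \<in> borel_measurable seq_space"
  shows "(\<lambda>p. F (case_nat (fst p) (snd p))) \<in> borel_measurable (exp_law a' \<Otimes>\<^sub>M length_law b' c')"
proof -
  have "(\<lambda>p. case_nat (fst p) (snd p)) \<in> measurable (exp_law a' \<Otimes>\<^sub>M length_law b' c') seq_space"
    by (rule measurable_case_nat_seq) measurable
  from measurable_compose[OF this F] show ?thesis .
qed

lemma nn_integral_length_law:
  assumes F: "F \<in> borel_measurable seq_space"
  shows "(\<integral>\<^sup>+L. F L \<partial>length_law a b) = (\<integral>\<^sup>+s. \<integral>\<^sup>+L. F (case_nat s L) \<partial>length_law b a \<partial>exp_law a)"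
proof -
  interpret S: prob_space "length_law b a" by (rule prob_space_length_law)
  have m: "(\<lambda>(s, L). case_nat s L) \<in> measurable (exp_law a \<Otimes>\<^sub>M length_law b a) seq_space"
    unfolding split_beta' by (rule measurable_case_nat_seq) measurable
  have F': "F \<in> borel_measurable (distr (exp_law a \<Otimes>\<^sub>M length_law b a) seq_space (\<lambda>(s, L). case_nat s L))"
    using F by (simp only: measurable_distr_eq1)
  show ?thesis
    unfolding length_law_first_step[symmetric] nn_integral_distr[OF m F']
    using S.nn_integral_fst[OF measurable_first_step[OF F]] by (simp add: split_beta')
qed

lemma integral_length_law:
  fixes F :: "(nat \<Rightarrow> real) \<Rightarrow> real"
  assumes F: "F \<in> borel_measurable seq_space" and C: "\<And>L. \<bar>F L\<bar> \<le> C"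
  shows "(\<integral>L. F L \<partial>length_law a b) =
    (\<integral>s. exponential_density a s * (\<integral>L. F (case_nat s L) \<partial>length_law b a) \<partial>lborel)"
proof -
  interpret S: prob_space "length_law b a" by (rule prob_space_length_law)
  interpret P: pair_prob_space "exp_law a" "length_law b a"
    using prob_space_exponential_density[OF a] S.prob_space_axioms
    by (simp add: pair_prob_space_def pair_sigma_finite_def prob_space_imp_sigma_finite)
  note mF = measurable_first_step[OF F, of a b a]
  have m: "(\<lambda>(s, L). case_nat s L) \<in> measurable (exp_law a \<Otimes>\<^sub>M length_law b a) seq_space"
    unfolding split_beta' by (rule measurable_case_nat_seq) measurable
  have 1: "(\<integral>L. F L \<partial>length_law a b) = (\<integral>p. F (case_nat (fst p) (snd p)) \<partial>(exp_law a \<Otimes>\<^sub>M length_law b a))"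
    unfolding length_law_first_step[symmetric] integral_distr[OF m F] by (simp only: split_beta')
  have 2: "(\<integral>p. F (case_nat (fst p) (snd p)) \<partial>(exp_law a \<Otimes>\<^sub>M length_law b a)) = (\<integral>s. \<integral>L. F (case_nat s L) \<partial>length_law b a \<partial>exp_law a)"
  proof -
    have "integrable (exp_law a \<Otimes>\<^sub>M length_law b a) (\<lambda>p. F (case_nat (fst p) (snd p)))"
      by (rule P.integrable_const_bound[where B=C, OF _ mF]) (intro AE_I2, simp only: real_norm_def C)
    from P.integral_fst'[OF this] show ?thesis by (simp only: fst_conv snd_conv)
  qed
  have 3: "(\<integral>s. \<integral>L. F (case_nat s L) \<partial>length_law b a \<partial>exp_law a) = (\<integral>s. exponential_density a s * (\<integral>L. F (case_nat s L) \<partial>length_law b a) \<partial>lborel)"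
    unfolding real_scaleR_def[symmetric]
  proof (rule integral_density)
    have "case_prod (\<lambda>s L. F (case_nat s L)) \<in> borel_measurable (exp_law a \<Otimes>\<^sub>M length_law b a)"
      using mF by (simp only: split_beta')
    from S.borel_measurable_lebesgue_integral[OF this]
    show "(\<lambda>s. \<integral>L. F (case_nat s L) \<partial>length_law b a) \<in> borel_measurable lborel"
      by (simp only: measurable_density_eq1)
    show "AE s in lborel. 0 \<le> exponential_density a s"
      using a by (intro AE_I2 exponential_density_nonneg)
    show "exponential_density a \<in> borel_measurable lborel"
      using borel_measurable_erlang_density by (simp only: measurable_lborel2)
  qed
  show ?thesis by (rule trans[OF 1 trans[OF 2 3]])
qed

end

lemma nn_integral_exp_exp_law:
  assumes "0 < a"
  shows "(\<integral>\<^sup>+s. ennreal (exp (- s)) \<partial>exp_law a) = ennreal (a / (a + 1))"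
proof -
  have "(\<integral>\<^sup>+s. ennreal (exp (- s)) \<partial>exp_law a) =
      (\<integral>\<^sup>+s. ennreal (exponential_density a s) * ennreal (exp (- s)) \<partial>lborel)"
    by (subst nn_integral_density) auto
  also have "\<dots> = (\<integral>\<^sup>+s. ennreal (a / (a + 1)) * ennreal (exponential_density (a + 1) s) \<partial>lborel)"
  proof (intro nn_integral_cong)
    fix s :: real
    have "exp (- s * (a + 1)) = exp (- s * a) * exp (- s)"
      by (simp add: exp_add[symmetric] algebra_simps)
    then have "exponential_density a s * exp (- s) = a / (a + 1) * exponential_density (a + 1) s"
      using assms by (auto simp: exponential_density_def)
    then show "ennreal (exponential_density a s) * ennreal (exp (- s)) =
        ennreal (a / (a + 1)) * ennreal (exponential_density (a + 1) s)"
      using assms by (simp add: ennreal_mult[symmetric] exponential_density_nonneg)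
  qed
  also have "\<dots> = ennreal (a / (a + 1)) * emeasure (exp_law (a + 1)) (space (exp_law (a + 1)))"
    by (subst nn_integral_cmult, measurable) (simp add: emeasure_density)
  also have "\<dots> = ennreal (a / (a + 1))"
    using assms prob_space.emeasure_space_1[OF prob_space_exponential_density[of "a + 1"]] by simp
  finally show ?thesis .
qed

text \<open>The Laplace transform of the exponential law with rate \<open>a\<close> at 1 is \<open>a / (a + 1)\<close>, and each summand
  contributes one such factor.\<close>

lemma nn_integral_exp_even_sum:
  assumes "0 < a" "0 < b"
  shows "(\<integral>\<^sup>+L. ennreal (exp (- (\<Sum>k<n. L (2 * k)))) \<partial>length_law a b) = ennreal ((a / (a + 1)) ^ n)"
    and "(\<integral>\<^sup>+L. ennreal (exp (- (\<Sum>k<n. L (Suc (2 * k))))) \<partial>length_law a b) = ennreal ((b / (b + 1)) ^ n)"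
proof -
  have odd: "(\<integral>\<^sup>+L. ennreal (exp (- (\<Sum>k<n. L (Suc (2 * k))))) \<partial>length_law a b) =
      (\<integral>\<^sup>+L. ennreal (exp (- (\<Sum>k<n. L (2 * k)))) \<partial>length_law b a)" if "0 < a" "0 < b" for n a b
  proof -
    interpret prob_space "exp_law a" using that by (auto intro: prob_space_exponential_density)
    show ?thesis
      by (subst nn_integral_length_law[OF that]) (simp_all add: emeasure_space_1[simplified])
  qed
  have even: "(\<integral>\<^sup>+L. ennreal (exp (- (\<Sum>k<n. L (2 * k)))) \<partial>length_law a b) = ennreal ((a / (a + 1)) ^ n)"
    if ab: "0 < a" "0 < b" for n a b
  proof (induction n)
    case 0
    then show ?case using prob_space.emeasure_space_1[OF prob_space_length_law(1)[OF ab]] by simp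
  next
    case (Suc n)
    have "(\<integral>\<^sup>+L. ennreal (exp (- (\<Sum>k<Suc n. L (2 * k)))) \<partial>length_law a b) =
      (\<integral>\<^sup>+s. \<integral>\<^sup>+L. ennreal (exp (- s)) * ennreal (exp (- (\<Sum>k<n. L (Suc (2 * k))))) \<partial>length_law b a \<partial>exp_law a)"
      by (subst nn_integral_length_law[OF ab])
         (simp_all add: sum.lessThan_Suc_shift ennreal_mult[symmetric] exp_add[symmetric] del: sum.lessThan_Suc)
    also have "\<dots> = (\<integral>\<^sup>+s. ennreal (exp (- s)) * ennreal ((a / (a + 1)) ^ n) \<partial>exp_law a)"
      by (subst nn_integral_cmult) (simp_all add: odd[OF ab(2,1)] Suc)
    also have "\<dots> = ennreal ((a / (a + 1)) ^ Suc n)"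
      using ab by (subst nn_integral_multc)
        (simp_all add: nn_integral_exp_exp_law ennreal_mult[symmetric] zero_le_divide_iff)
    finally show ?case .
  qed
  show "(\<integral>\<^sup>+L. ennreal (exp (- (\<Sum>k<n. L (2 * k)))) \<partial>length_law a b) = ennreal ((a / (a + 1)) ^ n)"
    by (rule even[OF assms])
  show "(\<integral>\<^sup>+L. ennreal (exp (- (\<Sum>k<n. L (Suc (2 * k))))) \<partial>length_law a b) = ennreal ((b / (b + 1)) ^ n)"
    using odd[OF assms] even[OF assms(2,1)] by simp
qed

text \<open>By the Markov inequality, the event that all \<open>S n\<close> are at most \<open>c\<close> has measure at most \<open>exp c * q ^ n\<close>,
  for every \<open>n\<close>.\<close>

lemma AE_unbounded_of_exp_moments:
  fixes S :: "nat \<Rightarrow> 'a \<Rightarrow> real"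
  assumes [measurable]: "\<And>n. S n \<in> borel_measurable M"
    and moment: "\<And>n. (\<integral>\<^sup>+\<omega>. ennreal (exp (- S n \<omega>)) \<partial>M) = ennreal (q ^ n)" and q: "0 \<le> q" "q < 1"
  shows "AE \<omega> in M. \<forall>c. \<exists>n. c < S n \<omega>"
proof -
  have "AE \<omega> in M. \<exists>n. real c < S n \<omega>" for c :: nat
  proof -
    let ?A = "{\<omega> \<in> space M. \<forall>n. S n \<omega> \<le> real c}"
    have A: "?A \<in> sets M" by measurable
    have bound: "emeasure M ?A \<le> ennreal (exp c * q ^ n)" for n
    proof -
      have "emeasure M ?A = (\<integral>\<^sup>+\<omega>. indicator ?A \<omega> \<partial>M)" using A by simp
      also have "\<dots> \<le> (\<integral>\<^sup>+\<omega>. ennreal (exp c) * ennreal (exp (- S n \<omega>)) \<partial>M)"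
        by (intro nn_integral_mono) (auto simp: indicator_def ennreal_mult[symmetric] exp_add[symmetric])
      also have "\<dots> = ennreal (exp c * q ^ n)"
        using q by (subst nn_integral_cmult) (auto simp: moment ennreal_mult)
      finally show ?thesis .
    qed
    have "(\<lambda>n. ennreal (exp c * q ^ n)) \<longlonglongrightarrow> ennreal (exp c * 0)"
      using q by (intro tendsto_ennrealI tendsto_mult_left LIMSEQ_realpow_zero) auto
    then have "emeasure M ?A \<le> ennreal (exp c * 0)"
      by (rule LIMSEQ_le_const) (use bound in blast)
    then have "?A \<in> null_sets M" using A by (auto simp: null_sets_def)
    then show ?thesis
      by (rule AE_I') (auto simp: not_less)
  qed
  then have "AE \<omega> in M. \<forall>c::nat. \<exists>n. real c < S n \<omega>" by (simp add: AE_all_countable)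
  then show ?thesis
  proof eventually_elim
    case (elim \<omega>)
    show ?case
    proof
      fix c :: real
      obtain m :: nat where "c < real m" using reals_Archimedean2 by blast
      with elim show "\<exists>n. c < S n \<omega>" by (meson less_trans)
    qed
  qed
qed

lemma AE_regular:
  assumes "0 < a" "0 < b"
  shows "AE L in length_law a b. regular L"
proof -
  have pos: "AE s in exp_law c. 0 < s" if "0 < c" for c
  proof -
    have "AE s in lborel. s \<noteq> (0::real)" by (rule AE_lborel_singleton)
    then show ?thesis
      by (subst AE_density) (auto simp: exponential_density_def)
  qed
  have 1: "AE L in length_law a b. 0 < L n" for n
    unfolding length_law_def
    by (rule AE_PiM_component) (use assms pos in \<open>auto intro!: prob_space_exponential_density\<close>)
  have 2: "AE L in length_law a b. \<forall>c. \<exists>n. c < (\<Sum>k<n. L (2 * k))"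
    by (rule AE_unbounded_of_exp_moments[where q="a / (a + 1)"])
       (use assms in \<open>simp_all add: nn_integral_exp_even_sum\<close>)
  have 3: "AE L in length_law a b. \<forall>c. \<exists>n. c < (\<Sum>k<n. L (Suc (2 * k)))"
    by (rule AE_unbounded_of_exp_moments[where q="b / (b + 1)"])
       (use assms in \<open>simp_all add: nn_integral_exp_even_sum\<close>)
  from 1 have "AE L in length_law a b. \<forall>n. 0 < L n" by (simp add: AE_all_countable)
  with 2 3 show ?thesis
    by eventually_elim (simp add: regular_def)
qed

lemma distr_poisson_lengths:
  assumes "prob_space M" "poisson_lengths M \<beta>1 \<beta>2 d L"
  shows "distr M seq_space (\<lambda>\<omega> n. L n \<omega>) =
    (case d of Horizontal \<Rightarrow> length_law \<beta>1 \<beta>2 | Vertical \<Rightarrow> length_law \<beta>2 \<beta>1)"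
    and "(\<lambda>\<omega> n. L n \<omega>) \<in> measurable M seq_space"
proof -
  interpret prob_space M by fact
  have indep: "indep_vars (\<lambda>_. borel) L UNIV"
    and dist: "\<And>n. distributed M lborel (L n) (exponential_density (case segment_dir d n of Horizontal \<Rightarrow> \<beta>1 | Vertical \<Rightarrow> \<beta>2))"
    using assms(2) by (auto simp: poisson_lengths_def)
  have rv: "L n \<in> borel_measurable M" for n
    using distributed_measurable[OF dist[of n]] by simp
  then show meas: "(\<lambda>\<omega> n. L n \<omega>) \<in> measurable M seq_space"
    by (intro measurable_PiM_single') (auto simp: space_PiM)
  have "distr M seq_space (\<lambda>\<omega> n. L n \<omega>) = (\<Pi>\<^sub>M n\<in>UNIV. distr M borel (L n))"
    using indep rv by (subst (asm) indep_vars_iff_distr_eq_PiM') (auto simp: restrict_def)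
  also have "\<dots> = (\<Pi>\<^sub>M n\<in>UNIV. exp_law (case segment_dir d n of Horizontal \<Rightarrow> \<beta>1 | Vertical \<Rightarrow> \<beta>2))"
  proof (intro PiM_cong refl)
    fix n
    have "distr M borel (L n) = distr M lborel (L n)" by (intro distr_cong) auto
    then show "distr M borel (L n) = exp_law (case segment_dir d n of Horizontal \<Rightarrow> \<beta>1 | Vertical \<Rightarrow> \<beta>2)"
      using distributed_distr_eq_density[OF dist[of n]] by simp
  qed
  also have "\<dots> = (case d of Horizontal \<Rightarrow> length_law \<beta>1 \<beta>2 | Vertical \<Rightarrow> length_law \<beta>2 \<beta>1)"
    unfolding length_law_def by (cases d) (auto simp: segment_dir_def intro!: PiM_cong)
  finally show "distr M seq_space (\<lambda>\<omega> n. L n \<omega>) =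
    (case d of Horizontal \<Rightarrow> length_law \<beta>1 \<beta>2 | Vertical \<Rightarrow> length_law \<beta>2 \<beta>1)" .
qed

section \<open>Integrals over intervals and rectangles\<close>

lemma measurable_curried:
  fixes F :: "real \<Rightarrow> real \<Rightarrow> real"
  assumes "(\<lambda>(x, y). F x y) \<in> borel_measurable (borel \<Otimes>\<^sub>M borel)"
    and "f \<in> borel_measurable N" "g \<in> borel_measurable N"
  shows "(\<lambda>z. F (f z) (g z)) \<in> borel_measurable N"
  using measurable_compose[OF measurable_Pair[OF assms(2,3)] assms(1)] by simp

lemma set_integrable_bounded:
  fixes f :: "real \<Rightarrow> real"
  assumes "f \<in> borel_measurable borel" "\<And>x. a \<le> x \<Longrightarrow> x \<le> b \<Longrightarrow> \<bar>f x\<bar> \<le> C"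
  shows "set_integrable lborel {a..b} f"
  unfolding set_integrable_def
proof (rule Bochner_Integration.integrable_bound)
  show "integrable lborel (\<lambda>x. indicator {a..b} x *\<^sub>R C)"
    by (cases "a \<le> b") auto
  show "AE x in lborel. norm (indicator {a..b} x *\<^sub>R f x) \<le> norm (indicator {a..b} x *\<^sub>R C)"
    using assms(2) by (intro AE_I2) (force simp: indicator_def)
qed (use assms in measurable)

lemma set_integral_eq_off_point:
  fixes f g :: "real \<Rightarrow> real"
  assumes "\<And>x. x \<in> A \<Longrightarrow> x \<noteq> c \<Longrightarrow> f x = g x"
  shows "(LBINT x:A. f x) = (LBINT x:A. g x)"
  unfolding set_lebesgue_integral_def
  by (rule integral_discrete_difference[of "{c}"]) (auto simp: indicator_def assms)

lemma set_integral_eq_off_countable: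
  fixes f g :: "real \<Rightarrow> real"
  assumes "countable E" "\<And>x. x \<in> A \<Longrightarrow> x \<notin> E \<Longrightarrow> f x = g x"
  shows "(LBINT x:A. f x) = (LBINT x:A. g x)"
  unfolding set_lebesgue_integral_def
  by (rule integral_discrete_difference[OF assms(1)]) (auto simp: indicator_def assms)

lemma abs_set_integral_le:
  fixes f :: "real \<Rightarrow> real"
  assumes "a \<le> b" "\<And>x. a \<le> x \<Longrightarrow> x \<le> b \<Longrightarrow> \<bar>f x\<bar> \<le> C"
  shows "\<bar>LBINT x:{a..b}. f x\<bar> \<le> C * (b - a)"
proof -
  have "\<bar>LBINT x:{a..b}. f x\<bar> \<le> (\<integral>x. \<bar>indicator {a..b} x *\<^sub>R f x\<bar> \<partial>lborel)"
    unfolding set_lebesgue_integral_def by (rule integral_abs_bound)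
  also have "\<dots> \<le> (\<integral>x. indicator {a..b} x *\<^sub>R C \<partial>lborel)"
  proof (rule integral_mono')
    show "integrable lborel (\<lambda>x. indicator {a..b} x *\<^sub>R C)"
      using assms(1) by (intro integrable_scaleR_left integrable_real_indicator) auto
    have "0 \<le> C" using assms(2)[of a] assms(1) by linarith
    then show "0 \<le> indicator {a..b} x *\<^sub>R C" for x by simp
    show "\<bar>indicator {a..b} x *\<^sub>R f x\<bar> \<le> indicator {a..b} x *\<^sub>R C" for x
      using assms(2) by (auto simp: indicator_def)
  qed
  also have "\<dots> = C * (b - a)" using assms by simp
  finally show ?thesis .
qed

lemma borel_measurable_set_integral:
  fixes f :: "'a \<Rightarrow> real \<Rightarrow> real"
  assumes f: "(\<lambda>(x, y). f x y) \<in> borel_measurable (N \<Otimes>\<^sub>M borel)"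
    and l [measurable]: "l \<in> borel_measurable N" and r [measurable]: "r \<in> borel_measurable N"
  shows "(\<lambda>x. LBINT y:{l x..r x}. f x y) \<in> borel_measurable N"
proof -
  have "(\<lambda>(x, y). indicator {l x..r x} y *\<^sub>R f x y) =
      (\<lambda>p. if l (fst p) \<le> snd p \<and> snd p \<le> r (fst p) then case_prod f p else 0)"
    by (auto simp: fun_eq_iff)
  also have "\<dots> \<in> borel_measurable (N \<Otimes>\<^sub>M borel)"
    using f by measurable
  finally have "(\<lambda>(x, y). indicator {l x..r x} y *\<^sub>R f x y) \<in> borel_measurable (N \<Otimes>\<^sub>M lborel)"
    by (simp cong: measurable_cong_sets)
  then show ?thesis
    unfolding set_lebesgue_integral_def by (rule lborel.borel_measurable_lebesgue_integral)
qed

lemma Fubini_bounded: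
  fixes f :: "real \<Rightarrow> real \<Rightarrow> real"
  assumes f: "(\<lambda>(x, y). f x y) \<in> borel_measurable (borel \<Otimes>\<^sub>M borel)"
    and C: "\<And>x y. a \<le> x \<Longrightarrow> x \<le> b \<Longrightarrow> c \<le> y \<Longrightarrow> y \<le> d \<Longrightarrow> \<bar>f x y\<bar> \<le> C"
  shows "(LBINT x:{a..b}. LBINT y:{c..d}. f x y) = (LBINT y:{c..d}. LBINT x:{a..b}. f x y)"
proof -
  let ?g = "\<lambda>(x, y). indicator {a..b} x * indicator {c..d} y * f x y"
  have meas: "?g \<in> borel_measurable (lborel \<Otimes>\<^sub>M lborel)"
    using f by (simp add: split_beta' cong: measurable_cong_sets)
  have "integrable (lborel \<Otimes>\<^sub>M lborel) ?g"
  proof (rule Bochner_Integration.integrable_bound[OF _ meas])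
    have "integrable (lborel \<Otimes>\<^sub>M lborel) (\<lambda>p. indicator ({a..b} \<times> {c..d}) p *\<^sub>R C :: real)"
      by (cases "a \<le> b \<and> c \<le> d")
        (auto intro!: integrable_scaleR_left integrable_real_indicator
          simp: lborel.emeasure_pair_measure_Times ennreal_mult[symmetric] not_le)
    then show "integrable (lborel \<Otimes>\<^sub>M lborel) (\<lambda>p. indicator ({a..b} \<times> {c..d}) p *\<^sub>R C :: real)" .
    show "AE p in lborel \<Otimes>\<^sub>M lborel. norm (?g p) \<le> norm (indicator ({a..b} \<times> {c..d}) p *\<^sub>R C)"
      using C by (intro AE_I2) (force simp: indicator_def)
  qed
  from lborel_pair.Fubini_integral[OF this]
  have "(\<integral>x. \<integral>y. indicator {a..b} x * indicator {c..d} y * f x y \<partial>lborel \<partial>lborel) =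
        (\<integral>y. \<integral>x. indicator {a..b} x * indicator {c..d} y * f x y \<partial>lborel \<partial>lborel)" by simp
  moreover have "(\<integral>y. indicator {a..b} x * indicator {c..d} y * f x y \<partial>lborel) =
      indicator {a..b} x *\<^sub>R (LBINT y:{c..d}. f x y)" for x
    by (simp add: set_lebesgue_integral_def mult.assoc)
  moreover have "(\<integral>x. indicator {a..b} x * indicator {c..d} y * f x y \<partial>lborel) =
      indicator {c..d} y *\<^sub>R (LBINT x:{a..b}. f x y)" for y
    unfolding set_lebesgue_integral_def real_scaleR_def integral_mult_right_zero[symmetric]
    by (intro Bochner_Integration.integral_cong) auto
  ultimately show ?thesis
    unfolding set_lebesgue_integral_def by simp
qed

lemma Fubini_triangle:
  fixes f :: "real \<Rightarrow> real \<Rightarrow> real"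
  assumes f: "(\<lambda>(x, y). f x y) \<in> borel_measurable (borel \<Otimes>\<^sub>M borel)"
    and C: "\<And>x y. a \<le> y \<Longrightarrow> y \<le> x \<Longrightarrow> x \<le> b \<Longrightarrow> \<bar>f x y\<bar> \<le> C"
  shows "(LBINT x:{a..b}. LBINT y:{a..x}. f x y) = (LBINT y:{a..b}. LBINT x:{y..b}. f x y)"
proof -
  let ?g = "\<lambda>x y. if y \<le> x then f x y else 0"
  have "(LBINT x:{a..b}. LBINT y:{a..x}. f x y) = (LBINT x:{a..b}. LBINT y:{a..b}. ?g x y)"
    unfolding set_lebesgue_integral_def
    by (intro Bochner_Integration.integral_cong refl)
       (auto simp: indicator_def intro!: Bochner_Integration.integral_cong)
  also have "\<dots> = (LBINT y:{a..b}. LBINT x:{a..b}. ?g x y)"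
  proof (rule Fubini_bounded)
    show "(\<lambda>(x, y). ?g x y) \<in> borel_measurable (borel \<Otimes>\<^sub>M borel)"
      using f by (simp add: split_beta')
    show "\<bar>?g x y\<bar> \<le> \<bar>C\<bar>" if "a \<le> x" "x \<le> b" "a \<le> y" "y \<le> b" for x y
      using C[of y x] that by auto
  qed
  also have "\<dots> = (LBINT y:{a..b}. LBINT x:{y..b}. f x y)"
    unfolding set_lebesgue_integral_def
    by (intro Bochner_Integration.integral_cong refl)
       (auto simp: indicator_def intro!: Bochner_Integration.integral_cong)
  finally show ?thesis .
qed

lemma iterated_integral_add_scaled:
  fixes f g :: "real \<Rightarrow> real \<Rightarrow> real"
  assumes f: "(\<lambda>(x, y). f x y) \<in> borel_measurable (borel \<Otimes>\<^sub>M borel)"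
    and g: "(\<lambda>(x, y). g x y) \<in> borel_measurable (borel \<Otimes>\<^sub>M borel)"
    and Cf: "\<And>x y. a \<le> x \<Longrightarrow> x \<le> b \<Longrightarrow> c \<le> y \<Longrightarrow> y \<le> d \<Longrightarrow> \<bar>f x y\<bar> \<le> Cf"
    and Cg: "\<And>x y. a \<le> x \<Longrightarrow> x \<le> b \<Longrightarrow> c \<le> y \<Longrightarrow> y \<le> d \<Longrightarrow> \<bar>g x y\<bar> \<le> Cg"
    and cd: "c \<le> d"
  shows "(LBINT x:{a..b}. LBINT y:{c..d}. f x y + k * g x y) =
    (LBINT x:{a..b}. LBINT y:{c..d}. f x y) + k * (LBINT x:{a..b}. LBINT y:{c..d}. g x y)"
proof -
  have slice: "h x \<in> borel_measurable borel"
    if "(\<lambda>(x, y). h x y) \<in> borel_measurable (borel \<Otimes>\<^sub>M borel)" for h :: "real \<Rightarrow> real \<Rightarrow> real" and x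
    using measurable_compose[OF measurable_Pair1' that, of x] by auto
  have inner: "set_integrable lborel {a..b} (\<lambda>x. LBINT y:{c..d}. h x y)"
    if h: "(\<lambda>(x, y). h x y) \<in> borel_measurable (borel \<Otimes>\<^sub>M borel)"
      and C: "\<And>x y. a \<le> x \<Longrightarrow> x \<le> b \<Longrightarrow> c \<le> y \<Longrightarrow> y \<le> d \<Longrightarrow> \<bar>h x y\<bar> \<le> C" for h :: "real \<Rightarrow> real \<Rightarrow> real" and C
  proof (rule set_integrable_bounded)
    show "(\<lambda>x. LBINT y:{c..d}. h x y) \<in> borel_measurable borel"
      by (rule borel_measurable_set_integral[OF h]) measurable
    show "\<bar>LBINT y:{c..d}. h x y\<bar> \<le> C * (d - c)" if "a \<le> x" "x \<le> b" for x
      by (rule abs_set_integral_le) (use cd C that in auto)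
  qed
  have "(LBINT x:{a..b}. LBINT y:{c..d}. f x y + k * g x y) =
    (LBINT x:{a..b}. (LBINT y:{c..d}. f x y) + k * (LBINT y:{c..d}. g x y))"
  proof (rule set_lebesgue_integral_cong, simp, intro allI impI)
    fix x assume x: "x \<in> {a..b}"
    have "set_integrable lborel {c..d} (f x)" "set_integrable lborel {c..d} (g x)"
      using x Cf Cg by (auto intro!: set_integrable_bounded slice f g)
    then show "(LBINT y:{c..d}. f x y + k * g x y) = (LBINT y:{c..d}. f x y) + k * (LBINT y:{c..d}. g x y)"
      by (subst set_integral_add) auto
  qed
  also have "\<dots> = (LBINT x:{a..b}. LBINT y:{c..d}. f x y) + k * (LBINT x:{a..b}. LBINT y:{c..d}. g x y)"
    using inner[OF f Cf] inner[OF g Cg] by (subst set_integral_add) auto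
  finally show ?thesis .
qed

lemma set_integral_FTC:
  fixes F f :: "real \<Rightarrow> real"
  assumes "a \<le> b" "\<And>x. a \<le> x \<Longrightarrow> x \<le> b \<Longrightarrow> (F has_real_derivative f x) (at x)"
    "\<And>x. a \<le> x \<Longrightarrow> x \<le> b \<Longrightarrow> isCont f x"
  shows "(LBINT x:{a..b}. f x) = F b - F a"
  using integral_FTC_Icc_real[OF assms] by (simp add: set_lebesgue_integral_def mult.commute)

lemma set_integral_reflect:
  fixes f :: "real \<Rightarrow> real"
  shows "(LBINT x:{0..t}. f (t - x)) = (LBINT x:{0..t}. f x)"
  unfolding set_lebesgue_integral_def
  by (subst (2) lborel_integral_real_affine[of "-1" _ t])
     (auto intro!: Bochner_Integration.integral_cong simp: indicator_def)

lemma set_integral_shift: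
  fixes f :: "real \<Rightarrow> real"
  shows "(LBINT x:{s..t}. f (x - s)) = (LBINT r:{0..t - s}. f r)"
  unfolding set_lebesgue_integral_def
  by (subst (2) lborel_integral_real_affine[of 1 _ "- s"])
     (auto intro!: Bochner_Integration.integral_cong simp: indicator_def)

section \<open>Renewal equations for path functionals\<close>

text \<open>The integrated form of the initial value problem \<open>v' = \<beta> * (w - v)\<close>, \<open>v 0 = c\<close>, for bounded measurable
  \<open>w\<close>. Integrating the formula for \<open>v\<close> and exchanging the order of integration turns the kernel
  into \<open>1 - exp (- \<beta> * (t - r))\<close>, which brings back \<open>v t\<close>.\<close>

lemma exponential_kernel_resolvent:
  fixes v w :: "real \<Rightarrow> real"
  assumes \<beta>: "0 < \<beta>" and w: "w \<in> borel_measurable borel" and C: "\<And>r. \<bar>w r\<bar> \<le> C"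
    and v: "\<And>t. 0 < t \<Longrightarrow> v t = exp (- \<beta> * t) * c + (LBINT r:{0..t}. \<beta> * exp (- \<beta> * (t - r)) * w r)"
    and vint: "\<And>t. set_integrable lborel {0..t} v"
    and t: "0 < t"
  shows "v t = c + \<beta> * (LBINT r:{0..t}. w r - v r)"
proof -
  note [measurable] = w
  have wint: "set_integrable lborel {0..t} w"
    by (rule set_integrable_bounded[OF w C])
  have kint: "set_integrable lborel {0..t} (\<lambda>r. \<beta> * exp (- \<beta> * (t - r)) * w r)"
  proof (rule set_integrable_bounded)
    fix r assume "0 \<le> r" "r \<le> t"
    then have "\<bar>\<beta> * exp (- \<beta> * (t - r))\<bar> \<le> \<beta>" using \<beta> by auto
    then show "\<bar>\<beta> * exp (- \<beta> * (t - r)) * w r\<bar> \<le> \<beta> * C"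
      unfolding abs_mult[of _ "w r"] using C[of r] \<beta> by (intro mult_mono) auto
  qed measurable
  have "(LBINT \<tau>:{0..t}. v \<tau>) =
      (LBINT \<tau>:{0..t}. exp (- \<beta> * \<tau>) * c + (LBINT r:{0..\<tau>}. \<beta> * exp (- \<beta> * (\<tau> - r)) * w r))"
    by (rule set_integral_eq_off_point[of _ 0]) (use v in auto)
  also have "\<dots> = (LBINT \<tau>:{0..t}. exp (- \<beta> * \<tau>) * c) + (LBINT \<tau>:{0..t}. LBINT r:{0..\<tau>}. \<beta> * exp (- \<beta> * (\<tau> - r)) * w r)"
  proof (rule set_integral_add(2))
    show "set_integrable lborel {0..t} (\<lambda>\<tau>. exp (- \<beta> * \<tau>) * c)"
      by (rule borel_integrable_atLeastAtMost') (intro continuous_intros)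
    show "set_integrable lborel {0..t} (\<lambda>\<tau>. LBINT r:{0..\<tau>}. \<beta> * exp (- \<beta> * (\<tau> - r)) * w r)"
    proof (rule set_integrable_bounded)
      show "(\<lambda>\<tau>. LBINT r:{0..\<tau>}. \<beta> * exp (- \<beta> * (\<tau> - r)) * w r) \<in> borel_measurable borel"
        by (rule borel_measurable_set_integral) measurable
      fix \<tau> assume "0 \<le> \<tau>" "\<tau> \<le> t"
      have "\<bar>LBINT r:{0..\<tau>}. \<beta> * exp (- \<beta> * (\<tau> - r)) * w r\<bar> \<le> \<beta> * C * (\<tau> - 0)"
      proof (rule abs_set_integral_le)
        fix r assume "0 \<le> r" "r \<le> \<tau>"
        then have "\<bar>\<beta> * exp (- \<beta> * (\<tau> - r))\<bar> \<le> \<beta>" using \<beta> by auto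
        then show "\<bar>\<beta> * exp (- \<beta> * (\<tau> - r)) * w r\<bar> \<le> \<beta> * C"
          unfolding abs_mult[of _ "w r"] using C[of r] \<beta> by (intro mult_mono) auto
      qed fact
      also have "\<dots> \<le> \<beta> * C * t"
        using \<open>\<tau> \<le> t\<close> \<beta> C[of 0] by (intro mult_left_mono) auto
      finally show "\<bar>LBINT r:{0..\<tau>}. \<beta> * exp (- \<beta> * (\<tau> - r)) * w r\<bar> \<le> \<beta> * C * t" .
    qed
  qed
  also have "(LBINT \<tau>:{0..t}. LBINT r:{0..\<tau>}. \<beta> * exp (- \<beta> * (\<tau> - r)) * w r) =
      (LBINT r:{0..t}. LBINT \<tau>:{r..t}. \<beta> * exp (- \<beta> * (\<tau> - r)) * w r)"
  proof (rule Fubini_triangle)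
    fix x r :: real assume "0 \<le> r" "r \<le> x" "x \<le> t"
    then have "\<bar>\<beta> * exp (- \<beta> * (x - r))\<bar> \<le> \<beta>" using \<beta> by auto
    then show "\<bar>\<beta> * exp (- \<beta> * (x - r)) * w r\<bar> \<le> \<beta> * C"
      unfolding abs_mult[of _ "w r"] using C[of r] \<beta> by (intro mult_mono) auto
  qed measurable
  also have "\<dots> = (LBINT r:{0..t}. w r - exp (- \<beta> * (t - r)) * w r)"
  proof (rule set_lebesgue_integral_cong, simp, intro allI impI)
    fix r assume r: "r \<in> {0..t}"
    have "(LBINT \<tau>:{r..t}. \<beta> * exp (- \<beta> * (\<tau> - r)) * w r) =
        (- exp (- \<beta> * (t - r)) * w r) - (- exp (- \<beta> * (r - r)) * w r)"
      using r by (intro set_integral_FTC) (auto intro!: derivative_eq_intros continuous_intros)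
    then show "(LBINT \<tau>:{r..t}. \<beta> * exp (- \<beta> * (\<tau> - r)) * w r) = w r - exp (- \<beta> * (t - r)) * w r"
      by simp
  qed
  also have "(LBINT \<tau>:{0..t}. exp (- \<beta> * \<tau>) * c) = (- exp (- \<beta> * t) * c / \<beta>) - (- exp (- \<beta> * 0) * c / \<beta>)"
    using \<beta> t by (intro set_integral_FTC) (auto intro!: derivative_eq_intros continuous_intros)
  finally have V: "(LBINT \<tau>:{0..t}. v \<tau>) =
      c / \<beta> - exp (- \<beta> * t) * c / \<beta> + (LBINT r:{0..t}. w r - exp (- \<beta> * (t - r)) * w r)" by simp
  have W: "(LBINT r:{0..t}. w r - exp (- \<beta> * (t - r)) * w r) =
      (LBINT r:{0..t}. w r) - (LBINT r:{0..t}. \<beta> * exp (- \<beta> * (t - r)) * w r) / \<beta>"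
  proof -
    have "(LBINT r:{0..t}. w r - exp (- \<beta> * (t - r)) * w r) =
        (LBINT r:{0..t}. w r - (\<beta> * exp (- \<beta> * (t - r)) * w r) / \<beta>)"
      using \<beta> by simp
    also have "\<dots> = (LBINT r:{0..t}. w r) - (LBINT r:{0..t}. (\<beta> * exp (- \<beta> * (t - r)) * w r) / \<beta>)"
      by (intro set_integral_diff wint set_integrable_divide kint)
    also have "(LBINT r:{0..t}. (\<beta> * exp (- \<beta> * (t - r)) * w r) / \<beta>) =
        (LBINT r:{0..t}. \<beta> * exp (- \<beta> * (t - r)) * w r) / \<beta>"
      by (rule set_integral_divide_zero)
    finally show ?thesis .
  qed
  have "\<beta> * A = c + \<beta> * B - x"
    if "A = c / \<beta> - e * c / \<beta> + D" "D = B - E / \<beta>" "x = e * c + E" for A B D E e x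
    unfolding that using \<beta> by (simp add: algebra_simps)
  from this[OF V W v[OF t]] have "\<beta> * (LBINT \<tau>:{0..t}. v \<tau>) = c + \<beta> * (LBINT r:{0..t}. w r) - v t" .
  moreover have "(LBINT r:{0..t}. w r - v r) = (LBINT r:{0..t}. w r) - (LBINT r:{0..t}. v r)"
    by (intro set_integral_diff wint vint)
  ultimately show ?thesis by (simp add: right_diff_distrib)
qed

lemma integral_exponential_density:
  assumes "0 < a"
  shows "integrable lborel (exponential_density a)" "(\<integral>s. exponential_density a s \<partial>lborel) = 1"
proof -
  interpret prob_space "exp_law a" using assms by (rule prob_space_exponential_density)
  have "(\<integral>s. (1::real) \<partial>exp_law a) = (\<integral>s. exponential_density a s *\<^sub>R 1 \<partial>lborel)"
    using assms by (subst integral_density) (auto simp: exponential_density_nonneg)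
  then show 1: "(\<integral>s. exponential_density a s \<partial>lborel) = 1"
    using prob_space by simp
  then show "integrable lborel (exponential_density a)"
    using not_integrable_integral_eq by force
qed

text \<open>The first segment is longer than \<open>t\<close> with probability \<open>exp (- a * t)\<close>; otherwise it ends at distance
  \<open>r = t - s\<close> from the axis.\<close>

lemma first_step_integral:
  fixes W K :: "real \<Rightarrow> real"
  assumes a: "0 < a" and t: "0 < t" and W: "W \<in> borel_measurable borel" and C: "\<And>r. \<bar>W r\<bar> \<le> C"
    and after: "\<And>s. t < s \<Longrightarrow> K s = c" and before: "\<And>s. 0 < s \<Longrightarrow> s < t \<Longrightarrow> K s = W (t - s)"
  shows "(\<integral>s. exponential_density a s * K s \<partial>lborel) =
    exp (- a * t) * c + (LBINT r:{0..t}. a * exp (- a * (t - r)) * W r)"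
proof -
  note [measurable] = W
  have i1: "set_integrable lborel {0..t} (\<lambda>s. a * exp (- a * s) * W (t - s))"
  proof (rule set_integrable_bounded)
    fix r assume "0 \<le> r" "r \<le> t"
    then have "\<bar>a * exp (- a * r)\<bar> \<le> a" using a by auto
    then show "\<bar>a * exp (- a * r) * W (t - r)\<bar> \<le> a * C"
      unfolding abs_mult[of _ "W _"] using C[of "t - r"] a by (intro mult_mono) auto
  qed measurable
  have i2: "set_integrable lborel {0..t} (\<lambda>s. a * exp (- a * s) * c)"
    by (rule borel_integrable_atLeastAtMost') (intro continuous_intros)
  have i3: "integrable lborel (\<lambda>s. indicator {0..t} s *\<^sub>R (a * exp (- a * s) * W (t - s) - a * exp (- a * s) * c))"
    using set_integral_diff(1)[OF i1 i2] unfolding set_integrable_def .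
  \<comment> \<open>Comparison with the constant \<open>c\<close> avoids integrating over the unbounded tail \<open>s > t\<close>.\<close>
  have i4: "integrable lborel (\<lambda>s. exponential_density a s * c)"
    using integral_exponential_density[OF a] by simp
  have i5: "(\<integral>s. indicator {0..t} s *\<^sub>R (a * exp (- a * s) * W (t - s) - a * exp (- a * s) * c) \<partial>lborel) =
    (LBINT s:{0..t}. a * exp (- a * s) * W (t - s)) - (LBINT s:{0..t}. a * exp (- a * s) * c)"
    using set_integral_diff(2)[OF i1 i2] unfolding set_lebesgue_integral_def .
  have "(\<integral>s. exponential_density a s * K s \<partial>lborel) = (\<integral>s. exponential_density a s * c +
      indicator {0..t} s *\<^sub>R (a * exp (- a * s) * W (t - s) - a * exp (- a * s) * c) \<partial>lborel)"
  proof (rule integral_discrete_difference[of "{0, t}"])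
    fix s :: real assume "s \<notin> {0, t}"
    then consider "s < 0" | "0 < s" "s < t" | "t < s" by fastforce
    then show "exponential_density a s * K s = exponential_density a s * c +
      indicator {0..t} s *\<^sub>R (a * exp (- a * s) * W (t - s) - a * exp (- a * s) * c)"
      using t by cases (auto simp: exponential_density_def after before algebra_simps)
  qed auto
  also have "\<dots> = c + ((LBINT s:{0..t}. a * exp (- a * s) * W (t - s)) - (LBINT s:{0..t}. a * exp (- a * s) * c))"
    unfolding Bochner_Integration.integral_add[OF i4 i3] i5
    using integral_exponential_density[OF a] by simp
  also have "(LBINT s:{0..t}. a * exp (- a * s) * c) = (- exp (- a * t) * c) - (- exp (- a * 0) * c)"
    using t by (intro set_integral_FTC) (auto intro!: derivative_eq_intros continuous_intros)
  also have "(LBINT s:{0..t}. a * exp (- a * s) * W (t - s)) = (LBINT r:{0..t}. a * exp (- a * (t - r)) * W r)"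
    using set_integral_reflect[where f="\<lambda>r. a * exp (- a * (t - r)) * W r" and t=t] by simp
  finally show ?thesis by simp
qed

text \<open>Path functionals from \<open>(x, y)\<close> with vertical and horizontal start, and what the first segment decides
  about them: crossing the x-axis fixes the value \<open>h x\<close>, crossing the y-axis gives 0, and turning before
  hands over to the remaining path. A segment that ends exactly on an axis has probability 0.\<close>

locale renewal_pair =
  fixes a b C :: real and ZV ZH :: "real \<Rightarrow> real \<Rightarrow> (nat \<Rightarrow> real) \<Rightarrow> real" and h :: "real \<Rightarrow> real"
  assumes a: "0 < a" and b: "0 < b"
    and ZV_measurable: "(\<lambda>((x, y), L). ZV x y L) \<in> borel_measurable ((borel \<Otimes>\<^sub>M borel) \<Otimes>\<^sub>M seq_space)"
    and ZH_measurable: "(\<lambda>((x, y), L). ZH x y L) \<in> borel_measurable ((borel \<Otimes>\<^sub>M borel) \<Otimes>\<^sub>M seq_space)"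
    and ZV_bounded: "\<And>x y L. \<bar>ZV x y L\<bar> \<le> C" and ZH_bounded: "\<And>x y L. \<bar>ZH x y L\<bar> \<le> C"
    and ZV_crossing: "\<And>x y s L. regular L \<Longrightarrow> 0 < x \<Longrightarrow> 0 < y \<Longrightarrow> y < s \<Longrightarrow> ZV x y (case_nat s L) = h x"
    and ZV_turn: "\<And>x y s L. regular L \<Longrightarrow> 0 < x \<Longrightarrow> 0 < s \<Longrightarrow> s < y \<Longrightarrow> ZV x y (case_nat s L) = ZH x (y - s) L"
    and ZH_crossing: "\<And>x y s L. regular L \<Longrightarrow> 0 < x \<Longrightarrow> 0 < y \<Longrightarrow> x < s \<Longrightarrow> ZH x y (case_nat s L) = 0"
    and ZH_turn: "\<And>x y s L. regular L \<Longrightarrow> 0 < y \<Longrightarrow> 0 < s \<Longrightarrow> s < x \<Longrightarrow> ZH x y (case_nat s L) = ZV (x - s) y L"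
begin

definition EV :: "real \<Rightarrow> real \<Rightarrow> real" where
  "EV x y = (\<integral>L. ZV x y L \<partial>length_law a b)"

definition EH :: "real \<Rightarrow> real \<Rightarrow> real" where
  "EH x y = (\<integral>L. ZH x y L \<partial>length_law b a)"

lemma expectation_measurable_bounded:
  assumes M: "prob_space M" "sets M = sets seq_space"
    and Z: "(\<lambda>((x, y), L). Z x y L) \<in> borel_measurable ((borel \<Otimes>\<^sub>M borel) \<Otimes>\<^sub>M seq_space)"
    and bd: "\<And>x y L. \<bar>Z x y L\<bar> \<le> C"
  shows "(\<lambda>(x, y). \<integral>L. Z x y L \<partial>M) \<in> borel_measurable (borel \<Otimes>\<^sub>M borel)"
    and "\<bar>\<integral>L. Z x y L \<partial>M\<bar> \<le> C"
    and "Z x y \<in> borel_measurable seq_space"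
proof -
  interpret prob_space M by fact
  have "(\<lambda>(p, L). Z (fst p) (snd p) L) \<in> borel_measurable ((borel \<Otimes>\<^sub>M borel) \<Otimes>\<^sub>M M)"
    using Z M(2) by (simp add: split_beta' cong: measurable_cong_sets)
  from borel_measurable_lebesgue_integral[OF this]
  show "(\<lambda>(x, y). \<integral>L. Z x y L \<partial>M) \<in> borel_measurable (borel \<Otimes>\<^sub>M borel)"
    by (simp add: split_beta')
  have "(\<lambda>L. ((x, y), L)) \<in> measurable seq_space ((borel \<Otimes>\<^sub>M borel) \<Otimes>\<^sub>M seq_space)"
    by measurable
  from measurable_compose[OF this Z] show m: "Z x y \<in> borel_measurable seq_space" by simp
  have "Z x y \<in> borel_measurable M" using m M(2) by (simp cong: measurable_cong_sets)
  then have "integrable M (Z x y)"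
    by (intro integrable_const_bound[where B=C]) (auto simp: bd)
  then have "\<bar>\<integral>L. Z x y L \<partial>M\<bar> \<le> (\<integral>L. C \<partial>M)"
    using bd by (intro order_trans[OF integral_abs_bound] integral_mono) auto
  then show "\<bar>\<integral>L. Z x y L \<partial>M\<bar> \<le> C" by (simp add: prob_space)
qed

lemma EV_measurable: "(\<lambda>(x, y). EV x y) \<in> borel_measurable (borel \<Otimes>\<^sub>M borel)"
  and EV_bounded: "\<bar>EV x y\<bar> \<le> C"
  and ZV_slice: "ZV x y \<in> borel_measurable seq_space"
  unfolding EV_def
  using expectation_measurable_bounded[OF prob_space_length_law(1)[OF a b] sets_length_law ZV_measurable ZV_bounded]
  by auto

lemma EH_measurable: "(\<lambda>(x, y). EH x y) \<in> borel_measurable (borel \<Otimes>\<^sub>M borel)"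
  and EH_bounded: "\<bar>EH x y\<bar> \<le> C"
  and ZH_slice: "ZH x y \<in> borel_measurable seq_space"
  unfolding EH_def
  using expectation_measurable_bounded[OF prob_space_length_law(2)[OF a b] sets_length_law ZH_measurable ZH_bounded]
  by auto

lemma slice_measurable:
  assumes "(\<lambda>(x, y). f x y) \<in> borel_measurable (borel \<Otimes>\<^sub>M borel)"
  shows "f x \<in> borel_measurable borel" "(\<lambda>x. f x y) \<in> borel_measurable borel"
  using measurable_compose[OF measurable_Pair1' assms, of x] measurable_compose[OF measurable_Pair2' assms, of y] by auto

lemma integral_length_law_AE:
  assumes "0 < p" "0 < q" "F \<in> borel_measurable seq_space" "\<And>L. \<bar>F L\<bar> \<le> C"
    and "\<And>L. regular L \<Longrightarrow> F (case_nat s L) = G L" "G \<in> borel_measurable seq_space"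
  shows "(\<integral>L. F (case_nat s L) \<partial>length_law q p) = (\<integral>L. G L \<partial>length_law q p)"
proof (rule integral_cong_AE)
  have "(\<lambda>L. case_nat s L) \<in> measurable seq_space seq_space"
    by (rule measurable_case_nat_seq) auto
  from measurable_compose[OF this assms(3)] show "(\<lambda>L. F (case_nat s L)) \<in> borel_measurable (length_law q p)"
    by (simp cong: measurable_cong_sets)
  show "G \<in> borel_measurable (length_law q p)" using assms by (simp cong: measurable_cong_sets)
  show "AE L in length_law q p. F (case_nat s L) = G L"
    using AE_regular[OF assms(2,1)] by eventually_elim (rule assms)
qed

lemma EV_renewal:
  assumes "0 < x" "0 < y"
  shows "EV x y = exp (- a * y) * h x + (LBINT r:{0..y}. a * exp (- a * (y - r)) * EH x r)"
proof -
  let ?K = "\<lambda>s. \<integral>L. ZV x y (case_nat s L) \<partial>length_law b a"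
  interpret prob_space "length_law b a" by (rule prob_space_length_law[OF a b])
  have "EV x y = (\<integral>s. exponential_density a s * ?K s \<partial>lborel)"
    unfolding EV_def by (rule integral_length_law[OF a b ZV_slice ZV_bounded])
  also have "\<dots> = exp (- a * y) * h x + (LBINT r:{0..y}. a * exp (- a * (y - r)) * EH x r)"
  proof (rule first_step_integral[OF a assms(2) slice_measurable(1)[OF EH_measurable] EH_bounded])
    fix s assume "y < s"
    then have "?K s = (\<integral>L. h x \<partial>length_law b a)"
      using assms by (intro integral_length_law_AE[OF a b ZV_slice ZV_bounded]) (auto simp: ZV_crossing)
    also have "\<dots> = h x" using prob_space by simp
    finally show "?K s = h x" .
  next
    fix s assume "0 < s" "s < y"
    then show "?K s = EH x (y - s)"
      unfolding EH_def using assms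
      by (intro integral_length_law_AE[OF a b ZV_slice ZV_bounded] ZV_turn ZH_slice) auto
  qed
  finally show ?thesis .
qed

lemma EH_renewal:
  assumes "0 < x" "0 < y"
  shows "EH x y = (LBINT r:{0..x}. b * exp (- b * (x - r)) * EV r y)"
proof -
  let ?K = "\<lambda>s. \<integral>L. ZH x y (case_nat s L) \<partial>length_law a b"
  interpret prob_space "length_law a b" by (rule prob_space_length_law[OF a b])
  have "EH x y = (\<integral>s. exponential_density b s * ?K s \<partial>lborel)"
    unfolding EH_def by (rule integral_length_law[OF b a ZH_slice ZH_bounded])
  also have "\<dots> = exp (- b * x) * 0 + (LBINT r:{0..x}. b * exp (- b * (x - r)) * EV r y)"
  proof (rule first_step_integral[OF b assms(1) slice_measurable(2)[OF EV_measurable] EV_bounded])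
    fix s assume "x < s"
    then have "?K s = (\<integral>L. 0 \<partial>length_law a b)"
      using assms by (intro integral_length_law_AE[OF b a ZH_slice ZH_bounded]) (auto simp: ZH_crossing)
    then show "?K s = 0" by simp
  next
    fix s assume "0 < s" "s < x"
    then show "?K s = EV (x - s) y"
      unfolding EV_def using assms
      by (intro integral_length_law_AE[OF b a ZH_slice ZH_bounded] ZH_turn ZV_slice) auto
  qed
  finally show ?thesis by simp
qed

lemma slice_integrable:
  "set_integrable lborel {p..q} (EV x)" "set_integrable lborel {p..q} (\<lambda>x. EV x y)"
  "set_integrable lborel {p..q} (EH x)" "set_integrable lborel {p..q} (\<lambda>x. EH x y)"
  by (rule set_integrable_bounded[where C=C],
      auto intro: slice_measurable EV_measurable EH_measurable EV_bounded EH_bounded)+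

text \<open>The integrated forms of \<open>\<partial>EV / \<partial>y = a * (EH - EV)\<close> and \<open>\<partial>EH / \<partial>x = b * (EV - EH)\<close>.\<close>

lemma EV_eq:
  assumes "0 < x" "0 < y"
  shows "EV x y = h x + a * (LBINT r:{0..y}. EH x r - EV x r)"
  by (rule exponential_kernel_resolvent[OF a slice_measurable(1)[OF EH_measurable] EH_bounded EV_renewal slice_integrable(1)])
     (use assms in auto)

lemma EH_eq:
  assumes "0 < x" "0 < y"
  shows "EH x y = b * (LBINT r:{0..x}. EV r y - EH r y)"
proof -
  have "EH x y = 0 + b * (LBINT r:{0..x}. EV r y - EH r y)"
    by (rule exponential_kernel_resolvent[OF b slice_measurable(2)[OF EV_measurable] EV_bounded _ slice_integrable(4)])
       (use assms in \<open>auto simp: EH_renewal\<close>)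
  then show ?thesis by simp
qed

text \<open>Integrating \<open>EV_eq\<close> over \<open>x\<close> and \<open>EH_eq\<close> over \<open>y\<close> produces the double integral of \<open>EV - EH\<close> twice, with
  opposite signs.\<close>

lemma EV_integral_equation:
  assumes h: "h \<in> borel_measurable borel" "\<And>x. \<bar>h x\<bar> \<le> C" and xy: "0 < x" "0 < y"
  shows "EV x y + b * (LBINT r:{0..x}. EV r y) + a * (LBINT r:{0..y}. EV x r) =
    h x + b * (LBINT r:{0..x}. h r)"
proof -
  let ?D = "\<lambda>r s. EV r s - EH r s"
  have D: "(\<lambda>(r, s). ?D r s) \<in> borel_measurable (borel \<Otimes>\<^sub>M borel)"
    using EV_measurable EH_measurable by (simp add: split_beta')
  have D_bd: "\<bar>?D r s\<bar> \<le> 2 * C" for r s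
    using EV_bounded[of r s] EH_bounded[of r s] by linarith
  let ?I = "LBINT r:{0..x}. LBINT s:{0..y}. ?D r s"
  have 1: "EV x y = h x + a * (LBINT r:{0..y}. EH x r) - a * (LBINT r:{0..y}. EV x r)"
    unfolding EV_eq[OF xy] by (subst set_integral_diff) (auto intro: slice_integrable simp: algebra_simps)
  have "(LBINT s:{0..y}. EH x s) = (LBINT s:{0..y}. b * (LBINT r:{0..x}. ?D r s))"
    by (rule set_integral_eq_off_point[of _ 0]) (use xy EH_eq in auto)
  also have "\<dots> = b * (LBINT s:{0..y}. LBINT r:{0..x}. ?D r s)" by simp
  also have "(LBINT s:{0..y}. LBINT r:{0..x}. ?D r s) = ?I"
    by (rule Fubini_bounded[symmetric, OF D D_bd])
  finally have 2: "(LBINT s:{0..y}. EH x s) = b * ?I" .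
  have "(LBINT r:{0..x}. EV r y) = (LBINT r:{0..x}. h r + a * (LBINT s:{0..y}. EH r s - EV r s))"
    by (rule set_integral_eq_off_point[of _ 0]) (use xy EV_eq in auto)
  also have "\<dots> = (LBINT r:{0..x}. h r - a * (LBINT s:{0..y}. ?D r s))"
  proof -
    have "(LBINT s:{0..y}. EH r s - EV r s) = - (LBINT s:{0..y}. ?D r s)" for r
      unfolding set_lebesgue_integral_def integral_minus[symmetric] by (simp add: algebra_simps)
    then show ?thesis by simp
  qed
  also have "\<dots> = (LBINT r:{0..x}. h r) - (LBINT r:{0..x}. a * (LBINT s:{0..y}. ?D r s))"
  proof (rule set_integral_diff(2))
    show "set_integrable lborel {0..x} h"
      by (rule set_integrable_bounded[OF h])
    show "set_integrable lborel {0..x} (\<lambda>r. a * (LBINT s:{0..y}. ?D r s))"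
    proof (rule set_integrable_bounded)
      have "(\<lambda>r. LBINT s:{0..y}. ?D r s) \<in> borel_measurable borel"
        by (rule borel_measurable_set_integral[OF D]) measurable
      then show "(\<lambda>r. a * (LBINT s:{0..y}. ?D r s)) \<in> borel_measurable borel" by measurable
      show "\<bar>a * (LBINT s:{0..y}. ?D r s)\<bar> \<le> a * (2 * C * (y - 0))" for r
        unfolding abs_mult using a xy D_bd by (intro mult_mono abs_set_integral_le) auto
    qed
  qed
  finally have 3: "(LBINT r:{0..x}. EV r y) = (LBINT r:{0..x}. h r) - a * ?I" by simp
  show ?thesis unfolding 3 using 1 2 by (simp add: algebra_simps)
qed

end

section \<open>Uniqueness and superposition for the integral equation\<close>

lemma abs_set_integral_le_exp:
  fixes f :: "real \<Rightarrow> real"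
  assumes l: "0 < l" and x: "0 \<le> x" and K: "0 \<le> K" and f: "\<And>r. 0 < r \<Longrightarrow> r \<le> x \<Longrightarrow> \<bar>f r\<bar> \<le> K * exp (l * r)"
  shows "\<bar>LBINT r:{0..x}. f r\<bar> \<le> K * exp (l * x) / l"
proof -
  define f' where "f' r = (if r = 0 then 0 else f r)" for r
  have "(LBINT r:{0..x}. f r) = (LBINT r:{0..x}. f' r)"
    by (rule set_integral_eq_off_point[of _ 0]) (auto simp: f'_def)
  also have "\<bar>\<dots>\<bar> \<le> (\<integral>r. \<bar>indicator {0..x} r *\<^sub>R f' r\<bar> \<partial>lborel)"
    unfolding set_lebesgue_integral_def by (rule integral_abs_bound)
  also have "\<dots> \<le> (\<integral>r. indicator {0..x} r *\<^sub>R (K * exp (l * r)) \<partial>lborel)"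
  proof (rule integral_mono')
    have "set_integrable lborel {0..x} (\<lambda>r. K * exp (l * r))"
      by (rule borel_integrable_atLeastAtMost') (intro continuous_intros)
    then show "integrable lborel (\<lambda>r. indicator {0..x} r *\<^sub>R (K * exp (l * r)))"
      unfolding set_integrable_def .
    fix r
    show "0 \<le> indicator {0..x} r *\<^sub>R (K * exp (l * r))"
      using K by simp
    show "\<bar>indicator {0..x} r *\<^sub>R f' r\<bar> \<le> indicator {0..x} r *\<^sub>R (K * exp (l * r))"
      using f[of r] K by (auto simp: indicator_def f'_def)
  qed
  also have "\<dots> = (LBINT r:{0..x}. K * exp (l * r))"
    unfolding set_lebesgue_integral_def ..
  also have "\<dots> = K * exp (l * x) / l - K * exp (l * 0) / l"
    using l x by (intro set_integral_FTC) (auto intro!: derivative_eq_intros continuous_intros)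
  also have "\<dots> \<le> K * exp (l * x) / l" using K l by simp
  finally show ?thesis .
qed

text \<open>Relative to the weight \<open>exp (l * (x + y))\<close> with \<open>l = 2 * (a + b)\<close>, the integral operator halves any
  bound on \<open>d\<close>, so that iteration gives 0.\<close>

lemma homogeneous_integral_equation_zero:
  fixes d :: "real \<Rightarrow> real \<Rightarrow> real"
  assumes a: "0 < a" and b: "0 < b"
    and bd: "\<And>x y. 0 < x \<Longrightarrow> x \<le> A \<Longrightarrow> 0 < y \<Longrightarrow> y \<le> B \<Longrightarrow> \<bar>d x y\<bar> \<le> K"
    and eq: "\<And>x y. 0 < x \<Longrightarrow> x \<le> A \<Longrightarrow> 0 < y \<Longrightarrow> y \<le> B \<Longrightarrow>
      d x y + b * (LBINT r:{0..x}. d r y) + a * (LBINT r:{0..y}. d x r) = 0"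
    and xy: "0 < x" "x \<le> A" "0 < y" "y \<le> B"
  shows "d x y = 0"
proof -
  define l where "l = 2 * (a + b)"
  have l: "0 < l" using a b by (simp add: l_def)
  have K: "0 \<le> K" using bd[OF xy] by linarith
  have "\<bar>d x y\<bar> \<le> K * (1/2)^n * exp (l * (x + y))"
    if "0 < x" "x \<le> A" "0 < y" "y \<le> B" for n x y
    using that
  proof (induction n arbitrary: x y)
    case 0
    have "1 \<le> exp (l * (x + y))" using 0 l by simp
    then have "K * 1 \<le> K * exp (l * (x + y))" using K by (intro mult_left_mono)
    with bd[OF 0] show ?case by simp
  next
    case (Suc n)
    let ?k = "K * (1/2)^n"
    have 1: "\<bar>LBINT r:{0..x}. d r y\<bar> \<le> (?k * exp (l * y)) * exp (l * x) / l"
    proof (rule abs_set_integral_le_exp[OF l])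
      fix r assume "0 < r" "r \<le> x"
      then have "\<bar>d r y\<bar> \<le> ?k * exp (l * (r + y))" using Suc by auto
      then show "\<bar>d r y\<bar> \<le> ?k * exp (l * y) * exp (l * r)"
        by (simp add: distrib_left exp_add mult_ac)
    qed (use Suc K in auto)
    have 2: "\<bar>LBINT r:{0..y}. d x r\<bar> \<le> (?k * exp (l * x)) * exp (l * y) / l"
    proof (rule abs_set_integral_le_exp[OF l])
      fix r assume "0 < r" "r \<le> y"
      then have "\<bar>d x r\<bar> \<le> ?k * exp (l * (x + r))" using Suc by auto
      then show "\<bar>d x r\<bar> \<le> ?k * exp (l * x) * exp (l * r)"
        by (simp add: distrib_left exp_add mult_ac)
    qed (use Suc K in auto)
    have "\<bar>d x y\<bar> = \<bar>b * (LBINT r:{0..x}. d r y) + a * (LBINT r:{0..y}. d x r)\<bar>"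
      using eq[OF Suc.prems] by linarith
    also have "\<dots> \<le> b * \<bar>LBINT r:{0..x}. d r y\<bar> + a * \<bar>LBINT r:{0..y}. d x r\<bar>"
      using a b by (intro order_trans[OF abs_triangle_ineq]) (simp add: abs_mult)
    also have "\<dots> \<le> b * ((?k * exp (l * y)) * exp (l * x) / l) + a * ((?k * exp (l * x)) * exp (l * y) / l)"
      using 1 2 a b by (intro add_mono mult_left_mono) auto
    also have "\<dots> = (a + b) / l * ?k * exp (l * (x + y))"
      by (simp add: distrib_left distrib_right exp_add mult_ac add_divide_distrib)
    also have "(a + b) / l = 1/2" using a b by (simp add: l_def)
    finally show ?case by (simp add: mult_ac)
  qed
  from this[OF xy] have bound: "\<bar>d x y\<bar> \<le> K * (1/2)^n * exp (l * (x + y))" for n .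
  have "(\<lambda>n. K * (1/2)^n * exp (l * (x + y))) \<longlonglongrightarrow> K * 0 * exp (l * (x + y))"
    by (intro tendsto_intros LIMSEQ_realpow_zero) auto
  then have "\<bar>d x y\<bar> \<le> K * 0 * exp (l * (x + y))"
    by (rule LIMSEQ_le_const) (use bound in auto)
  then show ?thesis by simp
qed

text \<open>Exchanging integrals, the two single integrals of \<open>U\<close> become double integrals of \<open>u\<close> against integrals
  of \<open>D\<close>; the equation for \<open>D\<close> adds the three kernels up to 1.\<close>

lemma superposition_integral_equation:
  fixes D u :: "real \<Rightarrow> real \<Rightarrow> real"
  assumes D: "(\<lambda>(x, y). D x y) \<in> borel_measurable (borel \<Otimes>\<^sub>M borel)" and CD: "\<And>x y. \<bar>D x y\<bar> \<le> CD"
    and u: "(\<lambda>(x, y). u x y) \<in> borel_measurable (borel \<Otimes>\<^sub>M borel)" and Cu: "\<And>x y. \<bar>u x y\<bar> \<le> Cu"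
    and D_eq: "\<And>x y. 0 < x \<Longrightarrow> 0 < y \<Longrightarrow>
      D x y + b * (LBINT r:{0..x}. D r y) + a * (LBINT r:{0..y}. D x r) = 1"
    and XY: "0 < X" "0 < Y"
  defines "U \<equiv> (\<lambda>x y. LBINT s:{0..x}. LBINT t:{0..y}. D (x - s) (y - t) * u s t)"
  shows "U X Y + b * (LBINT x:{0..X}. U x Y) + a * (LBINT y:{0..Y}. U X y) = (LBINT s:{0..X}. LBINT t:{0..Y}. u s t)"
proof -
  have CD0: "0 \<le> CD" "0 \<le> Cu" using CD[of 0 0] Cu[of 0 0] by linarith+
  note D' = measurable_curried[OF D]
  note u' = measurable_curried[OF u]
  have Du_bd: "\<bar>D p q * u s t\<bar> \<le> CD * Cu" for p q s t
    unfolding abs_mult using CD Cu CD0 by (intro mult_mono) auto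
  define f1 where "f1 s t = D (X - s) (Y - t) * u s t" for s t
  define f2 where "f2 s t = (LBINT r:{0..X - s}. D r (Y - t)) * u s t" for s t
  define f3 where "f3 s t = (LBINT r:{0..Y - t}. D (X - s) r) * u s t" for s t
  have m1: "(\<lambda>(s, t). f1 s t) \<in> borel_measurable (borel \<Otimes>\<^sub>M borel)"
    unfolding f1_def split_beta' by (intro borel_measurable_times D' u') measurable
  have m2: "(\<lambda>(s, t). f2 s t) \<in> borel_measurable (borel \<Otimes>\<^sub>M borel)"
    unfolding f2_def split_beta'
  proof (intro borel_measurable_times u')
    show "(\<lambda>p. LBINT r:{0..X - fst p}. D r (Y - snd p)) \<in> borel_measurable (borel \<Otimes>\<^sub>M borel)"
    proof (rule borel_measurable_set_integral)
      show "(\<lambda>(x, y). D y (Y - snd x)) \<in> borel_measurable ((borel \<Otimes>\<^sub>M borel) \<Otimes>\<^sub>M borel)"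
        unfolding split_beta' by (intro D') measurable
    qed measurable
  qed measurable
  have m3: "(\<lambda>(s, t). f3 s t) \<in> borel_measurable (borel \<Otimes>\<^sub>M borel)"
    unfolding f3_def split_beta'
  proof (intro borel_measurable_times u')
    show "(\<lambda>p. LBINT r:{0..Y - snd p}. D (X - fst p) r) \<in> borel_measurable (borel \<Otimes>\<^sub>M borel)"
    proof (rule borel_measurable_set_integral)
      show "(\<lambda>(x, y). D (X - fst x) y) \<in> borel_measurable ((borel \<Otimes>\<^sub>M borel) \<Otimes>\<^sub>M borel)"
        unfolding split_beta' by (intro D') measurable
    qed measurable
  qed measurable
  have b1: "\<bar>f1 s t\<bar> \<le> CD * Cu" for s t unfolding f1_def by (rule Du_bd)
  have b2: "\<bar>f2 s t\<bar> \<le> CD * X * Cu" if "0 \<le> s" "s \<le> X" for s t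
  proof -
    have "\<bar>LBINT r:{0..X - s}. D r (Y - t)\<bar> \<le> CD * (X - s - 0)"
      using that CD by (intro abs_set_integral_le) auto
    also have "\<dots> \<le> CD * X" using that CD0 by (intro mult_left_mono) auto
    finally show ?thesis unfolding f2_def abs_mult using Cu CD0 XY by (intro mult_mono) auto
  qed
  have b3: "\<bar>f3 s t\<bar> \<le> CD * Y * Cu" if "0 \<le> t" "t \<le> Y" for s t
  proof -
    have "\<bar>LBINT r:{0..Y - t}. D (X - s) r\<bar> \<le> CD * (Y - t - 0)"
      using that CD by (intro abs_set_integral_le) auto
    also have "\<dots> \<le> CD * Y" using that CD0 by (intro mult_left_mono) auto
    finally show ?thesis unfolding f3_def abs_mult using Cu CD0 XY by (intro mult_mono) auto
  qed
  \<comment> \<open>First the triangle \<open>s \<le> x\<close> is swept in the other order, then, for fixed \<open>s\<close>, \<open>x\<close> and \<open>t\<close> are exchanged.\<close>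
  have "(LBINT x:{0..X}. U x Y) = (LBINT s:{0..X}. LBINT x:{s..X}. LBINT t:{0..Y}. D (x - s) (Y - t) * u s t)"
    unfolding U_def
  proof (rule Fubini_triangle)
    show "(\<lambda>(x, s). LBINT t:{0..Y}. D (x - s) (Y - t) * u s t) \<in> borel_measurable (borel \<Otimes>\<^sub>M borel)"
      unfolding split_beta'
    proof (rule borel_measurable_set_integral)
      show "(\<lambda>(p, t). D (fst p - snd p) (Y - t) * u (snd p) t) \<in> borel_measurable ((borel \<Otimes>\<^sub>M borel) \<Otimes>\<^sub>M borel)"
        unfolding split_beta' by (intro borel_measurable_times D' u') measurable
    qed measurable
    show "\<bar>LBINT t:{0..Y}. D (x - s) (Y - t) * u s t\<bar> \<le> CD * Cu * (Y - 0)" for x s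
      using XY Du_bd by (intro abs_set_integral_le) auto
  qed
  also have "\<dots> = (LBINT s:{0..X}. LBINT t:{0..Y}. f2 s t)"
  proof (rule set_lebesgue_integral_cong, simp, intro allI impI)
    fix s assume "s \<in> {0..X}"
    have "(LBINT x:{s..X}. LBINT t:{0..Y}. D (x - s) (Y - t) * u s t) =
        (LBINT t:{0..Y}. LBINT x:{s..X}. D (x - s) (Y - t) * u s t)"
    proof (rule Fubini_bounded)
      show "(\<lambda>(x, t). D (x - s) (Y - t) * u s t) \<in> borel_measurable (borel \<Otimes>\<^sub>M borel)"
        unfolding split_beta' by (intro borel_measurable_times D' u') measurable
    qed (rule Du_bd)
    also have "\<dots> = (LBINT t:{0..Y}. f2 s t)"
      unfolding f2_def set_integral_mult_left set_integral_shift[of s X "\<lambda>r. D r (Y - t)" for t] ..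
    finally show "(LBINT x:{s..X}. LBINT t:{0..Y}. D (x - s) (Y - t) * u s t) = (LBINT t:{0..Y}. f2 s t)" .
  qed
  finally have 2: "(LBINT x:{0..X}. U x Y) = (LBINT s:{0..X}. LBINT t:{0..Y}. f2 s t)" .
  have "(LBINT y:{0..Y}. U X y) = (LBINT s:{0..X}. LBINT y:{0..Y}. LBINT t:{0..y}. D (X - s) (y - t) * u s t)"
    unfolding U_def
  proof (rule Fubini_bounded)
    show "(\<lambda>(y, s). LBINT t:{0..y}. D (X - s) (y - t) * u s t) \<in> borel_measurable (borel \<Otimes>\<^sub>M borel)"
      unfolding split_beta'
    proof (rule borel_measurable_set_integral)
      show "(\<lambda>(p, t). D (X - snd p) (fst p - t) * u (snd p) t) \<in> borel_measurable ((borel \<Otimes>\<^sub>M borel) \<Otimes>\<^sub>M borel)"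
        unfolding split_beta' by (intro borel_measurable_times D' u') measurable
    qed measurable
    show "\<bar>LBINT t:{0..y}. D (X - s) (y - t) * u s t\<bar> \<le> CD * Cu * Y" if "0 \<le> y" "y \<le> Y" for y s
    proof -
      have "\<bar>LBINT t:{0..y}. D (X - s) (y - t) * u s t\<bar> \<le> CD * Cu * (y - 0)"
        using that Du_bd by (intro abs_set_integral_le) auto
      also have "\<dots> \<le> CD * Cu * Y" using that CD0 by (intro mult_left_mono) auto
      finally show ?thesis .
    qed
  qed
  also have "\<dots> = (LBINT s:{0..X}. LBINT t:{0..Y}. f3 s t)"
  proof (rule set_lebesgue_integral_cong, simp, intro allI impI)
    fix s assume "s \<in> {0..X}"
    have "(LBINT y:{0..Y}. LBINT t:{0..y}. D (X - s) (y - t) * u s t) =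
        (LBINT t:{0..Y}. LBINT y:{t..Y}. D (X - s) (y - t) * u s t)"
    proof (rule Fubini_triangle)
      show "(\<lambda>(y, t). D (X - s) (y - t) * u s t) \<in> borel_measurable (borel \<Otimes>\<^sub>M borel)"
        unfolding split_beta' by (intro borel_measurable_times D' u') measurable
    qed (rule Du_bd)
    also have "\<dots> = (LBINT t:{0..Y}. f3 s t)"
      unfolding f3_def set_integral_mult_left set_integral_shift[of t Y "D (X - s)" for t] ..
    finally show "(LBINT y:{0..Y}. LBINT t:{0..y}. D (X - s) (y - t) * u s t) = (LBINT t:{0..Y}. f3 s t)" .
  qed
  finally have 3: "(LBINT y:{0..Y}. U X y) = (LBINT s:{0..X}. LBINT t:{0..Y}. f3 s t)" .
  have "(LBINT s:{0..X}. LBINT t:{0..Y}. u s t) = (LBINT s:{0..X}. LBINT t:{0..Y}. (f1 s t + b * f2 s t) + a * f3 s t)"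
  proof (rule set_integral_eq_off_point[of _ X])
    fix s assume s: "s \<in> {0..X}" "s \<noteq> X"
    show "(LBINT t:{0..Y}. u s t) = (LBINT t:{0..Y}. (f1 s t + b * f2 s t) + a * f3 s t)"
    proof (rule set_integral_eq_off_point[of _ Y])
      fix t assume t: "t \<in> {0..Y}" "t \<noteq> Y"
      have "(f1 s t + b * f2 s t) + a * f3 s t = (D (X - s) (Y - t) + b * (LBINT r:{0..X - s}. D r (Y - t))
          + a * (LBINT r:{0..Y - t}. D (X - s) r)) * u s t"
        unfolding f1_def f2_def f3_def by (simp add: algebra_simps)
      also have "D (X - s) (Y - t) + b * (LBINT r:{0..X - s}. D r (Y - t)) + a * (LBINT r:{0..Y - t}. D (X - s) r) = 1"
        using s t by (intro D_eq) auto
      finally show "u s t = (f1 s t + b * f2 s t) + a * f3 s t" by simp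
    qed
  qed
  also have "\<dots> = (LBINT s:{0..X}. LBINT t:{0..Y}. f1 s t + b * f2 s t) + a * (LBINT s:{0..X}. LBINT t:{0..Y}. f3 s t)"
  proof (rule iterated_integral_add_scaled)
    show "(\<lambda>(s, t). f1 s t + b * f2 s t) \<in> borel_measurable (borel \<Otimes>\<^sub>M borel)"
      using m1 m2 by (simp add: split_beta')
    show "\<bar>f1 s t + b * f2 s t\<bar> \<le> CD * Cu + \<bar>b\<bar> * (CD * X * Cu)" if "0 \<le> s" "s \<le> X" for s t
      by (rule order_trans[OF abs_triangle_ineq], unfold abs_mult[of b])
         (intro add_mono mult_left_mono b1 b2 that abs_ge_zero)
  qed (use m3 b3 XY in auto)
  also have "(LBINT s:{0..X}. LBINT t:{0..Y}. f1 s t + b * f2 s t) =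
      (LBINT s:{0..X}. LBINT t:{0..Y}. f1 s t) + b * (LBINT s:{0..X}. LBINT t:{0..Y}. f2 s t)"
    by (rule iterated_integral_add_scaled[OF m1 m2 b1 b2]) (use XY in auto)
  finally show ?thesis
    unfolding 2 3 by (simp add: U_def f1_def)
qed

section \<open>The integral equation of a telegraph solution\<close>

text \<open>The fundamental theorem for the Henstock-Kurzweil integral asks for no regularity of the derivative.
  This matters because the first partial derivatives of a solution are only known to exist.\<close>

lemma set_integral_FTC_integrable:
  fixes F f g :: "real \<Rightarrow> real"
  assumes "a \<le> b" and F: "\<And>x. a \<le> x \<Longrightarrow> x \<le> b \<Longrightarrow> (F has_real_derivative f x) (at x)"
    and fg: "\<And>x. a \<le> x \<Longrightarrow> x \<le> b \<Longrightarrow> f x = g x" and g: "set_integrable lborel {a..b} g"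
  shows "(LBINT x:{a..b}. g x) = F b - F a"
proof -
  have "(f has_integral (F b - F a)) {a..b}"
    using assms(1) F
    by (intro fundamental_theorem_of_calculus)
       (auto simp: has_real_derivative_iff_has_vector_derivative[symmetric] intro: DERIV_subset)
  then have "(g has_integral (F b - F a)) {a..b}"
    by (rule has_integral_eq[rotated]) (use fg in auto)
  then show ?thesis
    using set_borel_integral_eq_integral(2)[OF g] by (simp add: integral_unique)
qed

text \<open>Continuity on the whole plane gives Borel measurability at once.\<close>

lemma continuous_clamp:
  fixes f :: "real \<Rightarrow> real \<Rightarrow> real"
  assumes "continuous_on S (\<lambda>(x, y). f x y)" "\<And>x y. p \<le> x \<Longrightarrow> q \<le> y \<Longrightarrow> (x, y) \<in> S"
  shows "continuous_on UNIV (\<lambda>(x, y). f (max p x) (max q y))"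
proof -
  have "continuous_on UNIV ((\<lambda>(x, y). f x y) \<circ> (\<lambda>z. (max p (fst z), max q (snd z))))"
    using assms by (intro continuous_on_compose continuous_on_subset[OF assms(1)] continuous_intros) auto
  then show ?thesis by (simp add: comp_def split_beta')
qed

lemma continuous_imp_measurable_pair:
  fixes f :: "real \<Rightarrow> real \<Rightarrow> real"
  assumes "continuous_on UNIV (\<lambda>(x, y). f x y)"
  shows "(\<lambda>(x, y). f x y) \<in> borel_measurable (borel \<Otimes>\<^sub>M borel)"
  using borel_measurable_continuous_onI[OF assms] by (simp add: borel_prod)

lemma continuous_imp_bounded_rectangle:
  fixes f :: "real \<Rightarrow> real \<Rightarrow> real"
  assumes "continuous_on UNIV (\<lambda>(x, y). f x y)"
  obtains C where "\<And>x y. a \<le> x \<Longrightarrow> x \<le> b \<Longrightarrow> c \<le> y \<Longrightarrow> y \<le> d \<Longrightarrow> \<bar>f x y\<bar> \<le> C"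
proof -
  have "compact ((\<lambda>(x, y). f x y) ` ({a..b} \<times> {c..d}))"
    by (intro compact_continuous_image continuous_on_subset[OF assms] compact_Times) auto
  then obtain C where "\<And>z. z \<in> (\<lambda>(x, y). f x y) ` ({a..b} \<times> {c..d}) \<Longrightarrow> norm z \<le> C"
    using compact_imp_bounded bounded_iff by metis
  then have "\<bar>f x y\<bar> \<le> C" if "a \<le> x" "x \<le> b" "c \<le> y" "y \<le> d" for x y
    using that by (force simp: image_iff)
  then show ?thesis by (rule that)
qed

lemma continuous_pair_sections:
  fixes f :: "real \<Rightarrow> real \<Rightarrow> real"
  assumes "continuous_on UNIV (\<lambda>(x, y). f x y)"
  shows "continuous_on S (f x)" "continuous_on S (\<lambda>x. f x y)"
proof -
  have "continuous_on S ((\<lambda>(x, y). f x y) \<circ> (\<lambda>y. (x, y)))" "continuous_on S ((\<lambda>(x, y). f x y) \<circ> (\<lambda>x. (x, y)))"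
    by (intro continuous_on_compose continuous_on_subset[OF assms] continuous_intros, simp)+
  then show "continuous_on S (f x)" "continuous_on S (\<lambda>x. f x y)" by (simp_all add: comp_def)
qed

lemma set_integrable_section:
  fixes f :: "real \<Rightarrow> real \<Rightarrow> real"
  assumes "continuous_on UNIV (\<lambda>(x, y). f x y)"
  shows "set_integrable lborel {c..d} (f x)" "set_integrable lborel {c..d} (\<lambda>x. f x y)"
  by (auto intro!: borel_integrable_atLeastAtMost' continuous_pair_sections[OF assms])

text \<open>Since \<open>k\<close> is continuous, \<open>\<phi>X x y\<close> differs from its trace \<open>\<phi>X x q\<close> by the well-behaved integral \<open>K x y\<close>.
  Integrating the equation over \<open>y\<close> expresses the trace through bounded measurable functions, and
  integrating over \<open>x\<close> then gives \<open>a * (Y - q) * (\<phi> X q - \<phi> p q)\<close>. The same term appears when the double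
  integral of \<open>K\<close> is taken in the other order, and it cancels.\<close>

lemma telegraph_rectangle:
  fixes \<phi> k u' :: "real \<Rightarrow> real \<Rightarrow> real"
  assumes a: "a \<noteq> 0" and b: "b \<noteq> 0"
    and pq: "p \<le> X" "q < Y"
    and f: "continuous_on UNIV (\<lambda>(x, y). \<phi> x y)" and k: "continuous_on UNIV (\<lambda>(x, y). k x y)"
    and u: "continuous_on UNIV (\<lambda>(x, y). u x y)"
    and dX: "\<And>x y. p \<le> x \<Longrightarrow> q \<le> y \<Longrightarrow> ((\<lambda>x. \<phi> x y) has_real_derivative \<phi>X x y) (at x)"
    and dY: "\<And>x y. p \<le> x \<Longrightarrow> q \<le> y \<Longrightarrow> ((\<lambda>y. \<phi> x y) has_real_derivative \<phi>Y x y) (at y)"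
    and dXY: "\<And>x y. p \<le> x \<Longrightarrow> q \<le> y \<Longrightarrow> ((\<lambda>y. \<phi>X x y) has_real_derivative k x y) (at y)"
    and eq: "\<And>x y. p \<le> x \<Longrightarrow> q \<le> y \<Longrightarrow> k x y + b * \<phi>Y x y + a * \<phi>X x y = u x y"
  shows "\<phi> X Y - \<phi> p Y - \<phi> X q + \<phi> p q + b * (LBINT x:{p..X}. \<phi> x Y - \<phi> x q)
    + a * (LBINT y:{q..Y}. \<phi> X y - \<phi> p y) = (LBINT x:{p..X}. LBINT y:{q..Y}. u x y)"
proof -
  define K where "K x y = (LBINT r:{q..y}. k x r)" for x y
  define A where "A x = (LBINT y:{q..Y}. K x y)" for x
  define U where "U x = (LBINT y:{q..Y}. u x y)" for x
  obtain Ck where Ck: "\<And>x y. p \<le> x \<Longrightarrow> x \<le> X \<Longrightarrow> q \<le> y \<Longrightarrow> y \<le> Y \<Longrightarrow> \<bar>k x y\<bar> \<le> Ck"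
    using continuous_imp_bounded_rectangle[OF k] by metis
  obtain Cu where Cu: "\<And>x y. p \<le> x \<Longrightarrow> x \<le> X \<Longrightarrow> q \<le> y \<Longrightarrow> y \<le> Y \<Longrightarrow> \<bar>u x y\<bar> \<le> Cu"
    using continuous_imp_bounded_rectangle[OF u] by metis
  have Ck0: "0 \<le> Ck" using Ck[of p q] pq by auto
  note km = measurable_curried[OF continuous_imp_measurable_pair[OF k]]
  have Km: "(\<lambda>(x, y). K x y) \<in> borel_measurable (borel \<Otimes>\<^sub>M borel)"
    unfolding K_def split_beta'
  proof (rule borel_measurable_set_integral)
    show "(\<lambda>(z, r). k (fst z) r) \<in> borel_measurable ((borel \<Otimes>\<^sub>M borel) \<Otimes>\<^sub>M borel)"
      unfolding split_beta' by (intro km) measurable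
  qed measurable
  have Kb: "\<bar>K x y\<bar> \<le> Ck * (Y - q)" if "p \<le> x" "x \<le> X" "q \<le> y" "y \<le> Y" for x y
  proof -
    have "\<bar>K x y\<bar> \<le> Ck * (y - q)"
      unfolding K_def using that Ck by (intro abs_set_integral_le) auto
    also have "\<dots> \<le> Ck * (Y - q)" using that Ck0 by (intro mult_left_mono) auto
    finally show ?thesis .
  qed
  have Kslice: "K x \<in> borel_measurable borel" "(\<lambda>x. K x y) \<in> borel_measurable borel" for x y
    using measurable_compose[OF measurable_Pair1' Km, of x] measurable_compose[OF measurable_Pair2' Km, of y] by auto
  have Kint: "set_integrable lborel {q..Y} (K x)" if "p \<le> x" "x \<le> X" for x
    using that Kb by (intro set_integrable_bounded[OF Kslice(1)]) auto
  have Kint': "set_integrable lborel {p..X} (\<lambda>x. K x y)" if "q \<le> y" "y \<le> Y" for y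
    using that Kb by (intro set_integrable_bounded[OF Kslice(2)]) auto
  have Aint: "set_integrable lborel {p..X} A"
  proof (rule set_integrable_bounded)
    show "A \<in> borel_measurable borel"
      unfolding A_def by (rule borel_measurable_set_integral[OF Km]) measurable
    show "\<bar>A x\<bar> \<le> Ck * (Y - q) * (Y - q)" if "p \<le> x" "x \<le> X" for x
      unfolding A_def using that Kb pq by (intro abs_set_integral_le) auto
  qed
  have Uint: "set_integrable lborel {p..X} U"
  proof (rule set_integrable_bounded)
    show "U \<in> borel_measurable borel"
      unfolding U_def by (rule borel_measurable_set_integral[OF continuous_imp_measurable_pair[OF u]]) measurable
    show "\<bar>U x\<bar> \<le> Cu * (Y - q)" if "p \<le> x" "x \<le> X" for x
      unfolding U_def using that Cu pq by (intro abs_set_integral_le) auto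
  qed
  have phiX: "\<phi>X x y = \<phi>X x q + K x y" if "p \<le> x" "q \<le> y" for x y
  proof -
    have "K x y = \<phi>X x y - \<phi>X x q"
      unfolding K_def using that dXY by (intro set_integral_FTC_integrable[where f="k x"] set_integrable_section[OF k]) auto
    then show ?thesis by simp
  qed
  have mixed: "(LBINT x:{p..X}. K x y) = \<phi> X y - \<phi> X q - (\<phi> p y - \<phi> p q)" if "q \<le> y" "y \<le> Y" for y
  proof (rule set_integral_FTC_integrable[where f="\<lambda>x. \<phi>X x y - \<phi>X x q"])
    show "((\<lambda>x. \<phi> x y - \<phi> x q) has_real_derivative \<phi>X x y - \<phi>X x q) (at x)" if "p \<le> x" for x
      using that \<open>q \<le> y\<close> by (intro derivative_intros dX) auto
    show "\<phi>X x y - \<phi>X x q = K x y" if "p \<le> x" for x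
      using phiX[OF that \<open>q \<le> y\<close>] by simp
  qed (use pq that Kint' in auto)
  have vertical: "a * (Y - q) * \<phi>X x q = U x - K x Y - b * (\<phi> x Y - \<phi> x q) - a * A x" if x: "p \<le> x" "x \<le> X" for x
  proof -
    let ?g = "\<lambda>y. (u x y - k x y - a * (\<phi>X x q + K x y)) / b"
    have i1: "set_integrable lborel {q..Y} (\<lambda>y. u x y - k x y)"
      by (intro set_integral_diff set_integrable_section u k)
    have i2: "set_integrable lborel {q..Y} (\<lambda>y. \<phi>X x q)"
      by (rule borel_integrable_atLeastAtMost') (intro continuous_intros)
    have i3: "set_integrable lborel {q..Y} (\<lambda>y. \<phi>X x q + K x y)"
      by (intro set_integral_add i2 Kint x)
    have "(LBINT y:{q..Y}. ?g y) = \<phi> x Y - \<phi> x q"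
    proof (rule set_integral_FTC_integrable[where f="\<phi>Y x"])
      show "\<phi>Y x y = ?g y" if "q \<le> y" for y
        using eq[OF x(1) that] phiX[OF x(1) that] b by (simp add: field_simps)
      show "set_integrable lborel {q..Y} ?g"
        by (intro set_integrable_divide set_integral_diff(1)[OF i1] set_integrable_mult_right i3)
    qed (use pq x dY in auto)
    moreover have "(LBINT y:{q..Y}. ?g y) = ((U x - K x Y) - a * ((Y - q) * \<phi>X x q + A x)) / b"
    proof -
      have "(LBINT y:{q..Y}. ?g y) = (LBINT y:{q..Y}. u x y - k x y - a * (\<phi>X x q + K x y)) / b"
        by (rule set_integral_divide_zero)
      also have "(LBINT y:{q..Y}. u x y - k x y - a * (\<phi>X x q + K x y)) =
          (LBINT y:{q..Y}. u x y - k x y) - a * (LBINT y:{q..Y}. \<phi>X x q + K x y)"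
        using set_integral_diff(2)[OF i1 set_integrable_mult_right[OF i3, of a]] by simp
      also have "(LBINT y:{q..Y}. u x y - k x y) = U x - K x Y"
        unfolding U_def K_def by (intro set_integral_diff set_integrable_section u k)
      also have "(LBINT y:{q..Y}. \<phi>X x q + K x y) = (LBINT y:{q..Y}. \<phi>X x q) + A x"
        unfolding A_def by (intro set_integral_add i2 Kint x)
      also have "(LBINT y:{q..Y}. \<phi>X x q) = (Y - q) * \<phi>X x q"
        using pq by (simp add: set_lebesgue_integral_def)
      finally show ?thesis .
    qed
    ultimately show ?thesis using b by (simp add: field_simps)
  qed
  have phi_int: "set_integrable lborel {p..X} (\<lambda>x. \<phi> x Y - \<phi> x q)"
    by (intro set_integral_diff set_integrable_section f)
  have j1: "set_integrable lborel {p..X} (\<lambda>x. U x - K x Y)"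
    using pq by (intro set_integral_diff Uint Kint') auto
  have j2: "set_integrable lborel {p..X} (\<lambda>x. U x - K x Y - b * (\<phi> x Y - \<phi> x q))"
    by (intro set_integral_diff(1)[OF j1] set_integrable_mult_right phi_int)
  have "(LBINT x:{p..X}. U x - K x Y - b * (\<phi> x Y - \<phi> x q) - a * A x) =
      a * (Y - q) * \<phi> X q - a * (Y - q) * \<phi> p q"
  proof (rule set_integral_FTC_integrable[where f="\<lambda>x. a * (Y - q) * \<phi>X x q"])
    show "((\<lambda>x. a * (Y - q) * \<phi> x q) has_real_derivative a * (Y - q) * \<phi>X x q) (at x)" if "p \<le> x" for x
      using that by (intro DERIV_cmult dX) auto
    show "set_integrable lborel {p..X} (\<lambda>x. U x - K x Y - b * (\<phi> x Y - \<phi> x q) - a * A x)"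
      by (intro set_integral_diff(1)[OF j2] set_integrable_mult_right Aint)
  qed (use pq vertical in auto)
  moreover have "(LBINT x:{p..X}. U x - K x Y - b * (\<phi> x Y - \<phi> x q) - a * A x) =
      (LBINT x:{p..X}. U x) - (LBINT x:{p..X}. K x Y) - b * (LBINT x:{p..X}. \<phi> x Y - \<phi> x q) - a * (LBINT x:{p..X}. A x)"
    using set_integral_diff(2)[OF j2 set_integrable_mult_right[OF Aint, of a]]
      set_integral_diff(2)[OF j1 set_integrable_mult_right[OF phi_int, of b]]
      set_integral_diff(2)[OF Uint Kint'[of Y]] pq by simp
  moreover have "(LBINT x:{p..X}. A x) = (LBINT y:{q..Y}. \<phi> X y - \<phi> p y) - (Y - q) * (\<phi> X q - \<phi> p q)"
  proof -
    have "(LBINT x:{p..X}. A x) = (LBINT y:{q..Y}. LBINT x:{p..X}. K x y)"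
      unfolding A_def by (rule Fubini_bounded[OF Km Kb])
    also have "\<dots> = (LBINT y:{q..Y}. (\<phi> X y - \<phi> p y) - (\<phi> X q - \<phi> p q))"
      by (rule set_lebesgue_integral_cong) (auto simp: mixed)
    also have "\<dots> = (LBINT y:{q..Y}. \<phi> X y - \<phi> p y) - (LBINT y:{q..Y}. \<phi> X q - \<phi> p q)"
      by (intro set_integral_diff set_integrable_section f borel_integrable_atLeastAtMost' continuous_intros)
    also have "(LBINT y:{q..Y}. \<phi> X q - \<phi> p q) = (Y - q) * (\<phi> X q - \<phi> p q)"
      using pq by (simp add: set_lebesgue_integral_def)
    finally show ?thesis .
  qed
  ultimately show ?thesis
    using mixed[of Y] pq unfolding U_def by (simp add: algebra_simps)
qed

lemma tendsto_set_integral_lower_limit: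
  fixes f :: "nat \<Rightarrow> real \<Rightarrow> real"
  assumes e: "\<And>n. 0 < e n" "e \<longlonglongrightarrow> 0" and f: "\<And>n. f n \<in> borel_measurable borel"
    and g: "g \<in> borel_measurable borel"
    and C: "\<And>n x. 0 \<le> x \<Longrightarrow> x \<le> X \<Longrightarrow> \<bar>f n x\<bar> \<le> C"
    and lim: "\<And>x. 0 < x \<Longrightarrow> x \<le> X \<Longrightarrow> (\<lambda>n. f n x) \<longlonglongrightarrow> g x"
  shows "(\<lambda>n. LBINT x:{e n..X}. f n x) \<longlonglongrightarrow> (LBINT x:{0..X}. g x)"
  unfolding set_lebesgue_integral_def
proof (rule integral_dominated_convergence[where w="\<lambda>x. indicator {0..X} x *\<^sub>R \<bar>C\<bar>"])
  show "integrable lborel (\<lambda>x. indicator {0..X} x *\<^sub>R \<bar>C\<bar>)"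
    using borel_integrable_atLeastAtMost'[of 0 X "\<lambda>_. \<bar>C\<bar>"] by (simp add: set_integrable_def)
  show "AE x in lborel. norm (indicator {e n..X} x *\<^sub>R f n x) \<le> indicator {0..X} x *\<^sub>R \<bar>C\<bar>" for n
  proof (intro AE_I2)
    fix x
    show "norm (indicator {e n..X} x *\<^sub>R f n x) \<le> indicator {0..X} x *\<^sub>R \<bar>C\<bar>"
      using C[of x n] e(1)[of n] by (cases "e n \<le> x \<and> x \<le> X") (auto simp: indicator_def)
  qed
  have "AE x in lborel. x \<noteq> (0::real)" by (rule AE_lborel_singleton)
  then show "AE x in lborel. (\<lambda>n. indicator {e n..X} x *\<^sub>R f n x) \<longlonglongrightarrow> indicator {0..X} x *\<^sub>R g x"
  proof eventually_elim
    case (elim x)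
    show ?case
    proof (cases "0 < x \<and> x \<le> X")
      case True
      then have "eventually (\<lambda>n. e n < x) sequentially"
        using e(2) by (intro order_tendstoD) auto
      then have ev: "eventually (\<lambda>n. indicator {e n..X} x *\<^sub>R f n x = f n x) sequentially"
        by eventually_elim (use True in \<open>auto simp: indicator_def\<close>)
      have "(\<lambda>n. f n x) \<longlonglongrightarrow> indicator {0..X} x *\<^sub>R g x"
        using True lim[of x] by (simp add: indicator_def)
      with tendsto_cong[OF ev] show ?thesis by blast
    next
      case False
      have "indicator {e n..X} x *\<^sub>R f n x = 0" for n
        using False e(1)[of n] by (auto simp: indicator_def)
      moreover have "indicator {0..X} x *\<^sub>R g x = 0" using False elim by (auto simp: indicator_def)
      ultimately show ?thesis by (simp only: tendsto_const)
    qed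
  qed
qed (use f g in measurable)

text \<open>The equation is posed on the open quadrant and the solution is merely continuous up to the axes, so
  the identity on \<open>{e..X} \<times> {e..Y}\<close> is passed to the limit.\<close>

lemma telegraph_integral_equation:
  assumes a: "0 < a" and b: "0 < b"
    and u: "continuous_on ({0..} \<times> {0..}) (\<lambda>(x, y). u x y)"
    and sol: "telegraph_solution b a u chi psi \<phi>"
    and XY: "0 < X" "0 < Y"
  shows "\<phi> X Y + b * (LBINT x:{0..X}. \<phi> x Y) + a * (LBINT y:{0..Y}. \<phi> X y) =
    chi X + psi Y - chi 0 + b * (LBINT x:{0..X}. chi x) + a * (LBINT y:{0..Y}. psi y)
    + (LBINT x:{0..X}. LBINT y:{0..Y}. u x y)"
proof -
  obtain \<phi>X \<phi>Y \<phi>XY where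
    d: "\<And>x y. 0 < x \<Longrightarrow> 0 < y \<Longrightarrow> ((\<lambda>x. \<phi> x y) has_real_derivative \<phi>X x y) (at x)"
       "\<And>x y. 0 < x \<Longrightarrow> 0 < y \<Longrightarrow> ((\<lambda>y. \<phi> x y) has_real_derivative \<phi>Y x y) (at y)"
       "\<And>x y. 0 < x \<Longrightarrow> 0 < y \<Longrightarrow> ((\<lambda>y. \<phi>X x y) has_real_derivative \<phi>XY x y) (at y)"
       "\<And>x y. 0 < x \<Longrightarrow> 0 < y \<Longrightarrow> \<phi>XY x y + b * \<phi>Y x y + a * \<phi>X x y = u x y"
    and k: "continuous_on ({0<..} \<times> {0<..}) (\<lambda>(x, y). \<phi>XY x y)"
    using sol unfolding telegraph_solution_def by blast
  have \<phi>: "continuous_on ({0..} \<times> {0..}) (\<lambda>(x, y). \<phi> x y)"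
    and chi: "\<And>x. 0 \<le> x \<Longrightarrow> \<phi> x 0 = chi x" and psi: "\<And>y. 0 \<le> y \<Longrightarrow> \<phi> 0 y = psi y"
    using sol unfolding telegraph_solution_def by auto
  define f where "f x y = \<phi> (max 0 x) (max 0 y)" for x y
  define v where "v x y = u (max 0 x) (max 0 y)" for x y
  have f: "continuous_on UNIV (\<lambda>(x, y). f x y)"
    unfolding f_def by (rule continuous_clamp[OF \<phi>]) auto
  have v: "continuous_on UNIV (\<lambda>(x, y). v x y)"
    unfolding v_def by (rule continuous_clamp[OF u]) auto
  have f_eq: "f x y = \<phi> x y" if "0 \<le> x" "0 \<le> y" for x y using that by (simp add: f_def)
  have rectangle: "f X Y - f e Y - f X e + f e e + b * (LBINT x:{e..X}. f x Y - f x e)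
    + a * (LBINT y:{e..Y}. f X y - f e y) = (LBINT x:{e..X}. LBINT y:{e..Y}. v x y)"
    if e: "0 < e" "e < X" "e < Y" for e
  proof (rule telegraph_rectangle[where k="\<lambda>x y. \<phi>XY (max e x) (max e y)" and \<phi>X=\<phi>X and \<phi>Y=\<phi>Y])
    show "continuous_on UNIV (\<lambda>(x, y). \<phi>XY (max e x) (max e y))"
      by (rule continuous_clamp[OF k]) (use e in auto)
    fix x y assume xy: "e \<le> x" "e \<le> y"
    then have pos: "0 < x" "0 < y" using e by auto
    have nx: "eventually (\<lambda>z. f z y = \<phi> z y) (nhds x)"
      using eventually_nhds_in_open[of "{0<..}" x] pos by (auto elim!: eventually_mono simp: f_eq)
    show "((\<lambda>x. f x y) has_real_derivative \<phi>X x y) (at x)"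
      using d(1)[OF pos] nx by (subst DERIV_cong_ev[OF refl nx refl])
    have ny: "eventually (\<lambda>z. f x z = \<phi> x z) (nhds y)"
      using eventually_nhds_in_open[of "{0<..}" y] pos by (auto elim!: eventually_mono simp: f_eq)
    show "((\<lambda>y. f x y) has_real_derivative \<phi>Y x y) (at y)"
      using d(2)[OF pos] by (subst DERIV_cong_ev[OF refl ny refl])
    show "(\<phi>X x has_real_derivative \<phi>XY (max e x) (max e y)) (at y)"
      using d(3)[OF pos] xy by (simp add: max_absorb2)
    show "\<phi>XY (max e x) (max e y) + b * \<phi>Y x y + a * \<phi>X x y = v x y"
      using d(4)[OF pos] xy pos by (simp add: max_absorb2 v_def)
  qed (use a b e f v in auto)
  obtain Cf where Cf: "\<And>x y. 0 \<le> x \<Longrightarrow> x \<le> X \<Longrightarrow> 0 \<le> y \<Longrightarrow> y \<le> Y \<Longrightarrow> \<bar>f x y\<bar> \<le> Cf"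
    using continuous_imp_bounded_rectangle[OF f] by metis
  obtain Cv where Cv: "\<And>x y. 0 \<le> x \<Longrightarrow> x \<le> X \<Longrightarrow> 0 \<le> y \<Longrightarrow> y \<le> Y \<Longrightarrow> \<bar>v x y\<bar> \<le> Cv"
    using continuous_imp_bounded_rectangle[OF v] by metis
  define e where "e n = min X Y * inverse (real (Suc (Suc n)))" for n
  have e_pos: "0 < e n" for n using XY by (simp add: e_def)
  have e_lt: "e n < X" "e n < Y" for n
  proof -
    have "inverse (real (Suc (Suc n))) < 1" by (simp add: field_simps)
    then have "e n < min X Y * 1" unfolding e_def using XY by (intro mult_strict_left_mono) auto
    then show "e n < X" "e n < Y" by auto
  qed
  have e_lim: "e \<longlonglongrightarrow> 0"
  proof -
    have "(\<lambda>n. min X Y * inverse (real (Suc (Suc n)))) \<longlonglongrightarrow> min X Y * 0"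
      by (intro tendsto_mult_left LIMSEQ_Suc[OF LIMSEQ_inverse_real_of_nat])
    then show ?thesis by (simp add: e_def[abs_def])
  qed
  have f_lim: "(\<lambda>n. f (p n) (q n)) \<longlonglongrightarrow> f x y" if "p \<longlonglongrightarrow> x" "q \<longlonglongrightarrow> y" for p q x y
    using continuous_on_tendsto_compose[OF f tendsto_Pair[OF that]] by simp
  have m: "(\<lambda>x. f x y) \<in> borel_measurable borel" "f x \<in> borel_measurable borel" for x y
    by (intro borel_measurable_continuous_onI continuous_pair_sections[OF f])+
  have L1: "(\<lambda>n. LBINT x:{e n..X}. f x Y - f x (e n)) \<longlonglongrightarrow> (LBINT x:{0..X}. f x Y - f x 0)"
  proof (rule tendsto_set_integral_lower_limit[OF e_pos e_lim])
    show "\<bar>f x Y - f x (e n)\<bar> \<le> 2 * Cf" if "0 \<le> x" "x \<le> X" for x n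
      using Cf[of x Y] Cf[of x "e n"] that e_pos[of n] e_lt[of n] XY by auto
    show "(\<lambda>n. f x Y - f x (e n)) \<longlonglongrightarrow> f x Y - f x 0" for x
      by (intro tendsto_intros f_lim e_lim)
  qed (use m in measurable)
  have L2: "(\<lambda>n. LBINT y:{e n..Y}. f X y - f (e n) y) \<longlonglongrightarrow> (LBINT y:{0..Y}. f X y - f 0 y)"
  proof (rule tendsto_set_integral_lower_limit[OF e_pos e_lim])
    show "\<bar>f X y - f (e n) y\<bar> \<le> 2 * Cf" if "0 \<le> y" "y \<le> Y" for y n
      using Cf[of X y] Cf[of "e n" y] that e_pos[of n] e_lt[of n] XY by auto
    show "(\<lambda>n. f X y - f (e n) y) \<longlonglongrightarrow> f X y - f 0 y" for y
      by (intro tendsto_intros f_lim e_lim)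
  qed (use m in measurable)
  have vm: "v x \<in> borel_measurable borel" for x
    by (intro borel_measurable_continuous_onI continuous_pair_sections[OF v])
  have L3: "(\<lambda>n. LBINT x:{e n..X}. LBINT y:{e n..Y}. v x y) \<longlonglongrightarrow> (LBINT x:{0..X}. LBINT y:{0..Y}. v x y)"
  proof (rule tendsto_set_integral_lower_limit[OF e_pos e_lim])
    show "(\<lambda>x. LBINT y:{c..Y}. v x y) \<in> borel_measurable borel" for c
      by (rule borel_measurable_set_integral[OF continuous_imp_measurable_pair[OF v]]) measurable
    then show "(\<lambda>x. LBINT y:{0..Y}. v x y) \<in> borel_measurable borel" .
    show "\<bar>LBINT y:{e n..Y}. v x y\<bar> \<le> Cv * Y" if x: "0 \<le> x" "x \<le> X" for x n
    proof -
      have "\<bar>LBINT y:{e n..Y}. v x y\<bar> \<le> Cv * (Y - e n)"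
        using Cv[OF x] e_pos[of n] e_lt[of n] by (intro abs_set_integral_le) auto
      also have "\<dots> \<le> Cv * Y"
        using Cv[OF x, of Y] XY e_pos[of n] by (intro mult_left_mono) auto
      finally show ?thesis .
    qed
    show "(\<lambda>n. LBINT y:{e n..Y}. v x y) \<longlonglongrightarrow> (LBINT y:{0..Y}. v x y)" if "0 < x" "x \<le> X" for x
      using that Cv by (intro tendsto_set_integral_lower_limit[OF e_pos e_lim vm vm, where C=Cv]) auto
  qed
  have "(\<lambda>n. f X Y - f (e n) Y - f X (e n) + f (e n) (e n) + b * (LBINT x:{e n..X}. f x Y - f x (e n))
      + a * (LBINT y:{e n..Y}. f X y - f (e n) y)) \<longlonglongrightarrow>
      f X Y - f 0 Y - f X 0 + f 0 0 + b * (LBINT x:{0..X}. f x Y - f x 0) + a * (LBINT y:{0..Y}. f X y - f 0 y)"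
    by (intro tendsto_intros L1 L2 f_lim e_lim)
  moreover have "(\<lambda>n. f X Y - f (e n) Y - f X (e n) + f (e n) (e n) + b * (LBINT x:{e n..X}. f x Y - f x (e n))
      + a * (LBINT y:{e n..Y}. f X y - f (e n) y)) = (\<lambda>n. LBINT x:{e n..X}. LBINT y:{e n..Y}. v x y)"
    using rectangle[OF e_pos e_lt] by auto
  ultimately have "f X Y - f 0 Y - f X 0 + f 0 0 + b * (LBINT x:{0..X}. f x Y - f x 0)
      + a * (LBINT y:{0..Y}. f X y - f 0 y) = (LBINT x:{0..X}. LBINT y:{0..Y}. v x y)"
    using L3 LIMSEQ_unique by fastforce
  moreover have "(LBINT x:{0..X}. f x Y - f x 0) = (LBINT x:{0..X}. f x Y) - (LBINT x:{0..X}. f x 0)"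
    "(LBINT y:{0..Y}. f X y - f 0 y) = (LBINT y:{0..Y}. f X y) - (LBINT y:{0..Y}. f 0 y)"
    by (intro set_integral_diff set_integrable_section f)+
  moreover have "(LBINT x:{0..X}. f x Y) = (LBINT x:{0..X}. \<phi> x Y)" "(LBINT x:{0..X}. f x 0) = (LBINT x:{0..X}. chi x)"
    "(LBINT y:{0..Y}. f X y) = (LBINT y:{0..Y}. \<phi> X y)" "(LBINT y:{0..Y}. f 0 y) = (LBINT y:{0..Y}. psi y)"
    using XY by (auto intro!: set_lebesgue_integral_cong simp: f_eq chi psi)
  moreover have "(LBINT x:{0..X}. LBINT y:{0..Y}. v x y) = (LBINT x:{0..X}. LBINT y:{0..Y}. u x y)"
    by (intro set_lebesgue_integral_cong allI impI) (auto simp: v_def)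
  moreover have "f X Y = \<phi> X Y" "f 0 Y = psi Y" "f X 0 = chi X" "f 0 0 = chi 0"
    using XY by (auto simp: f_eq chi psi)
  ultimately show ?thesis by (simp add: algebra_simps)
qed

section \<open>Crossing points and sides as path functionals\<close>

text \<open>A horizontal first segment that crosses the y-axis leads to a negative abscissa, where \<open>h\<close> vanishes.\<close>

lemma renewal_pair_abscissa:
  assumes a: "0 < a" "0 < b" and h: "h \<in> borel_measurable borel" "\<And>x. \<bar>h x\<bar> \<le> C" "\<And>x. x < 0 \<Longrightarrow> h x = 0"
  shows "renewal_pair a b C (\<lambda>x y L. h (abscissa Vertical x y L)) (\<lambda>x y L. h (abscissa Horizontal x y L)) h"
proof
  have "(\<lambda>p. h (abscissa d (fst (fst p)) (snd (fst p)) (snd p)))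
      \<in> borel_measurable ((borel \<Otimes>\<^sub>M borel) \<Otimes>\<^sub>M seq_space)" for d
    by (rule measurable_compose[OF measurable_abscissa h(1)]) measurable
  then show "(\<lambda>((x, y), L). h (abscissa Vertical x y L)) \<in> borel_measurable ((borel \<Otimes>\<^sub>M borel) \<Otimes>\<^sub>M seq_space)"
    "(\<lambda>((x, y), L). h (abscissa Horizontal x y L)) \<in> borel_measurable ((borel \<Otimes>\<^sub>M borel) \<Otimes>\<^sub>M seq_space)"
    by (simp_all only: split_beta')
  fix x y s :: real and L :: "nat \<Rightarrow> real"
  assume L: "regular L"
  show "h (abscissa Vertical x y (case_nat s L)) = h x" if "0 < y" "y < s"
    using that L by (simp add: abscissa_Vertical_crossing)
  show "h (abscissa Vertical x y (case_nat s L)) = h (abscissa Horizontal x (y - s) L)" if "0 < s" "s < y"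
    using that abscissa_first_step[OF L, of s y Vertical x] by (simp add: step_def)
  have H: "abscissa Horizontal x y (case_nat s L) = abscissa Vertical (x - s) y L" if "0 < y" "0 < s"
    using that abscissa_first_step[OF L, of s y Horizontal x] by (simp add: step_def)
  show "h (abscissa Horizontal x y (case_nat s L)) = h (abscissa Vertical (x - s) y L)" if "0 < y" "0 < s"
    using H[OF that] by simp
  show "h (abscissa Horizontal x y (case_nat s L)) = 0" if "0 < x" "0 < y" "x < s"
  proof -
    have "abscissa Vertical (x - s) y L \<le> x - s" using L that by (intro abscissa_le) auto
    with that H show ?thesis by (simp add: h(3))
  qed
qed (use a h in auto)

lemma renewal_pair_passes_below:
  assumes a: "0 < a" "0 < b"
  shows "renewal_pair a b 1 (\<lambda>x y L. of_bool (passes_below Vertical x y L))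
    (\<lambda>x y L. of_bool (passes_below Horizontal x y L)) (\<lambda>_. 1)"
proof
  have "(\<lambda>p. of_bool (passes_below d (fst (fst p)) (snd (fst p)) (snd p)) :: real)
      \<in> borel_measurable ((borel \<Otimes>\<^sub>M borel) \<Otimes>\<^sub>M seq_space)" for d
    by (rule measurable_compose[OF pred_passes_below, where L=borel]) measurable
  then show "(\<lambda>((x, y), L). of_bool (passes_below Vertical x y L) :: real) \<in> borel_measurable ((borel \<Otimes>\<^sub>M borel) \<Otimes>\<^sub>M seq_space)"
    "(\<lambda>((x, y), L). of_bool (passes_below Horizontal x y L) :: real) \<in> borel_measurable ((borel \<Otimes>\<^sub>M borel) \<Otimes>\<^sub>M seq_space)"
    by (simp_all only: split_beta')
qed (use a in \<open>auto simp: passes_below_Vertical_crossing passes_below_Vertical_turn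
      passes_below_Horizontal_crossing passes_below_Horizontal_turn\<close>)

text \<open>\<open>D\<close> is the kernel with which \<open>u\<close> enters the formula; its equation is the difference of the two renewal
  equations with \<open>h = 1\<close>.\<close>

lemma passes_below_difference_equation:
  assumes a: "0 < a" "0 < b"
  defines "D \<equiv> (\<lambda>x y. (\<integral>L. of_bool (passes_below Vertical x y L) \<partial>length_law a b)
      - (\<integral>L. of_bool (passes_below Horizontal x y L) \<partial>length_law b a) :: real)"
  shows "0 < x \<Longrightarrow> 0 < y \<Longrightarrow> D x y + b * (LBINT r:{0..x}. D r y) + a * (LBINT r:{0..y}. D x r) = 1"
    and "(\<lambda>(x, y). D x y) \<in> borel_measurable (borel \<Otimes>\<^sub>M borel)"
    and "\<bar>D x y\<bar> \<le> 2"
proof -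
  interpret renewal_pair a b 1 "\<lambda>x y L. of_bool (passes_below Vertical x y L)"
    "\<lambda>x y L. of_bool (passes_below Horizontal x y L)" "\<lambda>_. 1"
    by (rule renewal_pair_passes_below[OF a])
  have D: "D = (\<lambda>x y. EV x y - EH x y)"
    by (simp add: D_def EV_def EH_def)
  have "(LBINT r:{0..y}. EH x r - EV x r) = - (LBINT r:{0..y}. EV x r - EH x r)"
    unfolding set_lebesgue_integral_def integral_minus[symmetric] by (simp add: algebra_simps)
  then show "D x y + b * (LBINT r:{0..x}. D r y) + a * (LBINT r:{0..y}. D x r) = 1" if "0 < x" "0 < y"
    unfolding D using EV_eq[OF that] EH_eq[OF that] by simp
  show "(\<lambda>(x, y). D x y) \<in> borel_measurable (borel \<Otimes>\<^sub>M borel)"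
    unfolding D using EV_measurable EH_measurable by (simp add: split_beta')
  show "\<bar>D x y\<bar> \<le> 2"
    unfolding D using EV_bounded[of x y] EH_bounded[of x y] by linarith
qed

lemma superposition_section_integrable:
  fixes D u :: "real \<Rightarrow> real \<Rightarrow> real"
  assumes D: "(\<lambda>(x, y). D x y) \<in> borel_measurable (borel \<Otimes>\<^sub>M borel)" and CD: "\<And>x y. \<bar>D x y\<bar> \<le> CD"
    and u: "(\<lambda>(x, y). u x y) \<in> borel_measurable (borel \<Otimes>\<^sub>M borel)" and Cu: "\<And>x y. \<bar>u x y\<bar> \<le> Cu"
  defines "U \<equiv> (\<lambda>x y. LBINT s:{0..x}. LBINT t:{0..y}. D (x - s) (y - t) * u s t)"
  shows "0 \<le> x \<Longrightarrow> x \<le> X \<Longrightarrow> 0 \<le> y \<Longrightarrow> y \<le> Y \<Longrightarrow> \<bar>U x y\<bar> \<le> CD * Cu * Y * X"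
    and "0 \<le> y \<Longrightarrow> set_integrable lborel {0..x} (\<lambda>x. U x y)"
    and "0 \<le> x \<Longrightarrow> set_integrable lborel {0..y} (U x)"
proof -
  have CD0: "0 \<le> CD" "0 \<le> Cu" using CD[of 0 0] Cu[of 0 0] by linarith+
  note D' = measurable_curried[OF D]
  note u' = measurable_curried[OF u]
  have Du_bd: "\<bar>D p q * u s t\<bar> \<le> CD * Cu" for p q s t
    unfolding abs_mult using CD Cu CD0 by (intro mult_mono) auto
  show bd: "\<bar>U x y\<bar> \<le> CD * Cu * Y * X" if "0 \<le> x" "x \<le> X" "0 \<le> y" "y \<le> Y" for x y X Y
  proof -
    have "\<bar>U x y\<bar> \<le> (CD * Cu * (y - 0)) * (x - 0)"
      unfolding U_def using that Du_bd by (intro abs_set_integral_le) auto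
    also have "\<dots> \<le> (CD * Cu * Y) * X"
      using that CD0 by (intro mult_mono mult_left_mono mult_nonneg_nonneg) auto
    finally show ?thesis .
  qed
  show "set_integrable lborel {0..x} (\<lambda>x. U x y)" if "0 \<le> y" for x y
  proof (rule set_integrable_bounded)
    show "(\<lambda>x. U x y) \<in> borel_measurable borel"
      unfolding U_def
    proof (rule borel_measurable_set_integral)
      show "(\<lambda>(x, s). LBINT t:{0..y}. D (x - s) (y - t) * u s t) \<in> borel_measurable (borel \<Otimes>\<^sub>M borel)"
        unfolding split_beta'
      proof (rule borel_measurable_set_integral)
        show "(\<lambda>(p, t). D (fst p - snd p) (y - t) * u (snd p) t) \<in> borel_measurable ((borel \<Otimes>\<^sub>M borel) \<Otimes>\<^sub>M borel)"
          unfolding split_beta' by (intro borel_measurable_times D' u') measurable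
      qed measurable
    qed measurable
    show "\<bar>U r y\<bar> \<le> CD * Cu * y * x" if "0 \<le> r" "r \<le> x" for r
      using that \<open>0 \<le> y\<close> by (intro bd) auto
  qed
  show "set_integrable lborel {0..y} (U x)" if "0 \<le> x" for x y
  proof (rule set_integrable_bounded)
    show "U x \<in> borel_measurable borel"
      unfolding U_def
    proof (rule borel_measurable_set_integral)
      show "(\<lambda>(y, s). LBINT t:{0..y}. D (x - s) (y - t) * u s t) \<in> borel_measurable (borel \<Otimes>\<^sub>M borel)"
        unfolding split_beta'
      proof (rule borel_measurable_set_integral)
        show "(\<lambda>(p, t). D (x - snd p) (fst p - t) * u (snd p) t) \<in> borel_measurable ((borel \<Otimes>\<^sub>M borel) \<Otimes>\<^sub>M borel)"
          unfolding split_beta' by (intro borel_measurable_times D' u') measurable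
      qed measurable
    qed measurable
    show "\<bar>U x r\<bar> \<le> CD * Cu * y * x" if "0 \<le> r" "r \<le> y" for r
      using that \<open>0 \<le> x\<close> by (intro bd) auto
  qed
qed

section \<open>Expectations of functionals of the two paths\<close>

lemma (in prob_space) expectation_set_integral:
  fixes F :: "'a \<Rightarrow> real \<Rightarrow> real"
  assumes F: "(\<lambda>(\<omega>, x). F \<omega> x) \<in> borel_measurable (M \<Otimes>\<^sub>M borel)"
    and C: "\<And>\<omega> x. a \<le> x \<Longrightarrow> x \<le> b \<Longrightarrow> \<bar>F \<omega> x\<bar> \<le> C"
  shows "(\<integral>\<omega>. (LBINT x:{a..b}. F \<omega> x) \<partial>M) = (LBINT x:{a..b}. (\<integral>\<omega>. F \<omega> x \<partial>M))"
proof -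
  interpret P: pair_sigma_finite M lborel ..
  let ?g = "\<lambda>(\<omega>, x). indicator {a..b} x * F \<omega> x"
  have meas: "?g \<in> borel_measurable (M \<Otimes>\<^sub>M lborel)"
    using F by (simp add: split_beta' cong: measurable_cong_sets)
  have "integrable (M \<Otimes>\<^sub>M lborel) ?g"
  proof (rule Bochner_Integration.integrable_bound[OF _ meas])
    show "integrable (M \<Otimes>\<^sub>M lborel) (\<lambda>p. indicator (space M \<times> {a..b}) p *\<^sub>R C :: real)"
      by (cases "a \<le> b")
        (auto intro!: integrable_scaleR_left integrable_real_indicator
          simp: lborel.emeasure_pair_measure_Times emeasure_space_1 not_le)
    show "AE p in M \<Otimes>\<^sub>M lborel. norm (?g p) \<le> norm (indicator (space M \<times> {a..b}) p *\<^sub>R C)"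
    proof (intro AE_I2)
      fix p :: "'a \<times> real" assume "p \<in> space (M \<Otimes>\<^sub>M lborel)"
      then show "norm (?g p) \<le> norm (indicator (space M \<times> {a..b}) p *\<^sub>R C)"
        using C[of "snd p" "fst p"] by (cases p) (auto simp: indicator_def space_pair_measure)
    qed
  qed
  from P.Fubini_integral[OF this]
  have "(\<integral>\<omega>. \<integral>x. indicator {a..b} x * F \<omega> x \<partial>lborel \<partial>M) = (\<integral>x. \<integral>\<omega>. indicator {a..b} x * F \<omega> x \<partial>M \<partial>lborel)"
    by simp
  then show ?thesis unfolding set_lebesgue_integral_def by simp
qed

lemma (in prob_space) expectation_iterated_integral:
  fixes F :: "'a \<Rightarrow> real \<Rightarrow> real \<Rightarrow> real"
  assumes F: "(\<lambda>((\<omega>, x), y). F \<omega> x y) \<in> borel_measurable ((M \<Otimes>\<^sub>M borel) \<Otimes>\<^sub>M borel)"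
    and C: "\<And>\<omega> x y. \<bar>F \<omega> x y\<bar> \<le> C" and cd: "c \<le> d"
  shows "(\<integral>\<omega>. (LBINT x:{a..b}. LBINT y:{c..d}. F \<omega> x y) \<partial>M) = (LBINT x:{a..b}. LBINT y:{c..d}. (\<integral>\<omega>. F \<omega> x y \<partial>M))"
    and "(\<lambda>\<omega>. LBINT x:{a..b}. LBINT y:{c..d}. F \<omega> x y) \<in> borel_measurable M"
proof -
  have inner: "(\<lambda>(\<omega>, x). LBINT y:{c..d}. F \<omega> x y) \<in> borel_measurable (M \<Otimes>\<^sub>M borel)"
    unfolding split_beta'
    by (rule borel_measurable_set_integral) (use F in \<open>simp_all only: split_beta' measurable_const space_borel UNIV_I\<close>)
  show "(\<lambda>\<omega>. LBINT x:{a..b}. LBINT y:{c..d}. F \<omega> x y) \<in> borel_measurable M"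
    by (rule borel_measurable_set_integral[OF inner]) auto
  have "(\<integral>\<omega>. (LBINT x:{a..b}. LBINT y:{c..d}. F \<omega> x y) \<partial>M) = (LBINT x:{a..b}. \<integral>\<omega>. (LBINT y:{c..d}. F \<omega> x y) \<partial>M)"
  proof (rule expectation_set_integral[OF inner])
    show "\<bar>LBINT y:{c..d}. F \<omega> x y\<bar> \<le> C * (d - c)" for \<omega> x
      using cd C by (intro abs_set_integral_le) auto
  qed
  also have "\<dots> = (LBINT x:{a..b}. LBINT y:{c..d}. (\<integral>\<omega>. F \<omega> x y \<partial>M))"
  proof (rule set_lebesgue_integral_cong, simp, intro allI impI)
    fix x :: real
    have "(\<lambda>p :: 'a \<times> real. ((fst p, x), snd p)) \<in> measurable (M \<Otimes>\<^sub>M borel) ((M \<Otimes>\<^sub>M borel) \<Otimes>\<^sub>M borel)"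
      by measurable
    from measurable_compose[OF this F]
    have "(\<lambda>(\<omega>, y). F \<omega> x y) \<in> borel_measurable (M \<Otimes>\<^sub>M borel)" by (simp add: split_beta')
    then show "(\<integral>\<omega>. (LBINT y:{c..d}. F \<omega> x y) \<partial>M) = (LBINT y:{c..d}. (\<integral>\<omega>. F \<omega> x y \<partial>M))"
      using C by (rule expectation_set_integral)
  qed
  finally show "(\<integral>\<omega>. (LBINT x:{a..b}. LBINT y:{c..d}. F \<omega> x y) \<partial>M) = (LBINT x:{a..b}. LBINT y:{c..d}. (\<integral>\<omega>. F \<omega> x y \<partial>M))" .
qed

text \<open>For \<open>x\<close> and \<open>y\<close> outside the countable sets of turning abscissae and ordinates, the point \<open>(x, y)\<close> is
  off both paths.\<close>

lemma integral_I_between: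
  fixes w :: "real \<Rightarrow> real \<Rightarrow> real"
  assumes Lh: "regular Lh" and Lv: "regular Lv" and Y: "0 \<le> Y"
    and w: "(\<lambda>(x, y). w x y) \<in> borel_measurable (borel \<Otimes>\<^sub>M borel)" and C: "\<And>x y. \<bar>w x y\<bar> \<le> C"
  shows "(LBINT x:{0..X}. LBINT y:{0..Y}.
      I_between (X, Y) (walk (X, Y) Horizontal Lh) (walk (X, Y) Vertical Lv) x y * w x y) =
    (LBINT x:{0..X}. LBINT y:{0..Y}. of_bool (passes_below Vertical (X - x) (Y - y) Lv) * w x y)
    - (LBINT x:{0..X}. LBINT y:{0..Y}. of_bool (passes_below Horizontal (X - x) (Y - y) Lh) * w x y)"
proof -
  let ?V = "\<lambda>x y. of_bool (passes_below Vertical (X - x) (Y - y) Lv) * w x y"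
  let ?H = "\<lambda>x y. of_bool (passes_below Horizontal (X - x) (Y - y) Lh) * w x y"
  let ?th = "turn_point (X, Y) Horizontal Lh" and ?tv = "turn_point (X, Y) Vertical Lv"
  have m: "(\<lambda>(x, y). of_bool (passes_below d (X - x) (Y - y) L) * w x y) \<in> borel_measurable (borel \<Otimes>\<^sub>M borel)" for d L
  proof -
    have "(\<lambda>p. of_bool (passes_below d (X - fst p) (Y - snd p) L) :: real) \<in> borel_measurable (borel \<Otimes>\<^sub>M borel)"
      by (rule measurable_compose[OF pred_passes_below, where L=borel]) (simp_all add: space_PiM)
    then show ?thesis using w by (simp add: split_beta')
  qed
  have bd: "\<bar>of_bool P * w x y\<bar> \<le> C" for P x y
    using C[of x y] abs_ge_zero[of "w x y"] by (cases P) auto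
  have "(LBINT x:{0..X}. LBINT y:{0..Y}.
      I_between (X, Y) (walk (X, Y) Horizontal Lh) (walk (X, Y) Vertical Lv) x y * w x y) =
    (LBINT x:{0..X}. LBINT y:{0..Y}. ?V x y + (- 1) * ?H x y)"
  proof (rule set_integral_eq_off_countable[where E="range (\<lambda>n. fst (?th n)) \<union> range (\<lambda>n. fst (?tv n)) \<union> {X}"])
    fix x assume x: "x \<in> {0..X}" "x \<notin> range (\<lambda>n. fst (?th n)) \<union> range (\<lambda>n. fst (?tv n)) \<union> {X}"
    show "(LBINT y:{0..Y}. I_between (X, Y) (walk (X, Y) Horizontal Lh) (walk (X, Y) Vertical Lv) x y * w x y) =
      (LBINT y:{0..Y}. ?V x y + (- 1) * ?H x y)"
    proof (rule set_integral_eq_off_countable[where E="range (\<lambda>n. snd (?th n)) \<union> range (\<lambda>n. snd (?tv n)) \<union> {Y}"])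
      fix y assume y: "y \<in> {0..Y}" "y \<notin> range (\<lambda>n. snd (?th n)) \<union> range (\<lambda>n. snd (?tv n)) \<union> {Y}"
      have "(x, y) \<notin> walk (X, Y) Horizontal Lh ` {0..}" "(x, y) \<notin> walk (X, Y) Vertical Lv ` {0..}"
        using walk_in_lines[of x y] x y by blast+
      then show "I_between (X, Y) (walk (X, Y) Horizontal Lh) (walk (X, Y) Vertical Lv) x y * w x y =
        ?V x y + (- 1) * ?H x y"
        using x y by (subst I_between_off_paths[OF Lh Lv]) (auto simp: algebra_simps)
    qed auto
  qed auto
  also have "\<dots> = (LBINT x:{0..X}. LBINT y:{0..Y}. ?V x y) + (- 1) * (LBINT x:{0..X}. LBINT y:{0..Y}. ?H x y)"
    by (rule iterated_integral_add_scaled[OF m m bd bd Y])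
  finally show ?thesis by simp
qed

lemma abs_I_between_le: "\<bar>I_between P Th Tv x y\<bar> \<le> 1"
  by (simp add: I_between_def)

lemma measurable_I_between:
  assumes Lh: "Lh \<in> measurable N seq_space" and Lv: "Lv \<in> measurable N seq_space"
    and xy: "x \<in> borel_measurable N" "y \<in> borel_measurable N"
  shows "(\<lambda>\<omega>. I_between (X, Y) (walk (X, Y) Horizontal (Lh \<omega>)) (walk (X, Y) Vertical (Lv \<omega>)) (x \<omega>) (y \<omega>)) \<in> borel_measurable N"
proof -
  have shift: "(\<lambda>\<omega>. X - x \<omega>) \<in> borel_measurable N" "(\<lambda>\<omega>. Y - y \<omega>) \<in> borel_measurable N"
    using xy by auto
  note [measurable] = pred_passes_below[OF shift Lh, of Horizontal] pred_passes_below[OF shift Lv, of Vertical]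
    pred_passes_above[OF shift Lh, of Horizontal] pred_passes_above[OF shift Lv, of Vertical]
  show ?thesis
    unfolding I_between_def Int_iff upper_left_translate lower_right_translate[of _ _ X Y] by measurable
qed

lemma (in prob_space) integral_via_law:
  fixes F :: "'b \<Rightarrow> real"
  assumes T: "T \<in> measurable M S" and law: "distr M S T = Q"
    and F: "F \<in> borel_measurable S" and bd: "AE L in Q. \<bar>F L\<bar> \<le> C"
  shows "integrable M (\<lambda>\<omega>. F (T \<omega>))" "(\<integral>\<omega>. F (T \<omega>) \<partial>M) = (\<integral>L. F L \<partial>Q)"
proof -
  have "AE \<omega> in M. \<bar>F (T \<omega>)\<bar> \<le> C"
    using bd T unfolding law[symmetric] by (rule AE_distrD[rotated])
  then show "integrable M (\<lambda>\<omega>. F (T \<omega>))"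
    using measurable_compose[OF T F] by (intro integrable_const_bound[where B=C]) auto
  show "(\<integral>\<omega>. F (T \<omega>) \<partial>M) = (\<integral>L. F L \<partial>Q)"
    unfolding law[symmetric] by (rule integral_distr[symmetric, OF T F])
qed

lemma C1_on_nonneg_continuous:
  assumes "C1_on_nonneg f"
  shows "continuous_on {0..} f"
  using assms unfolding C1_on_nonneg_def continuous_on_eq_continuous_within
  by (auto intro: has_field_derivative_imp_has_derivative DERIV_continuous)

text \<open>Paths from abscissae up to \<open>A\<close> only see boundary values up to \<open>A\<close>; cutting off there makes them bounded.\<close>

lemma boundary_cutoff:
  fixes f :: "real \<Rightarrow> real" and A :: real
  assumes f: "continuous_on {0..} f"
  defines "h \<equiv> (\<lambda>x. if 0 \<le> x \<and> x \<le> A then f x else 0)"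
  obtains C where "\<And>x. \<bar>h x\<bar> \<le> C" "h \<in> borel_measurable borel" "zero_ext f \<in> borel_measurable borel"
proof -
  have "bounded (f ` {0..A})"
    by (intro compact_imp_bounded compact_continuous_image continuous_on_subset[OF f]) auto
  then obtain C where "\<forall>y\<in>f ` {0..A}. norm y \<le> C"
    unfolding bounded_iff by blast
  then have C: "\<bar>f x\<bar> \<le> C" if "0 \<le> x" "x \<le> A" for x
    using that by auto
  have "continuous_on UNIV (\<lambda>x. f (max 0 x))"
    by (rule continuous_on_compose2[OF f]) (auto intro!: continuous_intros)
  then have [measurable]: "(\<lambda>x. f (max 0 x)) \<in> borel_measurable borel"
    by (rule borel_measurable_continuous_onI)
  show ?thesis
  proof (rule that[of "\<bar>C\<bar>"])
    show "\<bar>h x\<bar> \<le> \<bar>C\<bar>" for x using C[of x] by (auto simp: h_def)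
    have "h = (\<lambda>x. if 0 \<le> x \<and> x \<le> A then f (max 0 x) else 0)"
      by (auto simp: h_def fun_eq_iff max_def)
    then show "h \<in> borel_measurable borel" by simp
    have "zero_ext f = (\<lambda>x. if x < 0 then 0 else f (max 0 x))"
      by (auto simp: zero_ext_def fun_eq_iff max_def)
    then show "zero_ext f \<in> borel_measurable borel" by simp
  qed
qed

lemma (in prob_space) boundary_expectation:
  assumes ab: "0 < a" "0 < b" and f: "continuous_on {0..} f" and x: "x \<le> A" and y: "0 \<le> y"
    and T: "T \<in> measurable M seq_space" and law: "distr M seq_space T = length_law a b"
  defines "h \<equiv> (\<lambda>x. if 0 \<le> x \<and> x \<le> A then f x else 0)"
  shows "integrable M (\<lambda>\<omega>. zero_ext f (abscissa Vertical x y (T \<omega>)))"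
    and "(\<integral>\<omega>. zero_ext f (abscissa Vertical x y (T \<omega>)) \<partial>M) = (\<integral>L. h (abscissa Vertical x y L) \<partial>length_law a b)"
proof -
  obtain C where C: "\<And>x. \<bar>h x\<bar> \<le> C" and h: "h \<in> borel_measurable borel" and z: "zero_ext f \<in> borel_measurable borel"
    unfolding h_def using boundary_cutoff[OF f, of A] by metis
  have abs: "(\<lambda>L. abscissa Vertical x y L) \<in> borel_measurable seq_space"
    by (rule measurable_abscissa) auto
  have eq: "AE L in length_law a b. zero_ext f (abscissa Vertical x y L) = h (abscissa Vertical x y L)"
    using AE_regular[OF ab]
  proof eventually_elim
    case (elim L)
    have "abscissa Vertical x y L \<le> A" using abscissa_le[OF elim y, of Vertical x] x by linarith
    then show ?case by (simp add: zero_ext_def h_def)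
  qed
  have bd: "AE L in length_law a b. \<bar>zero_ext f (abscissa Vertical x y L)\<bar> \<le> C"
    using eq by eventually_elim (simp add: C)
  note via = integral_via_law[OF T law measurable_compose[OF abs z] bd]
  show "integrable M (\<lambda>\<omega>. zero_ext f (abscissa Vertical x y (T \<omega>)))" by (rule via)
  have "(\<integral>L. zero_ext f (abscissa Vertical x y L) \<partial>length_law a b) = (\<integral>L. h (abscissa Vertical x y L) \<partial>length_law a b)"
    using eq measurable_compose[OF abs z] measurable_compose[OF abs h]
    by (intro integral_cong_AE) (simp_all cong: measurable_cong_sets)
  with via(2) show "(\<integral>\<omega>. zero_ext f (abscissa Vertical x y (T \<omega>)) \<partial>M) = (\<integral>L. h (abscissa Vertical x y L) \<partial>length_law a b)"
    by simp
qed

text \<open>Almost surely the integral over the region between the paths is a difference of two integrals that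
  involve one path each, and Fubini moves the expectations inside.\<close>

lemma (in prob_space) between_expectation:
  fixes w :: "real \<Rightarrow> real \<Rightarrow> real" and a b X Y :: real
  assumes ab: "0 < a" "0 < b" and XY: "0 \<le> X" "0 \<le> Y"
    and Lv: "Lv \<in> measurable M seq_space" "distr M seq_space Lv = length_law a b"
    and Lh: "Lh \<in> measurable M seq_space" "distr M seq_space Lh = length_law b a"
    and w: "(\<lambda>(x, y). w x y) \<in> borel_measurable (borel \<Otimes>\<^sub>M borel)" and C: "\<And>x y. \<bar>w x y\<bar> \<le> C"
  defines "D \<equiv> (\<lambda>x y. (\<integral>L. of_bool (passes_below Vertical x y L) \<partial>length_law a b)
      - (\<integral>L. of_bool (passes_below Horizontal x y L) \<partial>length_law b a) :: real)"
    and "J \<equiv> (\<lambda>\<omega>. LBINT x:{0..X}. LBINT y:{0..Y}.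
      I_between (X, Y) (walk (X, Y) Horizontal (Lh \<omega>)) (walk (X, Y) Vertical (Lv \<omega>)) x y * w x y)"
  shows "integrable M J" "(\<integral>\<omega>. J \<omega> \<partial>M) = (LBINT x:{0..X}. LBINT y:{0..Y}. D (X - x) (Y - y) * w x y)"
proof -
  let ?P = "\<lambda>d L x y. of_bool (passes_below d (X - x) (Y - y) L) * w x y :: real"
  let ?J = "\<lambda>d L. LBINT x:{0..X}. LBINT y:{0..Y}. ?P d L x y"
  have C0: "0 \<le> C" using C[of 0 0] by linarith
  note w' = measurable_curried[OF w]
  have Pm: "(\<lambda>((L, x), y). ?P d L x y) \<in> borel_measurable ((seq_space \<Otimes>\<^sub>M borel) \<Otimes>\<^sub>M borel)" for d
    unfolding split_beta'
  proof (intro borel_measurable_times w')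
    show "(\<lambda>p. of_bool (passes_below d (X - snd (fst p)) (Y - snd p) (fst (fst p))) :: real)
        \<in> borel_measurable ((seq_space \<Otimes>\<^sub>M borel) \<Otimes>\<^sub>M borel)"
      by (rule measurable_compose[OF pred_passes_below, where L=borel]) measurable
  qed measurable
  have Pb: "\<bar>?P d L x y\<bar> \<le> C" for d L x y
    using C[of x y] C0 by simp
  have Jb: "\<bar>?J d L\<bar> \<le> C * (Y - 0) * (X - 0)" for d L
    using XY Pb by (intro abs_set_integral_le) auto
  have Jm: "?J d \<in> borel_measurable seq_space" for d
  proof -
    interpret Q: prob_space "length_law a b" by (rule prob_space_length_law[OF ab])
    have "(\<lambda>((L, x), y). ?P d L x y) \<in> borel_measurable ((length_law a b \<Otimes>\<^sub>M borel) \<Otimes>\<^sub>M borel)"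
      using Pm by (simp cong: measurable_cong_sets)
    from Q.expectation_iterated_integral(2)[OF this Pb XY(2)] show ?thesis
      by (simp cong: measurable_cong_sets)
  qed
  have EJ: "(\<integral>L. ?J d L \<partial>length_law p q) = (LBINT x:{0..X}. LBINT y:{0..Y}.
      (\<integral>L. of_bool (passes_below d (X - x) (Y - y) L) \<partial>length_law p q) * w x y)"
    if pq: "0 < p" "0 < q" for d p q
  proof -
    interpret Q: prob_space "length_law p q" by (rule prob_space_length_law[OF pq])
    have "(\<lambda>((L, x), y). ?P d L x y) \<in> borel_measurable ((length_law p q \<Otimes>\<^sub>M borel) \<Otimes>\<^sub>M borel)"
      using Pm by (simp cong: measurable_cong_sets)
    from Q.expectation_iterated_integral(1)[OF this Pb XY(2)] show ?thesis by simp
  qed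
  have v: "integrable M (\<lambda>\<omega>. ?J Vertical (Lv \<omega>))" "(\<integral>\<omega>. ?J Vertical (Lv \<omega>) \<partial>M) = (\<integral>L. ?J Vertical L \<partial>length_law a b)"
    by (rule integral_via_law[OF Lv Jm AE_I2[OF Jb]])+
  have h: "integrable M (\<lambda>\<omega>. ?J Horizontal (Lh \<omega>))" "(\<integral>\<omega>. ?J Horizontal (Lh \<omega>) \<partial>M) = (\<integral>L. ?J Horizontal L \<partial>length_law b a)"
    by (rule integral_via_law[OF Lh Jm AE_I2[OF Jb]])+
  have "AE \<omega> in M. regular (Lv \<omega>)"
    using AE_regular[OF ab] Lv by (metis AE_distrD)
  moreover have "AE \<omega> in M. regular (Lh \<omega>)"
    using AE_regular[OF ab(2,1)] Lh by (metis AE_distrD)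
  ultimately have J_eq: "AE \<omega> in M. J \<omega> = ?J Vertical (Lv \<omega>) - ?J Horizontal (Lh \<omega>)"
    by eventually_elim (use integral_I_between[OF _ _ XY(2) w C] in \<open>simp add: J_def\<close>)
  have Fm: "(\<lambda>((\<omega>, x), y). I_between (X, Y) (walk (X, Y) Horizontal (Lh \<omega>)) (walk (X, Y) Vertical (Lv \<omega>)) x y * w x y)
      \<in> borel_measurable ((M \<Otimes>\<^sub>M borel) \<Otimes>\<^sub>M borel)"
    unfolding split_beta'
    by (intro borel_measurable_times w' measurable_I_between
        measurable_compose[OF _ Lh(1)] measurable_compose[OF _ Lv(1)]) measurable
  have Fb: "\<bar>I_between (X, Y) (walk (X, Y) Horizontal (Lh \<omega>)) (walk (X, Y) Vertical (Lv \<omega>)) x y * w x y\<bar> \<le> C" for \<omega> x y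
    using mult_mono[OF abs_I_between_le C zero_le_one abs_ge_zero] unfolding abs_mult mult_1 .
  have J_meas: "J \<in> borel_measurable M"
    unfolding J_def by (rule expectation_iterated_integral(2)[OF Fm Fb XY(2)])
  show "integrable M J"
    using Bochner_Integration.integrable_diff[OF v(1) h(1)] J_eq J_meas
    by (subst integrable_cong_AE[where g="\<lambda>\<omega>. ?J Vertical (Lv \<omega>) - ?J Horizontal (Lh \<omega>)"]) auto
  have "(\<integral>\<omega>. J \<omega> \<partial>M) = (\<integral>\<omega>. ?J Vertical (Lv \<omega>) - ?J Horizontal (Lh \<omega>) \<partial>M)"
    using J_eq J_meas Bochner_Integration.integrable_diff[OF v(1) h(1)]
    by (intro integral_cong_AE) auto
  also have "\<dots> = (\<integral>L. ?J Vertical L \<partial>length_law a b) - (\<integral>L. ?J Horizontal L \<partial>length_law b a)"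
    unfolding Bochner_Integration.integral_diff[OF v(1) h(1)] v(2) h(2) ..
  also have "\<dots> = (LBINT x:{0..X}. LBINT y:{0..Y}. (\<integral>L. of_bool (passes_below Vertical (X - x) (Y - y) L) \<partial>length_law a b) * w x y)
    + (- 1) * (LBINT x:{0..X}. LBINT y:{0..Y}. (\<integral>L. of_bool (passes_below Horizontal (X - x) (Y - y) L) \<partial>length_law b a) * w x y)"
    unfolding EJ[OF ab] EJ[OF ab(2,1)] by simp
  also have "\<dots> = (LBINT x:{0..X}. LBINT y:{0..Y}.
      (\<integral>L. of_bool (passes_below Vertical (X - x) (Y - y) L) \<partial>length_law a b) * w x y
      + (- 1) * ((\<integral>L. of_bool (passes_below Horizontal (X - x) (Y - y) L) \<partial>length_law b a) * w x y))"
  proof (rule iterated_integral_add_scaled[symmetric])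
    interpret R: renewal_pair a b 1 "\<lambda>x y L. of_bool (passes_below Vertical x y L)"
      "\<lambda>x y L. of_bool (passes_below Horizontal x y L)" "\<lambda>_. 1"
      by (rule renewal_pair_passes_below[OF ab])
    have shift: "(\<lambda>(x, y). E (X - x) (Y - y) * w x y) \<in> borel_measurable (borel \<Otimes>\<^sub>M borel)"
      if "(\<lambda>(x, y). E x y) \<in> borel_measurable (borel \<Otimes>\<^sub>M borel)" for E :: "real \<Rightarrow> real \<Rightarrow> real"
    proof -
      have "(\<lambda>p. (X - fst p, Y - snd p)) \<in> measurable (borel \<Otimes>\<^sub>M borel) (borel \<Otimes>\<^sub>M borel)" by measurable
      from measurable_compose[OF this that] w show ?thesis by (simp add: split_beta')
    qed
    show "(\<lambda>(x, y). (\<integral>L. of_bool (passes_below Vertical (X - x) (Y - y) L) \<partial>length_law a b) * w x y) \<in> borel_measurable (borel \<Otimes>\<^sub>M borel)"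
      "(\<lambda>(x, y). (\<integral>L. of_bool (passes_below Horizontal (X - x) (Y - y) L) \<partial>length_law b a) * w x y) \<in> borel_measurable (borel \<Otimes>\<^sub>M borel)"
      using shift[OF R.EV_measurable] shift[OF R.EH_measurable] by (simp_all only: R.EV_def R.EH_def)
    show "\<bar>(\<integral>L. of_bool (passes_below Vertical (X - x) (Y - y) L) \<partial>length_law a b) * w x y\<bar> \<le> 1 * C"
      "\<bar>(\<integral>L. of_bool (passes_below Horizontal (X - x) (Y - y) L) \<partial>length_law b a) * w x y\<bar> \<le> 1 * C" for x y
      unfolding abs_mult
      by (rule mult_mono[OF R.EV_bounded[unfolded R.EV_def] C zero_le_one abs_ge_zero]
               mult_mono[OF R.EH_bounded[unfolded R.EH_def] C zero_le_one abs_ge_zero])+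
  qed (rule XY(2))
  also have "\<dots> = (LBINT x:{0..X}. LBINT y:{0..Y}. D (X - x) (Y - y) * w x y)"
    unfolding D_def by (simp add: left_diff_distrib)
  finally show "(\<integral>\<omega>. J \<omega> \<partial>M) = (LBINT x:{0..X}. LBINT y:{0..Y}. D (X - x) (Y - y) * w x y)" .
qed

section \<open>The stochastic representation\<close>

lemma set_integral_diff_sum3:
  fixes f g1 g2 g3 :: "real \<Rightarrow> real"
  assumes "set_integrable lborel A f" "set_integrable lborel A g1" "set_integrable lborel A g2" "set_integrable lborel A g3"
  shows "(LBINT r:A. f r - (g1 r + g2 r + g3 r)) =
    (LBINT r:A. f r) - ((LBINT r:A. g1 r) + (LBINT r:A. g2 r) + (LBINT r:A. g3 r))"
  using assms by (simp add: set_integral_diff set_integral_add)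

text \<open>Both sides satisfy the same integral equation on the rectangle, so their difference \<open>d\<close> vanishes.\<close>

lemma telegraph_solution_formula:
  fixes u w \<phi> :: "real \<Rightarrow> real \<Rightarrow> real" and chi psi :: "real \<Rightarrow> real"
  assumes ab: "0 < a" "0 < b"
    and u: "continuous_on ({0..} \<times> {0..}) (\<lambda>(x, y). u x y)"
    and chi: "continuous_on {0..} chi" "chi 0 = 0" and psi: "continuous_on {0..} psi"
    and sol: "telegraph_solution b a u chi psi \<phi>"
    and XY: "0 < X" "0 < Y"
    and w: "(\<lambda>(x, y). w x y) \<in> borel_measurable (borel \<Otimes>\<^sub>M borel)" "\<And>x y. \<bar>w x y\<bar> \<le> Cw"
      "\<And>x y. 0 \<le> x \<Longrightarrow> x \<le> X \<Longrightarrow> 0 \<le> y \<Longrightarrow> y \<le> Y \<Longrightarrow> w x y = u x y"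
  defines "hc \<equiv> (\<lambda>x. if 0 \<le> x \<and> x \<le> X then chi x else 0)"
    and "hp \<equiv> (\<lambda>y. if 0 \<le> y \<and> y \<le> Y then psi y else 0)"
    and "D \<equiv> (\<lambda>x y. (\<integral>L. of_bool (passes_below Vertical x y L) \<partial>length_law a b)
      - (\<integral>L. of_bool (passes_below Horizontal x y L) \<partial>length_law b a) :: real)"
  shows "\<phi> X Y = (\<integral>L. hc (abscissa Vertical X Y L) \<partial>length_law a b)
    + (\<integral>L. hp (abscissa Vertical Y X L) \<partial>length_law b a)
    + (LBINT x:{0..X}. LBINT y:{0..Y}. D (X - x) (Y - y) * w x y)"
proof -
  obtain Cc where Cc: "\<And>x. \<bar>hc x\<bar> \<le> Cc" "hc \<in> borel_measurable borel"
    unfolding hc_def using boundary_cutoff[OF chi(1), of X] by metis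
  obtain Cp where Cp: "\<And>y. \<bar>hp y\<bar> \<le> Cp" "hp \<in> borel_measurable borel"
    unfolding hp_def using boundary_cutoff[OF psi, of Y] by metis
  interpret c: renewal_pair a b Cc "\<lambda>x y L. hc (abscissa Vertical x y L)" "\<lambda>x y L. hc (abscissa Horizontal x y L)" hc
    by (rule renewal_pair_abscissa[OF ab Cc(2,1)]) (simp add: hc_def)
  interpret p: renewal_pair b a Cp "\<lambda>x y L. hp (abscissa Vertical x y L)" "\<lambda>x y L. hp (abscissa Horizontal x y L)" hp
    by (rule renewal_pair_abscissa[OF ab(2,1) Cp(2,1)]) (simp add: hp_def)
  have D_eq: "D x y + b * (LBINT r:{0..x}. D r y) + a * (LBINT r:{0..y}. D x r) = 1" if "0 < x" "0 < y" for x y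
    unfolding D_def by (rule passes_below_difference_equation(1)[OF ab that])
  have D_meas: "(\<lambda>(x, y). D x y) \<in> borel_measurable (borel \<Otimes>\<^sub>M borel)"
    unfolding D_def by (rule passes_below_difference_equation(2)[OF ab])
  have D_bd: "\<bar>D x y\<bar> \<le> 2" for x y
    unfolding D_def by (rule passes_below_difference_equation(3)[OF ab])
  define U where "U x y = (LBINT s:{0..x}. LBINT t:{0..y}. D (x - s) (y - t) * w s t)" for x y
  note U_sec = superposition_section_integrable[OF D_meas D_bd w(1,2), folded U_def]
  define d where "d x y = \<phi> x y - (c.EV x y + p.EV y x + U x y)" for x y
  have \<phi>: "continuous_on ({0..} \<times> {0..}) (\<lambda>(x, y). \<phi> x y)"
    and \<phi>0: "\<And>x. 0 \<le> x \<Longrightarrow> \<phi> x 0 = chi x"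
    using sol unfolding telegraph_solution_def by auto
  have f: "continuous_on UNIV (\<lambda>(x, y). \<phi> (max 0 x) (max 0 y))"
    by (rule continuous_clamp[OF \<phi>]) auto
  obtain Cf where Cf: "\<And>x y. 0 \<le> x \<Longrightarrow> x \<le> X \<Longrightarrow> 0 \<le> y \<Longrightarrow> y \<le> Y \<Longrightarrow> \<bar>\<phi> (max 0 x) (max 0 y)\<bar> \<le> Cf"
    using continuous_imp_bounded_rectangle[OF f] by metis
  have \<phi>_sec: "set_integrable lborel {0..x} (\<lambda>r. \<phi> r y)" "set_integrable lborel {0..y} (\<phi> x)"
    if "0 \<le> x" "0 \<le> y" for x y
  proof -
    have "continuous_on {0..x} ((\<lambda>(x, y). \<phi> x y) \<circ> (\<lambda>r. (r, y)))"
      "continuous_on {0..y} ((\<lambda>(x, y). \<phi> x y) \<circ> (\<lambda>r. (x, r)))"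
      by (intro continuous_on_compose continuous_on_subset[OF \<phi>] continuous_intros; use that in auto)+
    then show "set_integrable lborel {0..x} (\<lambda>r. \<phi> r y)" "set_integrable lborel {0..y} (\<phi> x)"
      by (auto intro: borel_integrable_atLeastAtMost' simp: comp_def)
  qed
  have "d X Y = 0"
  proof (rule homogeneous_integral_equation_zero[OF ab, where d=d and A=X and B=Y])
    fix x y assume xy: "0 < x" "x \<le> X" "0 < y" "y \<le> Y"
    have "\<bar>\<phi> x y\<bar> \<le> Cf" using Cf[of x y] xy by simp
    moreover have "\<bar>U x y\<bar> \<le> 2 * Cw * Y * X" using xy by (intro U_sec(1)) auto
    ultimately show "\<bar>d x y\<bar> \<le> Cf + (Cc + Cp + 2 * Cw * Y * X)"
      unfolding d_def using c.EV_bounded[of x y] p.EV_bounded[of y x] by linarith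
    have 1: "(LBINT r:{0..x}. d r y) =
        (LBINT r:{0..x}. \<phi> r y) - ((LBINT r:{0..x}. c.EV r y) + (LBINT r:{0..x}. p.EV y r) + (LBINT r:{0..x}. U r y))"
      unfolding d_def using xy by (intro set_integral_diff_sum3 \<phi>_sec c.slice_integrable p.slice_integrable U_sec) auto
    have 2: "(LBINT r:{0..y}. d x r) =
        (LBINT r:{0..y}. \<phi> x r) - ((LBINT r:{0..y}. c.EV x r) + (LBINT r:{0..y}. p.EV r x) + (LBINT r:{0..y}. U x r))"
      unfolding d_def using xy by (intro set_integral_diff_sum3 \<phi>_sec c.slice_integrable p.slice_integrable U_sec) auto
    have "c.EV x y + b * (LBINT r:{0..x}. c.EV r y) + a * (LBINT r:{0..y}. c.EV x r) = hc x + b * (LBINT r:{0..x}. hc r)"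
      using xy by (intro c.EV_integral_equation Cc) auto
    also have "(LBINT r:{0..x}. hc r) = (LBINT r:{0..x}. chi r)"
      using xy by (intro set_lebesgue_integral_cong) (auto simp: hc_def)
    also have "hc x = chi x" using xy by (simp add: hc_def)
    finally have 3: "c.EV x y + b * (LBINT r:{0..x}. c.EV r y) + a * (LBINT r:{0..y}. c.EV x r) = chi x + b * (LBINT r:{0..x}. chi r)" .
    have "p.EV y x + a * (LBINT r:{0..y}. p.EV r x) + b * (LBINT r:{0..x}. p.EV y r) = hp y + a * (LBINT r:{0..y}. hp r)"
      using xy by (intro p.EV_integral_equation Cp) auto
    also have "(LBINT r:{0..y}. hp r) = (LBINT r:{0..y}. psi r)"
      using xy by (intro set_lebesgue_integral_cong) (auto simp: hp_def)
    also have "hp y = psi y" using xy by (simp add: hp_def)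
    finally have 4: "p.EV y x + a * (LBINT r:{0..y}. p.EV r x) + b * (LBINT r:{0..x}. p.EV y r) = psi y + a * (LBINT r:{0..y}. psi r)" .
    have 5: "U x y + b * (LBINT r:{0..x}. U r y) + a * (LBINT r:{0..y}. U x r) = (LBINT s:{0..x}. LBINT t:{0..y}. w s t)"
      unfolding U_def using xy by (intro superposition_integral_equation[OF D_meas D_bd w(1,2)] D_eq) auto
    have 6: "(LBINT s:{0..x}. LBINT t:{0..y}. w s t) = (LBINT s:{0..x}. LBINT t:{0..y}. u s t)"
      using xy by (intro set_lebesgue_integral_cong allI impI) (auto simp: w)
    show "d x y + b * (LBINT r:{0..x}. d r y) + a * (LBINT r:{0..y}. d x r) = 0"
      using telegraph_integral_equation[OF ab u sol xy(1,3)] 3 4 5 6 chi(2)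
      unfolding 1 2 by (simp add: d_def algebra_simps)
  qed (use XY in auto)
  then show ?thesis by (simp add: d_def U_def c.EV_def p.EV_def)
qed

theorem theorem4p11:
  fixes \<beta>1 \<beta>2 X Y :: real
    and u \<phi> :: "real \<Rightarrow> real \<Rightarrow> real"
    and chi psi :: "real \<Rightarrow> real"
    and M :: "'a measure"
    and Lh Lv :: "nat \<Rightarrow> 'a \<Rightarrow> real"
    and Th Tv :: "'a \<Rightarrow> real \<Rightarrow> real \<times> real"
  assumes "\<beta>1 > 0" "\<beta>2 > 0" "\<beta>1 \<noteq> \<beta>2"
    and "continuous_on ({0..} \<times> {0..}) (\<lambda>(x, y). u x y)"
    and "C1_on_nonneg chi" "C1_on_nonneg psi" "chi 0 = 0" "psi 0 = 0"
    and "telegraph_solution \<beta>1 \<beta>2 u chi psi \<phi>"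
    and "X > 0" "Y > 0"
    and "prob_space M"
    and "poisson_lengths M \<beta>1 \<beta>2 Horizontal Lh"
    and "poisson_lengths M \<beta>1 \<beta>2 Vertical Lv"
    and "prob_space.indep_var M
           (\<Pi>\<^sub>M n\<in>UNIV. borel) (\<lambda>\<omega> n. Lh n \<omega>)
           (\<Pi>\<^sub>M n\<in>UNIV. borel) (\<lambda>\<omega> n. Lv n \<omega>)"
    and "\<And>\<omega>. Th \<omega> = walk (X, Y) Horizontal (\<lambda>n. Lh n \<omega>)"
    and "\<And>\<omega>. Tv \<omega> = walk (X, Y) Vertical (\<lambda>n. Lv n \<omega>)"
  shows "integrable M (\<lambda>\<omega>. zero_ext chi (first_x_axis_abscissa (Tv \<omega>))) \<and>
    integrable M (\<lambda>\<omega>. zero_ext psi (first_y_axis_ordinate (Th \<omega>))) \<and>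
    integrable M (\<lambda>\<omega>. LBINT x:{0..X}. (LBINT y:{0..Y}. I_between (X, Y) (Th \<omega>) (Tv \<omega>) x y * u x y)) \<and>
    \<phi> X Y =
      (\<integral>\<omega>. zero_ext chi (first_x_axis_abscissa (Tv \<omega>)) \<partial>M)
      + (\<integral>\<omega>. zero_ext psi (first_y_axis_ordinate (Th \<omega>)) \<partial>M)
      + (\<integral>\<omega>. (LBINT x:{0..X}. (LBINT y:{0..Y}. I_between (X, Y) (Th \<omega>) (Tv \<omega>) x y * u x y)) \<partial>M)"
proof -
  interpret prob_space M by fact
  note ab = assms(2,1)
  note u = assms(4)
  have chi: "continuous_on {0..} chi" and psi: "continuous_on {0..} psi"
    using assms(5,6) by (auto intro: C1_on_nonneg_continuous)
  let ?lh = "\<lambda>\<omega> n. Lh n \<omega>" and ?lv = "\<lambda>\<omega> n. Lv n \<omega>"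
  have h: "?lh \<in> measurable M seq_space" "distr M seq_space ?lh = length_law \<beta>1 \<beta>2"
    using distr_poisson_lengths[OF assms(12,13)] by simp_all
  have v: "?lv \<in> measurable M seq_space" "distr M seq_space ?lv = length_law \<beta>2 \<beta>1"
    using distr_poisson_lengths[OF assms(12,14)] by simp_all
  define u' where "u' x y = u (max 0 x) (max 0 y)" for x y
  have u': "continuous_on UNIV (\<lambda>(x, y). u' x y)"
    unfolding u'_def by (rule continuous_clamp[OF u]) auto
  obtain Cu where Cu: "\<And>x y. 0 \<le> x \<Longrightarrow> x \<le> X \<Longrightarrow> 0 \<le> y \<Longrightarrow> y \<le> Y \<Longrightarrow> \<bar>u' x y\<bar> \<le> Cu"
    using continuous_imp_bounded_rectangle[OF u'] by metis
  \<comment> \<open>Cutting \<open>u\<close> off outside the rectangle of integration gives a bounded function on the plane.\<close>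
  define w where "w x y = (if 0 \<le> x \<and> x \<le> X \<and> 0 \<le> y \<and> y \<le> Y then u' x y else 0)" for x y
  have w: "(\<lambda>(x, y). w x y) \<in> borel_measurable (borel \<Otimes>\<^sub>M borel)" "\<And>x y. \<bar>w x y\<bar> \<le> \<bar>Cu\<bar>"
    "\<And>x y. 0 \<le> x \<Longrightarrow> x \<le> X \<Longrightarrow> 0 \<le> y \<Longrightarrow> y \<le> Y \<Longrightarrow> w x y = u x y"
  proof -
    have [measurable]: "(\<lambda>p. u' (fst p) (snd p)) \<in> borel_measurable (borel \<Otimes>\<^sub>M borel)"
      using continuous_imp_measurable_pair[OF u'] by (simp add: split_beta')
    show "(\<lambda>(x, y). w x y) \<in> borel_measurable (borel \<Otimes>\<^sub>M borel)"
      unfolding w_def split_beta' by measurable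
    show "\<bar>w x y\<bar> \<le> \<bar>Cu\<bar>" for x y
      using Cu[of x y] by (auto simp: w_def)
  qed (simp add: w_def u'_def)
  have Tv: "first_x_axis_abscissa (Tv \<omega>) = abscissa Vertical X Y (?lv \<omega>)" for \<omega>
    by (simp add: assms(17) abscissa_def)
  have Th: "first_y_axis_ordinate (Th \<omega>) = abscissa Vertical Y X (?lh \<omega>)" for \<omega>
    by (simp add: assms(16) first_y_axis_ordinate_eq)
  have J: "(LBINT x:{0..X}. (LBINT y:{0..Y}. I_between (X, Y) (Th \<omega>) (Tv \<omega>) x y * u x y)) =
    (LBINT x:{0..X}. LBINT y:{0..Y}. I_between (X, Y) (walk (X, Y) Horizontal (?lh \<omega>)) (walk (X, Y) Vertical (?lv \<omega>)) x y * w x y)" for \<omega>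
    by (intro set_lebesgue_integral_cong allI impI) (auto simp: w assms(16,17))
  note B1 = boundary_expectation[OF ab chi order_refl less_imp_le[OF assms(11)] v]
  note B2 = boundary_expectation[OF ab(2,1) psi order_refl less_imp_le[OF assms(10)] h]
  note B3 = between_expectation[OF ab less_imp_le[OF assms(10)] less_imp_le[OF assms(11)] v h w(1,2)]
  have "\<phi> X Y =
      (\<integral>\<omega>. zero_ext chi (abscissa Vertical X Y (?lv \<omega>)) \<partial>M)
      + (\<integral>\<omega>. zero_ext psi (abscissa Vertical Y X (?lh \<omega>)) \<partial>M)
      + (\<integral>\<omega>. (LBINT x:{0..X}. LBINT y:{0..Y}. I_between (X, Y) (walk (X, Y) Horizontal (?lh \<omega>)) (walk (X, Y) Vertical (?lv \<omega>)) x y * w x y) \<partial>M)"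
    unfolding B1(2) B2(2) B3(2)
    by (rule telegraph_solution_formula[OF ab u chi assms(7) psi assms(9,10,11) w])
  with B1(1) B2(1) B3(1) show ?thesis
    unfolding Tv Th J by blast
qed

end
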